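(* Let $n\ge 1$, let $\phi\in\mathrm{Aut}(F_n)$, let $w_i$ be the reduced word representing $\phi(x_i)$ for $1\le i\le n$, and let $N=\left(\sum_{i=1}^n|w_i|\right)-n$, where $|w_i|$ is the length of $w_i$. Then there is a finite sequence $\mathcal{G}_1,\mathcal{G}_2,\ldots,\mathcal{G}_k$ of branded graphs, with $\mathcal{G}_j=(G_j,f_j,b_j,\{e_1^j,\ldots,e_n^j\})$, such that: (1) $\mathcal{G}_1$ is the subdivided rose of $\phi$, so that $\phi_{\mathcal{G}_1}=\phi$; (2) for each $1\le j<k$, $\mathcal{G}_{j+1}$ is obtained from $\mathcal{G}_j$ either by a branded fold or by an edge swap; exactly $N$ of these moves are branded folds, each branded fold is immediately preceded by at most two consecutive edge swaps, and there are no edge swaps after the last branded fold; (3) for each $1\le j<k$, the automorphism $\phi_{\mathcal{G}_{j+1}}^{-1}\phi_{\mathcal{G}_j}$ is either the identity or a Whitehead automorphism of the form $(A,a)$; (4) $f_k$ is an isomorphism of graphs and $\phi_{\mathcal{G}_k}\in W_n$. Consequently $$\phi=\phi_{\mathcal{G}_k}\,(\phi_{\mathcal{G}_k}^{-1}\phi_{\mathcal{G}_{k-1}})\cdots(\phi_{\mathcal{G}_3}^{-1}\phi_{\mathcal{G}_2})(\phi_{\mathcal{G}_2}^{-1}\phi_{\mathcal{G}_1})$$ is a decomposition of $\phi$ as a product of Whitehead automorphisms.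
   Context: Graphs. A graph $G$ consists of an edge set $EG$, a vertex set $VG$, a fixed-point-free involution $e\mapsto\bar e$ of $EG$, and maps $\iota,\tau:EG\to VG$ (initial and terminal vertex) with $\iota(\bar e)=\tau(e)$. All graphs are connected. A path is either a single vertex or a sequence of edges $e_1,\ldots,e_k$ with $\iota(e_{i+1})=\tau(e_i)$; it is reduced if it contains no consecutive pair $e,\bar e$; $\bar p$ denotes the reverse path. $\pi_1(G,v)$ is the group of reduced paths from $v$ to $v$ under concatenation followed by reduction. A maximal tree $T$ of $G$ is a subgraph that is a tree (connected with trivial $\pi_1$) and contains all vertices. Given a base vertex $b$ and a maximal tree $T$, $p_v$ denotes the unique reduced path in $T$ from $b$ to $v$. A map of graphs sends vertices to vertices, edges to edges and commutes with $\iota$ and $e\mapsto \bar e$; it is a homotopy equivalence if it induces an isomorphism on $\pi_1$, and a graph isomorphism if it is bijective on edges and vertices. Rose. $R_n$ is the graph with a single vertex $b_R$ and edges $x_1,\bar x_1,\ldots,x_n,\bar x_n$. The free group $F_n$ on $X=\{x_1,\ldots,x_n\}$ is identified with $\pi_1(R_n,b_R)$, $x_i$ corresponding to the edge $x_i$. $\mathrm{Aut}(F_n)$ acts on the left, so $\alpha\beta$ means apply $\beta$ first. Branded graphs. A branded graph is a tuple $\mathcal{G}=(G,f,b,\{e_1,\ldots,e_n\})$ where $f:G\to R_n$ is a homotopy equivalence, $b$ is a vertex of $G$, and $e_1,\ldots,e_n$ is an ordered choice of one edge from each pair $\{e,\bar e\}$ of edges outside some maximal tree $T$ of $G$ (so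 $T$ is $G$ with all $e_i,\bar e_i$ removed). With $l_i=p_{\iota(e_i)}\,e_i\,\overline{p_{\tau(e_i)}}$, the loops $l_1,\ldots,l_n$ form a basis of $\pi_1(G,b)$, and the associated automorphism $\phi_{\mathcal{G}}\in\mathrm{Aut}(F_n)$ is defined by $\phi_{\mathcal{G}}(x_i)=f_*(l_i)$. Subdivided rose of $\phi$. $G$ is the rose with $n$ loops at a central vertex $b$ with the $i$th loop subdivided into $|w_i|$ edges (pairs $e,\bar e$), $f$ maps the $i$th loop to the edge path $w_i$ in $R_n$, and $e_i$ is an edge of the $i$th loop oriented in the direction of $w_i$ (any such choice). Branded fold. Given a branded graph $\mathcal{G}=(G,f,b,\{e_1,\ldots,e_n\})$ with maximal tree $T$, and two distinct edges $s_1,s_2$ with $\iota(s_1)=\iota(s_2)$ and $f(s_1)=f(s_2)$, let $q:G\to G'$ be the quotient identifying $s_1$ with $s_2$, $\bar s_1$ with $\bar s_2$, and $\tau(s_1)$ with $\tau(s_2)$, and let $f':G'\to R_n$ be the induced map with $f'q=f$. It is a branded fold if either (type 1) $\iota(s_1),\tau(s_1),\tau(s_2)$ are pairwise distinct and $s_1,s_2$ both lie in $T$, or (type 2) one of $s_1,s_2$ has distinct endpoints and lies in $T$, while the other is a loop. The result is the branded graph $\mathcal{G}'=(G',f',q(b),\{q(e_1),\ldots,q(e_n)\})$. Edge swap. Given a branded graph $\mathcal{G}=(G,f,b,\{e_1,\ldots,e_n\})$ and an index $i$ such that $e_i$ has distinct endpoints, let $a$ be the longest common initial segment of $p_{\iota(e_i)}$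 and $p_{\tau(e_i)}$, and choose an edge $e_i'$ such that either $e_i'$ occurs in the part of $p_{\iota(e_i)}$ after $a$, or $\overline{e_i'}$ occurs in the part of $p_{\tau(e_i)}$ after $a$. The result is the branded graph obtained by replacing $e_i$ by $e_i'$, i.e. $(G,f,b,\{e_1,\ldots,e_i',\ldots,e_n\})$. Whitehead automorphisms. $W_n$ is the group of automorphisms $\psi$ of $F_n$ for which there are $\sigma\in S_n$ and $\epsilon_i\in\{1,-1\}$ with $\psi(x_i)=x_{\sigma(i)}^{\epsilon_i}$ for all $i$. For $a\in X\cup X^{-1}$ and $A\subset X\cup X^{-1}$ with $a\in A$, $a^{-1}\notin A$, the automorphism $(A,a)$ is defined by $(A,a)(x_j)=x_j$ if $x_j=a^{\pm1}$ and $(A,a)(x_j)=a^{\alpha_j}x_ja^{-\beta_j}$ otherwise, where $\alpha_j=\chi_A(x_j)$, $\beta_j=\chi_A(x_j^{-1})$ and $\chi_A$ is the indicator function of $A$. Whitehead automorphisms are the elements of $W_n$ and the automorphisms $(A,a)$. *)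

theory Defs
  imports
    "HOL-Algebra.Bij"
    "HOL-Combinatorics.Permutations"
    "HOL-Library.Sublist"
    "Graph_Theory.Graph_Theory"
begin

section \<open>Graphs with edge inversion\<close>

text \<open>The initial and terminal vertex of an edge are \<open>tail\<close> and \<open>head\<close>, and \<open>bar\<close> is the
  involution of the edge set. As in \<^locale>\<open>bidirected_digraph\<close>, \<open>bar\<close> is required to fix
  everything that is not an edge.\<close>

record ('v, 'e) bar_graph = "('v, 'e) pre_digraph" +
  bar :: "'e \<Rightarrow> 'e"

abbreviation dig :: "('v, 'e) bar_graph \<Rightarrow> ('v, 'e) pre_digraph" where
  "dig G \<equiv> pre_digraph.truncate G"

text \<open>Graphs are connected. As the edge set is closed under inversion, strong connectedness of
  the digraph says that any two vertices are joined by a path (and that there is a vertex).\<close>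

definition is_graph :: "('v, 'e) bar_graph \<Rightarrow> bool" where
  "is_graph G \<longleftrightarrow> bidirected_digraph (dig G) (bar G) \<and> strongly_connected (dig G)"

text \<open>A path is its list of edges; the single-vertex paths are the empty list, the vertex being
  recorded by the end points.\<close>

abbreviation path_from_to :: "('v, 'e) bar_graph \<Rightarrow> 'v \<Rightarrow> 'e list \<Rightarrow> 'v \<Rightarrow> bool" where
  "path_from_to G u p v \<equiv> pre_digraph.awalk (dig G) u p v"

definition reduced :: "('v, 'e) bar_graph \<Rightarrow> 'e list \<Rightarrow> bool" where
  "reduced G p \<longleftrightarrow> successively (\<lambda>e e'. e' \<noteq> bar G e) p"

definition rev_path :: "('v, 'e) bar_graph \<Rightarrow> 'e list \<Rightarrow> 'e list" where
  "rev_path G p = rev (map (bar G) p)"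

fun reduce :: "('v, 'e) bar_graph \<Rightarrow> 'e list \<Rightarrow> 'e list" where
  "reduce G [] = []"
| "reduce G (e # p) =
     (case reduce G p of
        [] \<Rightarrow> [e]
      | e' # p' \<Rightarrow> if e' = bar G e then p' else e # e' # p')"

definition pi1 :: "('v, 'e) bar_graph \<Rightarrow> 'v \<Rightarrow> 'e list monoid" where
  "pi1 G v =
    \<lparr>carrier = {p. path_from_to G v p v \<and> reduced G p},
     Group.monoid.mult = (\<lambda>p q. reduce G (p @ q)),
     one = []\<rparr>"

definition is_tree :: "('v, 'e) bar_graph \<Rightarrow> bool" where
  "is_tree T \<longleftrightarrow> is_graph T \<and> (\<forall>v \<in> verts T. carrier (pi1 T v) = {[]})"

definition maximal_tree :: "('v, 'e) bar_graph \<Rightarrow> ('v, 'e) bar_graph \<Rightarrow> bool" where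
  "maximal_tree T G \<longleftrightarrow>
     is_tree T \<and> spanning (dig T) (dig G) \<and> (\<forall>e \<in> arcs T. bar T e = bar G e)"

definition tree_path :: "('v, 'e) bar_graph \<Rightarrow> 'v \<Rightarrow> 'v \<Rightarrow> 'e list" where
  "tree_path T b v = (THE p. path_from_to T b p v \<and> reduced T p)"


section \<open>Maps of graphs\<close>

record ('v, 'e, 'w, 'd) graph_map =
  vmap :: "'v \<Rightarrow> 'w"
  emap :: "'e \<Rightarrow> 'd"

definition is_graph_map ::
  "('v, 'e) bar_graph \<Rightarrow> ('w, 'd) bar_graph \<Rightarrow> ('v, 'e, 'w, 'd) graph_map \<Rightarrow> bool" where
  "is_graph_map G H f \<longleftrightarrow>
     vmap f \<in> verts G \<rightarrow> verts H \<and> emap f \<in> arcs G \<rightarrow> arcs H \<and>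
     (\<forall>e \<in> arcs G. tail H (emap f e) = vmap f (tail G e) \<and> emap f (bar G e) = bar H (emap f e))"

definition induced_map ::
  "('w, 'd) bar_graph \<Rightarrow> ('v, 'e, 'w, 'd) graph_map \<Rightarrow> 'e list \<Rightarrow> 'd list" where
  "induced_map H f p = reduce H (map (emap f) p)"

definition homotopy_equivalence ::
  "('v, 'e) bar_graph \<Rightarrow> ('w, 'd) bar_graph \<Rightarrow> ('v, 'e, 'w, 'd) graph_map \<Rightarrow> bool" where
  "homotopy_equivalence G H f \<longleftrightarrow>
     is_graph_map G H f \<and>
     (\<forall>v \<in> verts G. induced_map H f \<in> iso (pi1 G v) (pi1 H (vmap f v)))"

definition graph_isomorphism ::
  "('v, 'e) bar_graph \<Rightarrow> ('w, 'd) bar_graph \<Rightarrow> ('v, 'e, 'w, 'd) graph_map \<Rightarrow> bool" where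
  "graph_isomorphism G H f \<longleftrightarrow>
     is_graph_map G H f \<and>
     bij_betw (vmap f) (verts G) (verts H) \<and> bij_betw (emap f) (arcs G) (arcs H)"


section \<open>The rose and the free group\<close>

text \<open>Generators are indexed by \<open>0, \<dots>, n - 1\<close>. The letter \<open>(i, True)\<close> is the generator with
  index \<open>i\<close> and \<open>(i, False)\<close> is its inverse.\<close>

type_synonym letter = "nat \<times> bool"

definition letters :: "nat \<Rightarrow> letter set" where
  "letters n = {..<n} \<times> UNIV"

definition rose :: "nat \<Rightarrow> (unit, letter) bar_graph" where
  "rose n =
    \<lparr>verts = {()}, arcs = letters n, tail = (\<lambda>_. ()), head = (\<lambda>_. ()),
     bar = perm_restrict (\<lambda>(i, s). (i, \<not> s)) (letters n)\<rparr>"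

definition free_grp :: "nat \<Rightarrow> letter list monoid" where
  "free_grp n = pi1 (rose n) ()"

text \<open>The endomorphism of the free group that sends the generator with index \<open>i\<close> to \<open>g i\<close>.\<close>

definition free_ext :: "nat \<Rightarrow> (nat \<Rightarrow> letter list) \<Rightarrow> letter list \<Rightarrow> letter list" where
  "free_ext n g =
    (\<lambda>w \<in> carrier (free_grp n).
       foldr (\<lambda>(i, s) u. (if s then g i else inv\<^bsub>free_grp n\<^esub> (g i)) \<otimes>\<^bsub>free_grp n\<^esub> u)
         w \<one>\<^bsub>free_grp n\<^esub>)"

text \<open>Multiplication in \<^const>\<open>AutoGroup\<close> is composition, the right factor being applied first.\<close>

abbreviation aut_free :: "nat \<Rightarrow> (letter list \<Rightarrow> letter list) monoid" where
  "aut_free n \<equiv> AutoGroup (free_grp n)"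


section \<open>Whitehead automorphisms\<close>

definition signed_perm_auts :: "nat \<Rightarrow> (letter list \<Rightarrow> letter list) set" where
  "signed_perm_auts n =
    {\<psi> \<in> carrier (aut_free n).
       \<exists>\<sigma> \<epsilon>. \<sigma> permutes {..<n} \<and> (\<forall>i<n. \<psi> [(i, True)] = [(\<sigma> i, \<epsilon> i)])}"

definition whitehead_pair :: "nat \<Rightarrow> letter set \<Rightarrow> letter \<Rightarrow> bool" where
  "whitehead_pair n A a \<longleftrightarrow> A \<subseteq> letters n \<and> a \<in> A \<and> bar (rose n) a \<notin> A"

definition whitehead_aut :: "nat \<Rightarrow> letter set \<Rightarrow> letter \<Rightarrow> letter list \<Rightarrow> letter list" where
  "whitehead_aut n A a =
    free_ext n
      (\<lambda>j. if a = (j, True) \<or> bar (rose n) a = (j, True) then [(j, True)]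
           else ([a] [^]\<^bsub>free_grp n\<^esub> (of_bool ((j, True) \<in> A) :: nat))
                \<otimes>\<^bsub>free_grp n\<^esub> [(j, True)]
                \<otimes>\<^bsub>free_grp n\<^esub>
                inv\<^bsub>free_grp n\<^esub> ([a] [^]\<^bsub>free_grp n\<^esub> (of_bool ((j, False) \<in> A) :: nat)))"

definition whitehead_pair_auts :: "nat \<Rightarrow> (letter list \<Rightarrow> letter list) set" where
  "whitehead_pair_auts n = {whitehead_aut n A a | A a. whitehead_pair n A a}"

definition whitehead_automorphisms :: "nat \<Rightarrow> (letter list \<Rightarrow> letter list) set" where
  "whitehead_automorphisms n = signed_perm_auts n \<union> whitehead_pair_auts n"


section \<open>Branded graphs\<close>

record ('v, 'e) branded =
  ugraph :: "('v, 'e) bar_graph"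
  marking :: "('v, 'e, unit, letter) graph_map"
  base :: 'v
  brands :: "'e list"

text \<open>The graph with the \<open>brands\<close> and their inverses removed.\<close>

definition brand_tree :: "('v, 'e) branded \<Rightarrow> ('v, 'e) bar_graph" where
  "brand_tree \<G> =
    (let G = ugraph \<G>; A = arcs G - (set (brands \<G>) \<union> bar G ` set (brands \<G>))
     in G\<lparr>arcs := A, bar := perm_restrict (bar G) A\<rparr>)"

definition branded_graph :: "nat \<Rightarrow> ('v, 'e) branded \<Rightarrow> bool" where
  "branded_graph n \<G> \<longleftrightarrow>
     is_graph (ugraph \<G>) \<and>
     homotopy_equivalence (ugraph \<G>) (rose n) (marking \<G>) \<and>
     base \<G> \<in> verts (ugraph \<G>) \<and>
     length (brands \<G>) = n \<and> set (brands \<G>) \<subseteq> arcs (ugraph \<G>) \<and>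
     (\<forall>i<n. \<forall>j<n. i \<noteq> j \<longrightarrow>
        brands \<G> ! i \<noteq> brands \<G> ! j \<and> brands \<G> ! i \<noteq> bar (ugraph \<G>) (brands \<G> ! j)) \<and>
     maximal_tree (brand_tree \<G>) (ugraph \<G>)"

abbreviation base_path :: "('v, 'e) branded \<Rightarrow> 'v \<Rightarrow> 'e list" where
  "base_path \<G> v \<equiv> tree_path (brand_tree \<G>) (base \<G>) v"

definition brand_loop :: "('v, 'e) branded \<Rightarrow> nat \<Rightarrow> 'e list" where
  "brand_loop \<G> i =
    (let G = ugraph \<G>; e = brands \<G> ! i
     in base_path \<G> (tail G e) @ [e] @ rev_path G (base_path \<G> (head G e)))"

definition assoc_aut :: "nat \<Rightarrow> ('v, 'e) branded \<Rightarrow> letter list \<Rightarrow> letter list" where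
  "assoc_aut n \<G> = free_ext n (\<lambda>i. induced_map (rose n) (marking \<G>) (brand_loop \<G> i))"


section \<open>The subdivided rose of an automorphism\<close>

datatype sr_vertex = Centre | Inner nat nat

text \<open>\<open>((i, j), True)\<close> is the edge in position \<open>j\<close> on the loop with index \<open>i\<close>, oriented along the
  loop, and \<open>((i, j), False)\<close> is its inverse.\<close>

type_synonym sr_edge = "(nat \<times> nat) \<times> bool"

definition sr_point :: "(nat \<Rightarrow> 'a list) \<Rightarrow> nat \<Rightarrow> nat \<Rightarrow> sr_vertex" where
  "sr_point w i j = (if j = 0 \<or> j = length (w i) then Centre else Inner i j)"

definition sr_graph :: "nat \<Rightarrow> (nat \<Rightarrow> letter list) \<Rightarrow> (sr_vertex, sr_edge) bar_graph" where
  "sr_graph n w =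
    (let A = {((i, j), s). i < n \<and> j < length (w i)}
     in \<lparr>verts = insert Centre {Inner i j | i j. i < n \<and> 0 < j \<and> j < length (w i)},
         arcs = A,
         tail = (\<lambda>((i, j), s). sr_point w i (if s then j else Suc j)),
         head = (\<lambda>((i, j), s). sr_point w i (if s then Suc j else j)),
         bar = perm_restrict (\<lambda>(x, s). (x, \<not> s)) A\<rparr>)"

definition sr_marking ::
  "nat \<Rightarrow> (nat \<Rightarrow> letter list) \<Rightarrow> (sr_vertex, sr_edge, unit, letter) graph_map" where
  "sr_marking n w =
    \<lparr>vmap = (\<lambda>_. ()),
     emap = (\<lambda>((i, j), s). if s then w i ! j else bar (rose n) (w i ! j))\<rparr>"

text \<open>\<open>c i\<close> is the position of the edge chosen on the loop with index \<open>i\<close>.\<close>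

definition subdivided_rose ::
  "nat \<Rightarrow> (letter list \<Rightarrow> letter list) \<Rightarrow> (nat \<Rightarrow> nat) \<Rightarrow> (sr_vertex, sr_edge) branded" where
  "subdivided_rose n \<phi> c =
    (let w = (\<lambda>i. \<phi> [(i, True)])
     in \<lparr>ugraph = sr_graph n w, marking = sr_marking n w, base = Centre,
         brands = map (\<lambda>i. ((i, c i), True)) [0..<n]\<rparr>)"


section \<open>Branded folds and edge swaps\<close>

text \<open>\<open>q\<close> presents \<open>G'\<close> as the quotient of \<open>G\<close> by the identifications of \<open>s1\<close> with \<open>s2\<close>, of their
  inverses and of their terminal vertices.\<close>

definition fold_quotient ::
  "('v, 'e) bar_graph \<Rightarrow> 'e \<Rightarrow> 'e \<Rightarrow> ('w, 'd) bar_graph \<Rightarrow> ('v, 'e, 'w, 'd) graph_map \<Rightarrow> bool" where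
  "fold_quotient G s1 s2 G' q \<longleftrightarrow>
     is_graph_map G G' q \<and> vmap q ` verts G = verts G' \<and> emap q ` arcs G = arcs G' \<and>
     (\<forall>u \<in> verts G. \<forall>v \<in> verts G. vmap q u = vmap q v \<longleftrightarrow>
        equivclp (\<lambda>x y. x = head G s1 \<and> y = head G s2) u v) \<and>
     (\<forall>d \<in> arcs G. \<forall>e \<in> arcs G. emap q d = emap q e \<longleftrightarrow>
        equivclp (\<lambda>x y. x = s1 \<and> y = s2 \<or> x = bar G s1 \<and> y = bar G s2) d e)"

definition fold_type1 :: "('v, 'e) branded \<Rightarrow> 'e \<Rightarrow> 'e \<Rightarrow> bool" where
  "fold_type1 \<G> s1 s2 \<longleftrightarrow>
     distinct [tail (ugraph \<G>) s1, head (ugraph \<G>) s1, head (ugraph \<G>) s2] \<and>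
     s1 \<in> arcs (brand_tree \<G>) \<and> s2 \<in> arcs (brand_tree \<G>)"

definition fold_type2 :: "('v, 'e) branded \<Rightarrow> 'e \<Rightarrow> 'e \<Rightarrow> bool" where
  "fold_type2 \<G> s t \<longleftrightarrow>
     tail (ugraph \<G>) s \<noteq> head (ugraph \<G>) s \<and> s \<in> arcs (brand_tree \<G>) \<and>
     tail (ugraph \<G>) t = head (ugraph \<G>) t"

definition branded_fold :: "('v, 'e) branded \<Rightarrow> ('w, 'd) branded \<Rightarrow> bool" where
  "branded_fold \<G> \<G>' \<longleftrightarrow>
    (let G = ugraph \<G>; f = marking \<G>; f' = marking \<G>'
     in \<exists>s1 \<in> arcs G. \<exists>s2 \<in> arcs G. \<exists>q.
          s1 \<noteq> s2 \<and> tail G s1 = tail G s2 \<and> emap f s1 = emap f s2 \<and>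
          (fold_type1 \<G> s1 s2 \<or> fold_type2 \<G> s1 s2 \<or> fold_type2 \<G> s2 s1) \<and>
          fold_quotient G s1 s2 (ugraph \<G>') q \<and>
          (\<forall>v \<in> verts G. vmap f' (vmap q v) = vmap f v) \<and>
          (\<forall>e \<in> arcs G. emap f' (emap q e) = emap f e) \<and>
          base \<G>' = vmap q (base \<G>) \<and>
          brands \<G>' = map (emap q) (brands \<G>))"

definition edge_swap :: "('v, 'e) branded \<Rightarrow> ('v, 'e) branded \<Rightarrow> bool" where
  "edge_swap \<G> \<G>' \<longleftrightarrow>
    (\<exists>i < length (brands \<G>). \<exists>e'.
       let G = ugraph \<G>; e = brands \<G> ! i;
           p = base_path \<G> (tail G e); p' = base_path \<G> (head G e);
           a = longest_common_prefix p p'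
       in tail G e \<noteq> head G e \<and>
          (e' \<in> set (drop (length a) p) \<or> bar G e' \<in> set (drop (length a) p')) \<and>
          \<G>' = \<G>\<lparr>brands := (brands \<G>)[i := e']\<rparr>)"

datatype move = Fold | Swap

fun move_step :: "move \<Rightarrow> ('v, 'e) branded \<Rightarrow> ('v, 'e) branded \<Rightarrow> bool" where
  "move_step Fold \<G> \<G>' = branded_fold \<G> \<G>'"
| "move_step Swap \<G> \<G>' = edge_swap \<G> \<G>'"

definition preceding_swaps :: "move list \<Rightarrow> nat \<Rightarrow> nat" where
  "preceding_swaps ms j = length (takeWhile (\<lambda>m. m = Swap) (rev (take j ms)))"

end

theory Submission
  imports Defs
begin

text \<open>
  A potential for a branded graph assigns to each vertex an element of the free group such that
  the label of every tree edge is the quotient of the values at its end points and the base has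
  value 1. The associated automorphism is read off a potential: the branded edge \<open>e\<close> contributes
  \<open>h (tail e) \<cdot> f e \<cdot> inverse (h (head e))\<close>. Removing an edge from the tree splits the vertices in
  two parts, and an edge swap, as well as a fold of type 2, multiplies the potential on the part
  without the base by the value of a letter; on the automorphism this is a Whitehead automorphism
  \<open>(A, a)\<close>. A fold of type 1 leaves the potential unchanged.

  If no two edges with the same origin have the same label, then reduced paths have reduced labels,
  so by surjectivity on fundamental groups every vertex carries a loop for each letter, and the
  graph is the rose. Otherwise two edges can be folded, and by injectivity their heads differ; one
  swap for each of them brings them into the tree. A fold removes one vertex, and the subdivided
  rose has \<open>N + 1\<close> vertices.
\<close>


section \<open>Reduction of words\<close>

text \<open>A move replaces many tree paths at once, and comparing the old loops with the new ones
  path by path would be laborious. A potential, in contrast, is determined by its equations along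
  tree edges, so it is enough to guess the new one and to check it edge by edge. The guess is
  forced. If a branded edge with index \<open>i\<close> takes part in a move, the factor is the
  value of the generator with index \<open>i\<close> or of its inverse. That generator then keeps
  its image, and every other image can change only by this factor at its two ends, which is the
  shape of \<open>(A, a)\<close>. Bijectivity of the associated endomorphism is the invariant. It
  passes forward through a move because the change is composition with an automorphism, and it
  returns the injectivity and surjectivity on fundamental groups from which the next fold is found.
  The quotient of a fold is built on representatives, by deleting \<open>s2\<close> and its head.
  All graphs of a sequence therefore live over the types of the first one and fit into a single
  list.\<close>

locale bar_involution =
  fixes G :: "('v, 'e) bar_graph"
  assumes bar_bar [simp]: "bar G (bar G e) = e"
begin

lemma bar_eq_iff [simp]: "bar G d = bar G e \<longleftrightarrow> d = e"
  by (metis bar_bar)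

definition push :: "'e \<Rightarrow> 'e list \<Rightarrow> 'e list" where
  "push e p = (case p of [] \<Rightarrow> [e] | e' # p' \<Rightarrow> if e' = bar G e then p' else e # e' # p')"

lemma reduce_Cons: "reduce G (e # p) = push e (reduce G p)"
  by (simp add: push_def)

declare reduce.simps(2) [simp del]

lemma reduced_Nil [simp]: "reduced G []" and reduced_single [simp]: "reduced G [e]"
  by (auto simp: reduced_def)

lemma reduced_Cons_Cons [simp]:
  "reduced G (e # d # p) \<longleftrightarrow> d \<noteq> bar G e \<and> reduced G (d # p)"
  by (auto simp: reduced_def)

lemma reduced_append_iff:
  "reduced G (p @ q) \<longleftrightarrow>
     reduced G p \<and> reduced G q \<and> (p = [] \<or> q = [] \<or> hd q \<noteq> bar G (last p))"
  by (auto simp: reduced_def successively_append_iff)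

lemma reduced_tl: "reduced G (e # p) \<Longrightarrow> reduced G p"
  by (cases p) auto

lemma reduced_push: "reduced G p \<Longrightarrow> reduced G (push e p)"
  by (auto simp: push_def split: list.split dest: reduced_tl)

lemma reduced_reduce [simp]: "reduced G (reduce G p)"
  by (induction p) (auto simp: reduce_Cons reduced_push)

lemma reduce_reduced: "reduced G p \<Longrightarrow> reduce G p = p"
proof (induction p)
  case (Cons e p)
  then show ?case by (cases p) (auto simp: reduce_Cons push_def dest: reduced_tl)
qed simp

lemma reduce_reduce [simp]: "reduce G (reduce G p) = reduce G p"
  by (simp add: reduce_reduced)

lemma reduce_single [simp]: "reduce G [e] = [e]"
  by (simp add: reduce_reduced)

text \<open>Each letter thus acts on the reduced words by a permutation, inverted by its bar. This
  is van der Waerden's substitute for confluence; the compatibility of \<open>reduce\<close> with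
  concatenation rests on it.\<close>

lemma push_push_bar: "reduced G p \<Longrightarrow> push e (push (bar G e) p) = p"
  by (cases p; cases "tl p") (auto simp: push_def dest: reduced_tl)

text \<open>The right factor enters only through its reduction, which gives
  \<open>reduce_append_right\<close> at once.\<close>

lemma reduce_append_foldr: "reduce G (p @ q) = foldr push p (reduce G q)"
  by (induction p) (auto simp: reduce_Cons)

lemma reduce_append_right [simp]: "reduce G (p @ reduce G q) = reduce G (p @ q)"
  by (simp add: reduce_append_foldr)

lemma reduce_append_left [simp]: "reduce G (reduce G p @ q) = reduce G (p @ q)"
proof (induction p)
  case (Cons e p)
  \<comment> \<open>If \<open>e\<close> cancels the first letter of \<open>r\<close>, the right-hand
    side applies \<open>e\<close> after \<open>bar G e\<close>, which is the identity on reduced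
    words.\<close>
  have push_append: "reduce G (push e r @ q) = push e (reduce G (r @ q))" for r
    by (cases r) (auto simp: push_def [of e "_ # _"] push_def [of e "[]"] reduce_Cons push_push_bar)
  show ?case
    by (simp add: reduce_Cons push_append Cons)
qed simp

lemma reduce_append_cong:
  "reduce G p = reduce G p' \<Longrightarrow> reduce G q = reduce G q' \<Longrightarrow> reduce G (p @ q) = reduce G (p' @ q')"
  by (metis reduce_append_left reduce_append_right)

lemma rev_path_Nil [simp]: "rev_path G [] = []"
  and rev_path_Cons [simp]: "rev_path G (e # p) = rev_path G p @ [bar G e]"
  and rev_path_append [simp]: "rev_path G (p @ q) = rev_path G q @ rev_path G p"
  and rev_path_rev_path [simp]: "rev_path G (rev_path G p) = p"
  and set_rev_path [simp]: "set (rev_path G p) = bar G ` set p"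
  and rev_path_eq_Nil_iff [simp]: "rev_path G p = [] \<longleftrightarrow> p = []"
  by (auto simp: rev_path_def rev_map o_def)

lemma reduce_cancel_bar [simp]: "reduce G (e # bar G e # p) = reduce G p"
  by (simp add: reduce_Cons push_push_bar)

lemma reduce_cancel_bar' [simp]: "reduce G (bar G e # e # p) = reduce G p"
  using reduce_cancel_bar [of "bar G e" p] by simp

lemma reduce_cancel: "reduce G (p @ rev_path G p @ q) = reduce G q"
proof (induction p arbitrary: q)
  case (Cons e p)
  have "reduce G ((e # p) @ rev_path G (e # p) @ q) = push e (reduce G (p @ rev_path G p @ [bar G e] @ q))"
    by (simp add: reduce_Cons)
  also have "\<dots> = reduce G q"
    by (subst Cons) (simp add: reduce_Cons [symmetric])
  finally show ?case .
qed simp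

lemma reduce_cancel' [simp]: "reduce G (rev_path G p @ p @ q) = reduce G q"
  using reduce_cancel [of "rev_path G p"] by simp

lemma reduce_inverse [simp]: "reduce G (p @ rev_path G p) = []"
  using reduce_cancel [of p "[]"] by simp

lemma reduce_inverse' [simp]: "reduce G (rev_path G p @ p) = []"
  using reduce_inverse [of "rev_path G p"] by simp

declare reduce_cancel [simp]

lemma reduce_append_cancel [simp]:
  "reduce G (r @ p) = reduce G (r @ q) \<longleftrightarrow> reduce G p = reduce G q"
  by (metis reduce_append_right reduce_cancel')

lemma reduce_eq_iff: "reduce G p = reduce G q \<longleftrightarrow> reduce G (rev_path G p @ q) = []"
  by (metis reduce_append_right reduce_cancel reduce_inverse' append_Nil2)

lemma reduce_eq_snoc_iff:
  "reduce G p = reduce G (q @ [bar G e]) \<longleftrightarrow> reduce G (p @ [e]) = reduce G q"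
proof -
  have "reduce G (q @ [bar G e] @ [e]) = reduce G q"
    using reduce_append_cong [of q q "[bar G e, e]" "[]"] by (simp add: reduce_Cons push_def)
  moreover have "reduce G ((p @ [e]) @ [bar G e]) = reduce G p"
    using reduce_append_cong [of p p "[e, bar G e]" "[]"] by (simp add: reduce_Cons push_def)
  ultimately show ?thesis
    by (metis append_assoc reduce_append_left)
qed

lemma reduced_rev_path [simp]: "reduced G (rev_path G p) \<longleftrightarrow> reduced G p"
proof -
  have "reduced G p \<Longrightarrow> reduced G (rev_path G p)" for p
  proof (induction p)
    case (Cons e p)
    then show ?case by (cases p) (auto simp: reduced_append_iff dest: reduced_tl)
  qed simp
  from this [of p] this [of "rev_path G p"] show ?thesis by auto
qed

lemma reduce_rev_path [simp]: "reduce G (rev_path G p) = rev_path G (reduce G p)"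
proof -
  have "reduce G (rev_path G p) = reduce G (rev_path G (reduce G p))"
    by (subst reduce_eq_iff) (simp add: reduce_append_cong [of p "reduce G p"])
  then show ?thesis by (simp add: reduce_reduced)
qed

lemma set_reduce: "set (reduce G p) \<subseteq> set p"
  by (induction p) (auto simp: reduce_Cons push_def split: list.splits if_splits)

text \<open>\<open>\<sigma>\<close> is a substitution of words for letters; the hypothesis says that it respects inversion up
  to reduction, so that it is defined on reduction classes.\<close>

lemma reduce_substitute:
  fixes \<sigma> :: "'e \<Rightarrow> 'd list"
  assumes H: "bar_involution H"
    and inv: "\<And>e. e \<in> set p \<Longrightarrow> reduce H (\<sigma> e @ \<sigma> (bar G e)) = []"
  shows "reduce H (concat (map \<sigma> (reduce G p))) = reduce H (concat (map \<sigma> p))"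
  using inv
proof (induction p)
  case (Cons e p)
  interpret H: bar_involution H by fact
  have "reduce H (concat (map \<sigma> (push e r))) = reduce H (\<sigma> e @ concat (map \<sigma> r))" for r
  proof (cases r)
    case (Cons d r')
    have "reduce H ((\<sigma> e @ \<sigma> (bar G e)) @ concat (map \<sigma> r')) = reduce H ([] @ concat (map \<sigma> r'))"
      using Cons.prems by (intro H.reduce_append_cong) auto
    then show ?thesis
      by (auto simp: push_def Cons)
  qed (auto simp: push_def)
  moreover have "reduce H (concat (map \<sigma> (reduce G p))) = reduce H (concat (map \<sigma> p))"
    using Cons by auto
  ultimately show ?case
    by (metis H.reduce_append_right concat.simps(2) list.simps(9) reduce_Cons)
qed simp

lemma reduce_map:
  assumes H: "bar_involution H"
    and bar: "\<And>e. e \<in> set p \<Longrightarrow> f (bar G e) = bar H (f e)"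
  shows "reduce H (map f (reduce G p)) = reduce H (map f p)"
proof -
  interpret H: bar_involution H by fact
  show ?thesis
    using reduce_substitute [OF H, of p "\<lambda>e. [f e]"] bar
    by (simp add: H.reduce_cancel_bar [of _ "[]"])
qed

end

lemma reduce_cong:
  "(\<And>e. e \<in> set p \<Longrightarrow> bar G e = bar H e) \<Longrightarrow> bar_involution G \<Longrightarrow> reduce G p = reduce H p"
proof (induction p)
  case (Cons e p)
  then have "reduce G p = reduce H p" by simp
  then show ?case using Cons.prems by (auto split: list.split)
qed simp

lemma reduced_cong:
  "(\<And>e. e \<in> set p \<Longrightarrow> bar G e = bar H e) \<Longrightarrow> reduced G p = reduced H p"
  unfolding reduced_def by (rule successively_cong) auto


section \<open>Walks\<close>

text \<open>Subgraphs with all vertices are given by their arc set \<open>A\<close>.\<close>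

primrec walk :: "('v, 'e) bar_graph \<Rightarrow> 'e set \<Rightarrow> 'v \<Rightarrow> 'e list \<Rightarrow> 'v \<Rightarrow> bool" where
  "walk G A u [] v \<longleftrightarrow> u = v"
| "walk G A u (e # p) v \<longleftrightarrow> e \<in> A \<and> tail G e = u \<and> walk G A (head G e) p v"

lemma walk_append: "walk G A u (p @ q) v \<longleftrightarrow> (\<exists>x. walk G A u p x \<and> walk G A x q v)"
  by (induction p arbitrary: u) auto

lemma walk_subset: "walk G A u p v \<Longrightarrow> set p \<subseteq> A"
  by (induction p arbitrary: u) auto

lemma walk_iff_subset: "walk G A u p v \<longleftrightarrow> set p \<subseteq> A \<and> walk G UNIV u p v"
  by (induction p arbitrary: u) auto

lemma walk_mono: "walk G A u p v \<Longrightarrow> A \<subseteq> B \<Longrightarrow> walk G B u p v"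
  by (induction p arbitrary: u) auto

definition restrict_arcs :: "('v, 'e) bar_graph \<Rightarrow> 'e set \<Rightarrow> ('v, 'e) bar_graph" where
  "restrict_arcs G A = G\<lparr>arcs := A, bar := perm_restrict (bar G) A\<rparr>"

lemma dig_simps [simp]:
  "verts (dig G) = verts G" "arcs (dig G) = arcs G" "tail (dig G) = tail G" "head (dig G) = head G"
  by (simp_all add: pre_digraph.truncate_def)

lemma restrict_arcs_simps [simp]:
  "verts (restrict_arcs G A) = verts G" "arcs (restrict_arcs G A) = A"
  "tail (restrict_arcs G A) = tail G" "head (restrict_arcs G A) = head G"
  "bar (restrict_arcs G A) = perm_restrict (bar G) A"
  by (simp_all add: restrict_arcs_def)

text \<open>An empty walk does not look at its vertex, so membership in \<open>verts G\<close> is a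
  separate conjunct.\<close>

lemma path_from_to_iff: "path_from_to G u p v \<longleftrightarrow> u \<in> verts G \<and> walk G (arcs G) u p v"
proof -
  have "walk G (arcs G) u p v \<longleftrightarrow> set p \<subseteq> arcs G \<and> pre_digraph.cas (dig G) u p v"
    by (induction p arbitrary: u) (auto simp: pre_digraph.cas.simps)
  then show ?thesis
    by (auto simp: pre_digraph.awalk_def)
qed

lemma walk_restrict_arcs [simp]: "walk (restrict_arcs G A) = walk G"
proof -
  have "walk (restrict_arcs G A) B u p v = walk G B u p v" for B u p v
    by (induction p arbitrary: u) auto
  then show ?thesis by (simp add: fun_eq_iff)
qed

locale wf_bar_graph = bar_involution G for G :: "('v, 'e) bar_graph" +
  assumes tail_in [simp]: "e \<in> arcs G \<Longrightarrow> tail G e \<in> verts G"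
    and head_in [simp]: "e \<in> arcs G \<Longrightarrow> head G e \<in> verts G"
    and bar_neq: "e \<in> arcs G \<Longrightarrow> bar G e \<noteq> e"
    and bar_eq: "e \<notin> arcs G \<Longrightarrow> bar G e = e"
    and tail_bar [simp]: "e \<in> arcs G \<Longrightarrow> tail G (bar G e) = head G e"
begin

lemma bar_in_iff [simp]: "bar G e \<in> arcs G \<longleftrightarrow> e \<in> arcs G"
  by (metis bar_bar bar_eq)

lemma head_bar [simp]: "e \<in> arcs G \<Longrightarrow> head G (bar G e) = tail G e"
  by (metis bar_bar bar_in_iff tail_bar)

lemma wf_digraph_dig: "wf_digraph (dig G)"
  by unfold_locales auto

lemma walk_in_verts: "walk G (arcs G) u p v \<Longrightarrow> u \<in> verts G \<Longrightarrow> v \<in> verts G"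
  by (induction p arbitrary: u) auto

lemma walk_unique_end: "walk G A u p v \<Longrightarrow> walk G A u p w \<Longrightarrow> v = w"
  by (induction p arbitrary: u) auto

end

lemma is_graph_iff:
  "is_graph G \<longleftrightarrow> wf_bar_graph G \<and> verts G \<noteq> {} \<and>
     (\<forall>u \<in> verts G. \<forall>v \<in> verts G. \<exists>p. walk G (arcs G) u p v)"
proof -
  have "bidirected_digraph (dig G) (bar G) \<longleftrightarrow> wf_bar_graph G"
  proof
    assume "bidirected_digraph (dig G) (bar G)"
    then interpret bidirected_digraph "dig G" "bar G" .
    show "wf_bar_graph G"
      using tail_in_verts head_in_verts arev_neq arev_eq tail_arev arev_arev
      by unfold_locales auto
  next
    assume "wf_bar_graph G"
    then interpret wf_bar_graph G .
    show "bidirected_digraph (dig G) (bar G)"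
      using bar_neq bar_eq by unfold_locales auto
  qed
  moreover have "strongly_connected (dig G) \<longleftrightarrow> verts G \<noteq> {} \<and>
     (\<forall>u \<in> verts G. \<forall>v \<in> verts G. \<exists>p. walk G (arcs G) u p v)" if "wf_bar_graph G"
  proof -
    interpret wf_bar_graph G by fact
    show ?thesis
      by (auto simp: strongly_connected_def wf_digraph.reachable_awalk [OF wf_digraph_dig] path_from_to_iff)
  qed
  ultimately show ?thesis
    unfolding is_graph_def by blast
qed

locale bar_subgraph = wf_bar_graph G for G :: "('v, 'e) bar_graph" +
  fixes A :: "'e set"
  assumes A_arcs: "A \<subseteq> arcs G"
    and bar_A: "e \<in> A \<Longrightarrow> bar G e \<in> A"
begin

lemma A_arc [simp]: "e \<in> A \<Longrightarrow> e \<in> arcs G"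
  using A_arcs by auto

lemma bar_A_iff [simp]: "bar G e \<in> A \<longleftrightarrow> e \<in> A"
  by (metis bar_A bar_bar)

lemma walk_arcs: "walk G A u p v \<Longrightarrow> walk G (arcs G) u p v"
  using A_arcs walk_mono by metis

lemma walk_rev_path: "walk G A u p v \<Longrightarrow> walk G A v (rev_path G p) u"
  by (induction p arbitrary: u) (auto simp: walk_append)

lemma walk_reduce: "walk G A u p v \<Longrightarrow> walk G A u (reduce G p) v"
proof (induction p arbitrary: u)
  case (Cons e p)
  then have "walk G A (head G e) (reduce G p) v" by simp
  with Cons.prems show ?case
    by (cases "reduce G p") (auto simp: reduce_Cons push_def)
qed simp

lemma wf_restrict_arcs: "wf_bar_graph (restrict_arcs G A)"
  using bar_neq by unfold_locales (auto simp: perm_restrict_def)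

lemma reduced_restrict_arcs: "set p \<subseteq> A \<Longrightarrow> reduced (restrict_arcs G A) p \<longleftrightarrow> reduced G p"
  by (rule reduced_cong) (auto simp: perm_restrict_def)

end

sublocale wf_bar_graph \<subseteq> full: bar_subgraph G "arcs G"
  by unfold_locales auto


section \<open>Spanning trees\<close>

text \<open>The tree is kept as an arc set inside \<open>G\<close>, with reduction taken in
  \<open>G\<close>: on arcs of \<open>A\<close> the involutions of \<open>G\<close> and of the
  subgraph agree, so only one notion of reduction occurs. \<open>maximal_tree_iff\<close> gives the
  link to the official notion.\<close>

locale rooted_tree = bar_subgraph G A for G :: "('v, 'e) bar_graph" and A +
  fixes b :: 'v
  assumes root_in [simp]: "b \<in> verts G"
    and tree_connected: "v \<in> verts G \<Longrightarrow> \<exists>p. walk G A b p v"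
    and tree_closed: "v \<in> verts G \<Longrightarrow> walk G A v p v \<Longrightarrow> reduce G p = []"
begin

section \<open>Reduced tree paths from the root\<close>

definition tp :: "'v \<Rightarrow> 'e list" where
  "tp v = tree_path (restrict_arcs G A) b v"

lemma tree_unique:
  assumes "walk G A u p v" "walk G A u q v" "u \<in> verts G"
  shows "reduce G p = reduce G q"
proof -
  have "walk G A v (rev_path G p @ q) v"
    using assms walk_rev_path by (auto simp: walk_append)
  moreover have "v \<in> verts G"
    using assms walk_in_verts walk_arcs by blast
  ultimately show ?thesis
    unfolding reduce_eq_iff by (rule tree_closed [rotated])
qed

lemma
  assumes "v \<in> verts G"
  shows tp_walk: "walk G A b (tp v) v" and tp_reduced [simp]: "reduced G (tp v)"
proof -
  let ?P = "\<lambda>p. path_from_to (restrict_arcs G A) b p v \<and> reduced (restrict_arcs G A) p"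
  have P: "?P p \<longleftrightarrow> walk G A b p v \<and> reduced G p" for p
    using walk_subset [of G A b p v] by (auto simp: path_from_to_iff reduced_restrict_arcs)
  obtain p where p: "walk G A b (reduce G p) v"
    using tree_connected [OF assms] walk_reduce by blast
  have "\<exists>!p. ?P p"
  proof (rule ex1I)
    show "?P (reduce G p)" using p P by simp
  next
    fix q assume "?P q"
    then have "walk G A b q v" "reduced G q" using P by auto
    then show "q = reduce G p"
      using tree_unique [OF p, of q] by (simp add: reduce_reduced)
  qed
  then have "?P (tp v)"
    unfolding tp_def tree_path_def by (rule theI')
  then show "walk G A b (tp v) v" "reduced G (tp v)"
    using P by auto
qed

lemma tp_eqI: "walk G A b p v \<Longrightarrow> reduce G p = tp v"
  using tree_unique [of b p v "tp v"] walk_in_verts [OF walk_arcs, of b p v] tp_walk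
  by (simp add: reduce_reduced)

lemma tp_eqI': "walk G A b p v \<Longrightarrow> reduced G p \<Longrightarrow> tp v = p"
  using tp_eqI [of p v] by (simp add: reduce_reduced)

lemma tp_root [simp]: "tp b = []"
  by (rule tp_eqI') auto

lemma set_tp: "v \<in> verts G \<Longrightarrow> set (tp v) \<subseteq> A"
  by (rule walk_subset [OF tp_walk])

lemma tp_extend:
  assumes "walk G A u p v" "u \<in> verts G"
  shows "reduce G (tp u @ p) = tp v"
  using assms tp_walk by (intro tp_eqI) (auto simp: walk_append)

text \<open>Either \<open>e\<close> can be appended to the path to its tail without cancellation, or
  that path already ends with the inverse of \<open>e\<close>; uniqueness of reduced tree paths does
  the rest.\<close>

lemma tp_edge_cases:
  assumes "e \<in> A"
  obtains "tp (head G e) = tp (tail G e) @ [e]" | "tp (tail G e) = tp (head G e) @ [bar G e]"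
proof (cases "reduced G (tp (tail G e) @ [e])")
  case True
  moreover have "walk G A b (tp (tail G e) @ [e]) (head G e)"
    using assms tp_walk by (auto simp: walk_append)
  ultimately show ?thesis
    using that tp_eqI' by blast
next
  case False
  then have "tp (tail G e) \<noteq> []" and "last (tp (tail G e)) = bar G e"
    using assms by (auto simp: reduced_append_iff) (metis bar_bar)
  then obtain r where r: "tp (tail G e) = r @ [bar G e]"
    by (metis append_butlast_last_id)
  moreover have "walk G A b r (head G e)"
    using tp_walk [of "tail G e"] assms r by (auto simp: walk_append)
  moreover have "reduced G r"
    using tp_reduced [of "tail G e"] assms r by (auto simp: reduced_append_iff)
  ultimately show ?thesis
    using that tp_eqI' by blast
qed

lemma tp_split:
  assumes v: "v \<in> verts G" and d: "d \<in> set (tp v)"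
  obtains r where "tp v = tp (tail G d) @ d # r" "tp (head G d) = tp (tail G d) @ [d]"
    "walk G A (head G d) r v"
proof -
  obtain q r where qr: "tp v = q @ d # r"
    using d by (meson split_list)
  have w: "walk G A b q (tail G d)" "d \<in> A" "walk G A (head G d) r v"
    using tp_walk [OF v] qr by (auto simp: walk_append)
  have red: "reduced G (q @ [d])" "reduced G q"
    using tp_reduced [OF v] qr by (auto simp: reduced_append_iff split: if_splits)
  have "tp (tail G d) = q"
    using w red by (auto intro: tp_eqI')
  moreover have "tp (head G d) = q @ [d]"
    using w red by (intro tp_eqI') (auto simp: walk_append)
  ultimately show ?thesis
    using that qr w by blast
qed

text \<open>The vertices that removing the tree edge \<open>d\<close>, pointing away from the root, disconnects from the
  root.\<close>

definition beyond :: "'e \<Rightarrow> 'v set" where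
  "beyond d = {v \<in> verts G. d \<in> set (tp v)}"

definition outward :: "'e \<Rightarrow> bool" where
  "outward d \<longleftrightarrow> d \<in> A \<and> tp (head G d) = tp (tail G d) @ [d]"

lemma outward_A: "outward d \<Longrightarrow> d \<in> A"
  by (simp add: outward_def)

lemma outward_or: "e \<in> A \<Longrightarrow> outward e \<or> outward (bar G e)"
  by (rule tp_edge_cases [of e]) (auto simp: outward_def)

lemma outward_tp: "v \<in> verts G \<Longrightarrow> d \<in> set (tp v) \<Longrightarrow> outward d"
  by (metis outward_def tp_split set_tp subsetD)

lemma bar_notin_tp:
  assumes "outward d" "v \<in> verts G"
  shows "bar G d \<notin> set (tp v)"
proof
  assume "bar G d \<in> set (tp v)"
  then have "outward (bar G d)" using assms outward_tp by blast
  with assms(1) show False by (simp add: outward_def)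
qed

lemma root_notin_beyond: "b \<notin> beyond d"
  by (simp add: beyond_def)

lemma head_beyond: "outward d \<Longrightarrow> head G d \<in> beyond d"
  by (auto simp: beyond_def outward_def)

lemma tail_notin_beyond: "outward d \<Longrightarrow> tail G d \<notin> beyond d"
proof
  assume "tail G d \<in> beyond d"
  then obtain r where "tp (tail G d) = tp (tail G d) @ d # r"
    by (auto simp: beyond_def elim: tp_split)
  then show False by simp
qed

text \<open>The tree paths to the two ends of \<open>e\<close> differ only by \<open>e\<close> or
  its inverse, so \<open>d\<close> lies on both or on neither.\<close>

lemma edge_beyond_iff:
  assumes "e \<in> A" "e \<noteq> d" "e \<noteq> bar G d"
  shows "tail G e \<in> beyond d \<longleftrightarrow> head G e \<in> beyond d"
  using assms(1)
  by (rule tp_edge_cases) (use assms in \<open>auto simp: beyond_def\<close>)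

lemma beyond_split:
  assumes "v \<in> beyond d" "outward d"
  obtains r where "tp v = tp (head G d) @ r" "walk G (A - {d, bar G d}) (head G d) r v"
proof -
  have v: "v \<in> verts G" "d \<in> set (tp v)"
    using assms by (auto simp: beyond_def)
  obtain r where r: "tp v = tp (tail G d) @ d # r" "tp (head G d) = tp (tail G d) @ [d]"
    "walk G A (head G d) r v"
    using v by (rule tp_split)
  \<comment> \<open>A second occurrence of \<open>d\<close> would give a longer reduced tree path to
    the tail of \<open>d\<close>.\<close>
  have "d \<notin> set r"
  proof
    assume "d \<in> set r"
    then obtain r1 r2 where r12: "r = r1 @ d # r2" by (meson split_list)
    have "walk G A b (tp (tail G d) @ d # r1) (tail G d)"
      using tp_walk [OF v(1)] unfolding r(1) r12 by (auto simp: walk_append)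
    moreover have "reduced G (tp (tail G d) @ d # r1)"
      using tp_reduced [OF v(1)] unfolding r(1) r12
      by (metis append.assoc append_Cons reduced_append_iff)
    ultimately have "tp (tail G d) = tp (tail G d) @ d # r1"
      by (rule tp_eqI')
    then show False by simp
  qed
  moreover have "bar G d \<notin> set r"
    using bar_notin_tp [OF assms(2) v(1)] r(1) by auto
  ultimately have "walk G (A - {d, bar G d}) (head G d) r v"
    using r(3) walk_iff_subset [of G A] walk_iff_subset [of G "A - {d, bar G d}"] by auto
  with r that show ?thesis by simp
qed

lemma notin_beyond_walk:
  assumes "v \<in> verts G" "v \<notin> beyond d" "outward d"
  shows "walk G (A - {d, bar G d}) b (tp v) v"
  using assms tp_walk [of v] bar_notin_tp [of d v] walk_iff_subset [of G A]
    walk_iff_subset [of G "A - {d, bar G d}"]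
  by (auto simp: beyond_def)

text \<open>The edge is the one at \<open>x\<close> on the tree path from \<open>x\<close> to
  \<open>y\<close>. It leads away from the root if the path to \<open>x\<close> is a prefix of the
  path to \<open>y\<close>; otherwise it is the last edge of the path to \<open>x\<close>. That it
  touches \<open>x\<close> is what later keeps a second prescribed edge in the tree.\<close>

lemma separating_edge:
  assumes xy: "x \<in> verts G" "y \<in> verts G" "x \<noteq> y"
  obtains d where "outward d" "x = tail G d \<or> x = head G d" "x \<in> beyond d \<longleftrightarrow> y \<notin> beyond d"
proof (cases "prefix (tp x) (tp y)")
  case True
  have "tp x \<noteq> tp y"
  proof
    assume "tp x = tp y"
    then have "walk G A b (tp x) y" using xy tp_walk by simp
    then show False
      using walk_unique_end tp_walk [OF xy(1)] xy(3) by blast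
  qed
  then obtain d r where dr: "tp y = tp x @ d # r"
    using True by (metis append_Nil2 neq_Nil_conv prefixE)
  have x: "tail G d = x"
    using tp_walk [OF xy(2)] dr tp_walk [OF xy(1)] walk_unique_end by (auto simp: walk_append)
  have "outward d" using outward_tp xy dr by auto
  moreover have "x \<notin> beyond d"
    using tail_notin_beyond \<open>outward d\<close> x by blast
  ultimately show ?thesis
    using that [of d] x dr xy by (auto simp: beyond_def)
next
  case False
  then have "tp x \<noteq> []" by auto
  then obtain q d where qd: "tp x = q @ [d]"
    by (metis append_butlast_last_id)
  have x: "head G d = x"
    using tp_walk [OF xy(1)] qd by (auto simp: walk_append)
  have "outward d" using outward_tp xy qd by auto
  moreover have "y \<notin> beyond d"
  proof
    assume "y \<in> beyond d"
    then obtain r where "tp y = tp (head G d) @ r"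
      using beyond_split \<open>outward d\<close> by blast
    with False x show False by simp
  qed
  ultimately show ?thesis
    using that [of d] x qd xy by (auto simp: beyond_def)
qed

end

text \<open>\<open>P\<close> is a potential whose values are reduction classes of paths, so closed walks in \<open>A\<close> are trivial.\<close>

lemma (in bar_subgraph) rooted_treeI:
  assumes b: "b \<in> verts G"
    and P: "\<And>v. v \<in> verts G \<Longrightarrow> walk G A b (P v) v"
    and edge: "\<And>e. e \<in> A \<Longrightarrow> reduce G (P (tail G e) @ [e]) = reduce G (P (head G e)) \<or>
                       reduce G (P (head G e) @ [bar G e]) = reduce G (P (tail G e))"
  shows "rooted_tree G A b"
proof unfold_locales
  \<comment> \<open>The second alternative is the same equation read backwards along
    \<open>e\<close>. Callers may therefore treat one orientation of each edge only.\<close>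
  have edge': "reduce G (P (tail G e) @ [e]) = reduce G (P (head G e))" if "e \<in> A" for e
    using edge [OF that] reduce_eq_snoc_iff [of "P (tail G e)" "P (head G e)" e] by auto
  have "reduce G (P u @ p) = reduce G (P v)" if "walk G A u p v" for u p v
    using that
  proof (induction p arbitrary: u)
    case (Cons e p)
    have "reduce G (P u @ e # p) = reduce G ((P u @ [e]) @ p)" by simp
    also have "\<dots> = reduce G (P (head G e) @ p)"
      using edge' Cons.prems by (intro reduce_append_cong) auto
    also have "\<dots> = reduce G (P v)" using Cons by auto
    finally show ?case .
  qed simp
  then show "reduce G p = []" if "walk G A v p v" for v p
    using that reduce_append_cancel [of "P v" p "[]"] by auto
qed (use b P in auto)

lemma (in rooted_tree) is_graph: "is_graph G"
proof -
  have "\<exists>p. walk G (arcs G) u p v" if "u \<in> verts G" "v \<in> verts G" for u v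
    using walk_arcs [OF walk_rev_path [OF tp_walk [OF that(1)]]] walk_arcs [OF tp_walk [OF that(2)]]
    by (metis walk_append)
  then show ?thesis
    using root_in wf_bar_graph_axioms by (auto simp: is_graph_iff simp del: root_in)
qed

text \<open>Trivial fundamental group speaks of reduced closed paths; \<open>tree_closed\<close>
  speaks of all closed walks, which is more convenient to use. Reducing a walk inside
  \<open>A\<close> connects the two.\<close>

lemma (in bar_subgraph) maximal_tree_iff:
  assumes b: "b \<in> verts G"
  shows "maximal_tree (restrict_arcs G A) G \<longleftrightarrow> rooted_tree G A b"
proof
  assume max: "maximal_tree (restrict_arcs G A) G"
  show "rooted_tree G A b"
  proof unfold_locales
    fix v assume v: "v \<in> verts G"
    then show "\<exists>p. walk G A b p v"
      using max b by (auto simp: maximal_tree_def is_tree_def is_graph_iff)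
    fix p assume p: "walk G A v p v"
    then have w: "walk G A v (reduce G p) v" by (rule walk_reduce)
    with walk_subset [OF w] have "walk G A v (reduce G p) v \<and> reduced (restrict_arcs G A) (reduce G p)"
      by (simp add: reduced_restrict_arcs)
    then show "reduce G p = []"
      using max v by (auto simp: maximal_tree_def is_tree_def pi1_def path_from_to_iff)
  qed (use b in auto)
next
  assume "rooted_tree G A b"
  then interpret rooted_tree G A b .
  \<comment> \<open>Seen as a graph in its own right the subgraph is again a rooted tree, so
    \<open>is_graph\<close> yields its connectedness.\<close>
  interpret R: rooted_tree "restrict_arcs G A" A b
  proof (intro rooted_tree.intro bar_subgraph.intro wf_restrict_arcs)
    show "bar_subgraph_axioms (restrict_arcs G A) A"
      by unfold_locales (auto simp: perm_restrict_def)
    have "reduce (restrict_arcs G A) p = reduce G p" if "walk G A v p v" for v p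
      using walk_subset [OF that]
      by (intro reduce_cong bar_involution_axioms wf_bar_graph.axioms(1) [OF wf_restrict_arcs])
         (auto simp: perm_restrict_def)
    then show "rooted_tree_axioms (restrict_arcs G A) A b"
      using tree_connected tree_closed by unfold_locales auto
  qed
  have "is_tree (restrict_arcs G A)"
    using R.is_graph tree_closed
    by (auto simp: is_tree_def pi1_def path_from_to_iff reduced_restrict_arcs [OF walk_subset] reduce_reduced)
       (metis reduce_reduced reduced_restrict_arcs walk_subset)
  moreover have "spanning (dig (restrict_arcs G A)) (dig G)"
    using R.wf_digraph_dig wf_digraph_dig A_arcs by (auto simp: spanning_def subgraph_def compatible_def)
  ultimately show "maximal_tree (restrict_arcs G A) G"
    by (auto simp: maximal_tree_def perm_restrict_def)
qed


section \<open>The free group\<close>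

lemma rose_simps [simp]:
  "verts (rose n) = {()}" "arcs (rose n) = letters n" "tail (rose n) e = ()" "head (rose n) e = ()"
  by (simp_all add: rose_def)

lemma mem_letters [simp]: "(i, s) \<in> letters n \<longleftrightarrow> i < n"
  by (simp add: letters_def)

lemma bar_rose: "bar (rose n) (i, s) = (i, if i < n then \<not> s else s)"
  by (simp add: rose_def perm_restrict_def)

interpretation rose: wf_bar_graph "rose n" for n
proof unfold_locales
  show "bar (rose n) (bar (rose n) e) = e" for e
    by (cases e) (simp add: bar_rose)
  show "e \<in> arcs (rose n) \<Longrightarrow> bar (rose n) e \<noteq> e" "e \<notin> arcs (rose n) \<Longrightarrow> bar (rose n) e = e" for e
    by (cases e; simp add: bar_rose)+
qed auto

lemma walk_rose: "walk (rose n) A u p v \<longleftrightarrow> set p \<subseteq> A"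
  by (induction p arbitrary: u) auto

lemma carrier_free_grp: "carrier (free_grp n) = {p. set p \<subseteq> letters n \<and> reduced (rose n) p}"
  by (auto simp: free_grp_def pi1_def path_from_to_iff walk_rose)

lemma mult_free_grp: "p \<otimes>\<^bsub>free_grp n\<^esub> q = reduce (rose n) (p @ q)"
  by (simp add: free_grp_def pi1_def)

lemma one_free_grp: "\<one>\<^bsub>free_grp n\<^esub> = []"
  by (simp add: free_grp_def pi1_def)

lemma reduce_in_free_grp [simp]: "set p \<subseteq> letters n \<Longrightarrow> reduce (rose n) p \<in> carrier (free_grp n)"
  using rose.set_reduce [of n p] by (auto simp: carrier_free_grp)

lemma rev_path_in_free_grp: "p \<in> carrier (free_grp n) \<Longrightarrow> rev_path (rose n) p \<in> carrier (free_grp n)"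
  using rose.bar_in_iff by (auto simp: carrier_free_grp)

interpretation free_grp: group "free_grp n" for n
proof (rule groupI)
  fix p assume "p \<in> carrier (free_grp n)"
  then show "\<exists>q\<in>carrier (free_grp n). q \<otimes>\<^bsub>free_grp n\<^esub> p = \<one>\<^bsub>free_grp n\<^esub>"
    by (intro bexI [of _ "rev_path (rose n) p"]) (auto simp: mult_free_grp one_free_grp rev_path_in_free_grp)
next
  show "p \<otimes>\<^bsub>free_grp n\<^esub> q \<in> carrier (free_grp n)"
    if "p \<in> carrier (free_grp n)" "q \<in> carrier (free_grp n)" for p q
    unfolding mult_free_grp using that by (intro reduce_in_free_grp) (auto simp: carrier_free_grp)
qed (auto simp: mult_free_grp one_free_grp carrier_free_grp rose.reduce_reduced)

lemma inv_free_grp: "p \<in> carrier (free_grp n) \<Longrightarrow> inv\<^bsub>free_grp n\<^esub> p = rev_path (rose n) p"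
  by (rule free_grp.inv_equality) (auto simp: mult_free_grp one_free_grp rev_path_in_free_grp)

lemma reduce_rev_path_inv:
  "set p \<subseteq> letters n \<Longrightarrow> reduce (rose n) (rev_path (rose n) p) = inv\<^bsub>free_grp n\<^esub> (reduce (rose n) p)"
  by (simp add: inv_free_grp)

lemma letter_in_free_grp [simp]: "[x] \<in> carrier (free_grp n) \<longleftrightarrow> x \<in> letters n"
  by (auto simp: carrier_free_grp)

lemma inv_letter: "x \<in> letters n \<Longrightarrow> inv\<^bsub>free_grp n\<^esub> [x] = [bar (rose n) x]"
  by (simp add: inv_free_grp)


subsection \<open>Endomorphisms\<close>

definition letter_value :: "nat \<Rightarrow> (nat \<Rightarrow> letter list) \<Rightarrow> letter \<Rightarrow> letter list" where
  "letter_value n g x = (if snd x then g (fst x) else inv\<^bsub>free_grp n\<^esub> (g (fst x)))"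

text \<open>All intermediate reductions are collected into one at the end, so that
  \<open>free_ext\<close> becomes a substitution of words and \<open>reduce_substitute\<close>
  applies.\<close>

lemma free_ext_eq:
  assumes "w \<in> carrier (free_grp n)"
  shows "free_ext n g w = reduce (rose n) (concat (map (letter_value n g) w))"
proof -
  have "foldr (\<lambda>(i, s) u. (if s then g i else inv\<^bsub>free_grp n\<^esub> (g i)) \<otimes>\<^bsub>free_grp n\<^esub> u) w \<one>\<^bsub>free_grp n\<^esub>
     = reduce (rose n) (concat (map (letter_value n g) w))"
    by (induction w) (auto simp: letter_value_def mult_free_grp one_free_grp)
  then show ?thesis using assms by (simp add: free_ext_def)
qed

lemma free_ext_cong: "(\<And>i. i < n \<Longrightarrow> g i = g' i) \<Longrightarrow> free_ext n g = free_ext n g'"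
proof
  fix w assume eq: "\<And>i. i < n \<Longrightarrow> g i = g' i"
  show "free_ext n g w = free_ext n g' w"
  proof (cases "w \<in> carrier (free_grp n)")
    case True
    then have "map (letter_value n g) w = map (letter_value n g') w"
      using eq by (auto simp: carrier_free_grp letter_value_def)
    then show ?thesis by (simp only: free_ext_eq [OF True])
  qed (simp add: free_ext_def)
qed

context
  fixes n and g :: "nat \<Rightarrow> letter list"
  assumes g: "\<And>i. i < n \<Longrightarrow> g i \<in> carrier (free_grp n)"
begin

lemma letter_value_in: "x \<in> letters n \<Longrightarrow> letter_value n g x \<in> carrier (free_grp n)"
  using g by (cases x) (auto simp: letter_value_def)

lemma letter_value_bar:
  "x \<in> letters n \<Longrightarrow> letter_value n g (bar (rose n) x) = inv\<^bsub>free_grp n\<^esub> (letter_value n g x)"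
  using g by (cases x) (auto simp: letter_value_def bar_rose)

lemma letter_value_cancel:
  assumes "x \<in> letters n"
  shows "reduce (rose n) (letter_value n g x @ letter_value n g (bar (rose n) x)) = []"
  using free_grp.r_inv [OF letter_value_in [OF assms]] letter_value_bar [OF assms]
  by (simp add: mult_free_grp one_free_grp)

lemma reduce_concat_letter_value:
  assumes "set w \<subseteq> letters n"
  shows "reduce (rose n) (concat (map (letter_value n g) (reduce (rose n) w)))
       = reduce (rose n) (concat (map (letter_value n g) w))"
  using assms by (intro rose.reduce_substitute rose.bar_involution_axioms letter_value_cancel) auto

lemma free_ext_in:
  assumes "w \<in> carrier (free_grp n)"
  shows "free_ext n g w \<in> carrier (free_grp n)"
proof -
  have "set (concat (map (letter_value n g) w)) \<subseteq> letters n"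
    using assms letter_value_in unfolding carrier_free_grp by fastforce
  then show ?thesis using assms by (simp add: free_ext_eq)
qed

lemma free_ext_hom: "free_ext n g \<in> hom (free_grp n) (free_grp n)"
proof (rule homI)
  fix p q assume pq: "p \<in> carrier (free_grp n)" "q \<in> carrier (free_grp n)"
  have "free_ext n g (p \<otimes>\<^bsub>free_grp n\<^esub> q) = reduce (rose n) (concat (map (letter_value n g) (p @ q)))"
    unfolding free_ext_eq [OF free_grp.m_closed [OF pq]] unfolding mult_free_grp
    using pq by (intro reduce_concat_letter_value) (auto simp: carrier_free_grp)
  with pq show "free_ext n g (p \<otimes>\<^bsub>free_grp n\<^esub> q) = free_ext n g p \<otimes>\<^bsub>free_grp n\<^esub> free_ext n g q"
    by (simp add: free_ext_eq mult_free_grp)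
qed (rule free_ext_in)

lemma free_ext_letter: "x \<in> letters n \<Longrightarrow> free_ext n g [x] = letter_value n g x"
  using letter_value_in [of x] by (simp add: free_ext_eq carrier_free_grp rose.reduce_reduced)

lemma free_ext_generator: "i < n \<Longrightarrow> free_ext n g [(i, True)] = g i"
  by (simp add: free_ext_letter letter_value_def)

end

lemma free_hom_eqI:
  assumes hom: "\<phi> \<in> hom (free_grp n) (free_grp n)" "\<psi> \<in> hom (free_grp n) (free_grp n)"
    and eq: "\<And>i. i < n \<Longrightarrow> \<phi> [(i, True)] = \<psi> [(i, True)]"
    and w: "w \<in> carrier (free_grp n)"
  shows "\<phi> w = \<psi> w"
proof -
  interpret \<phi>: group_hom "free_grp n" "free_grp n" \<phi>
    using hom by unfold_locales
  interpret \<psi>: group_hom "free_grp n" "free_grp n" \<psi>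
    using hom by unfold_locales
  have letter: "\<phi> [x] = \<psi> [x]" if "x \<in> letters n" for x
  proof (cases x)
    case (Pair i s)
    then have "i < n" and x: "x = (i, True) \<or> [x] = inv\<^bsub>free_grp n\<^esub> [(i, True)]"
      using that by (auto simp: inv_letter bar_rose)
    then show ?thesis using eq by auto
  qed
  show ?thesis using w
  proof (induction w)
    case Nil
    then show ?case using \<phi>.hom_one \<psi>.hom_one by (simp add: one_free_grp)
  next
    case (Cons x w)
    then have xw: "x \<in> letters n" "w \<in> carrier (free_grp n)" "x # w = [x] \<otimes>\<^bsub>free_grp n\<^esub> w"
      by (auto simp: carrier_free_grp mult_free_grp rose.reduce_reduced dest: rose.reduced_tl)
    then show ?case
      using Cons.IH letter by simp
  qed
qed

lemma carrier_aut_free: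
  "carrier (aut_free n) = hom (free_grp n) (free_grp n) \<inter> Bij (carrier (free_grp n))"
  by (simp add: AutoGroup_def auto_def)

lemma mult_aut_free:
  "\<phi> \<in> carrier (aut_free n) \<Longrightarrow> \<psi> \<in> carrier (aut_free n) \<Longrightarrow>
    \<phi> \<otimes>\<^bsub>aut_free n\<^esub> \<psi> = compose (carrier (free_grp n)) \<phi> \<psi>"
  by (simp add: AutoGroup_def BijGroup_def auto_def)

lemma one_aut_free: "\<one>\<^bsub>aut_free n\<^esub> = (\<lambda>w \<in> carrier (free_grp n). w)"
  by (simp add: AutoGroup_def BijGroup_def)

interpretation aut_free: group "aut_free n" for n
  by (rule free_grp.AutoGroup)

lemma aut_free_eqI:
  assumes "\<phi> \<in> hom (free_grp n) (free_grp n)" "\<phi> \<in> extensional (carrier (free_grp n))"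
    "\<psi> \<in> hom (free_grp n) (free_grp n)" "\<psi> \<in> extensional (carrier (free_grp n))"
    and "\<And>i. i < n \<Longrightarrow> \<phi> [(i, True)] = \<psi> [(i, True)]"
  shows "\<phi> = \<psi>"
  using assms free_hom_eqI [of \<phi> n \<psi>] by (intro extensionalityI) auto

lemma free_ext_extensional: "free_ext n g \<in> extensional (carrier (free_grp n))"
  by (simp add: free_ext_def)

lemma free_ext_of_aut:
  assumes "\<phi> \<in> carrier (aut_free n)" and "\<And>i. i < n \<Longrightarrow> g i = \<phi> [(i, True)]"
  shows "free_ext n g = \<phi>"
proof -
  have \<phi>: "\<phi> \<in> hom (free_grp n) (free_grp n)" "\<phi> \<in> extensional (carrier (free_grp n))"
    using assms(1) by (auto simp: carrier_aut_free Bij_def)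
  then have "g i \<in> carrier (free_grp n)" if "i < n" for i
    using that assms(2) by (auto intro: hom_carrier [THEN subsetD] simp: hom_in_carrier)
  with \<phi> assms(2) show ?thesis
    by (intro aut_free_eqI [OF free_ext_hom free_ext_extensional]) (auto simp: free_ext_generator)
qed


subsection \<open>Whitehead automorphisms\<close>

text \<open>The images of the generators under \<open>(A, a)\<close>, with conditionals in place of
  exponents 0 and 1. For a letter \<open>a\<close>, \<open>fst a = j\<close> covers both cases of
  \<open>a\<close> being the generator with index \<open>j\<close> or its inverse.\<close>

definition whitehead_gen :: "nat \<Rightarrow> letter set \<Rightarrow> letter \<Rightarrow> nat \<Rightarrow> letter list" where
  "whitehead_gen n A a j =
     (if fst a = j then [(j, True)]
      else (if (j, True) \<in> A then [a] else \<one>\<^bsub>free_grp n\<^esub>) \<otimes>\<^bsub>free_grp n\<^esub> [(j, True)]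
           \<otimes>\<^bsub>free_grp n\<^esub> inv\<^bsub>free_grp n\<^esub> (if (j, False) \<in> A then [a] else \<one>\<^bsub>free_grp n\<^esub>))"

lemma whitehead_aut_eq:
  assumes "a \<in> letters n"
  shows "whitehead_aut n A a = free_ext n (whitehead_gen n A a)"
proof -
  have "a = (j, True) \<or> bar (rose n) a = (j, True) \<longleftrightarrow> fst a = j" for j
    using assms by (cases a) (auto simp: bar_rose)
  then show ?thesis
    using assms unfolding whitehead_aut_def
    by (intro free_ext_cong) (auto simp: whitehead_gen_def)
qed

lemma whitehead_gen_in:
  "a \<in> letters n \<Longrightarrow> j < n \<Longrightarrow> whitehead_gen n A a j \<in> carrier (free_grp n)"
  by (auto simp: whitehead_gen_def)

text \<open>\<open>(A, a)\<close> fixes \<open>a\<close>, so the factors that it puts around a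
  generator cancel against those of the map for the inverse letter. Only letters of other indices
  are looked up in the sets, hence agreement away from \<open>a\<close> and its inverse is
  enough.\<close>

lemma whitehead_gen_inverse:
  assumes a: "a \<in> letters n" and A': "A' - {a, bar (rose n) a} = A - {a, bar (rose n) a}"
    and j: "j < n"
  shows "free_ext n (whitehead_gen n A a) (whitehead_gen n A' (bar (rose n) a) j) = [(j, True)]"
proof -
  let ?W = "free_ext n (whitehead_gen n A a)"
  interpret W: group_hom "free_grp n" "free_grp n" ?W
    using free_ext_hom whitehead_gen_in a by unfold_locales blast
  have bar_a: "bar (rose n) a \<in> letters n" "fst (bar (rose n) a) = fst a"
    using a by (cases a; simp add: bar_rose)+
  have gen: "?W [(k, True)] = whitehead_gen n A a k" if "k < n" for k
    using that a by (intro free_ext_generator whitehead_gen_in)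
  show ?thesis
  proof (cases "fst a = j")
    case True
    then show ?thesis using bar_a gen j by (simp add: whitehead_gen_def)
  next
    case False
    have W_a: "?W [a] = [a]"
    proof (cases a)
      case (Pair i s)
      then show ?thesis
        using a gen [of i] W.hom_inv [of "[(i, True)]"]
        by (cases s) (auto simp: whitehead_gen_def inv_letter bar_rose)
    qed
    have "(j, s) \<in> A' \<longleftrightarrow> (j, s) \<in> A" for s
    proof -
      have "(j, s) \<noteq> a" "(j, s) \<noteq> bar (rose n) a"
        using False bar_a(2) by (metis fst_conv)+
      then show ?thesis using A' by blast
    qed
    note A_iff = this
    define u v where "u = (if (j, True) \<in> A then [a] else \<one>\<^bsub>free_grp n\<^esub>)"
      and "v = (if (j, False) \<in> A then [a] else \<one>\<^bsub>free_grp n\<^esub>)"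
    have uv: "u \<in> carrier (free_grp n)" "v \<in> carrier (free_grp n)" "?W u = u" "?W v = v"
      using a W_a by (simp_all add: u_def v_def)
    have "whitehead_gen n A' (bar (rose n) a) j
        = inv\<^bsub>free_grp n\<^esub> u \<otimes>\<^bsub>free_grp n\<^esub> [(j, True)] \<otimes>\<^bsub>free_grp n\<^esub> inv\<^bsub>free_grp n\<^esub> (inv\<^bsub>free_grp n\<^esub> v)"
      using False a by (simp add: whitehead_gen_def A_iff bar_a u_def v_def inv_letter)
    then have "?W (whitehead_gen n A' (bar (rose n) a) j)
        = inv\<^bsub>free_grp n\<^esub> u \<otimes>\<^bsub>free_grp n\<^esub> whitehead_gen n A a j \<otimes>\<^bsub>free_grp n\<^esub> v"
      using uv j by (simp add: gen)
    also have "whitehead_gen n A a j = u \<otimes>\<^bsub>free_grp n\<^esub> [(j, True)] \<otimes>\<^bsub>free_grp n\<^esub> inv\<^bsub>free_grp n\<^esub> v"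
      using False by (simp add: whitehead_gen_def u_def v_def)
    also have "inv\<^bsub>free_grp n\<^esub> u \<otimes>\<^bsub>free_grp n\<^esub> (u \<otimes>\<^bsub>free_grp n\<^esub> [(j, True)] \<otimes>\<^bsub>free_grp n\<^esub> inv\<^bsub>free_grp n\<^esub> v) \<otimes>\<^bsub>free_grp n\<^esub> v
       = (inv\<^bsub>free_grp n\<^esub> u \<otimes>\<^bsub>free_grp n\<^esub> u) \<otimes>\<^bsub>free_grp n\<^esub> [(j, True)] \<otimes>\<^bsub>free_grp n\<^esub> (inv\<^bsub>free_grp n\<^esub> v \<otimes>\<^bsub>free_grp n\<^esub> v)"
      using uv(1,2) j by (simp only: free_grp.m_assoc free_grp.m_closed free_grp.inv_closed letter_in_free_grp mem_letters)
    also have "\<dots> = [(j, True)]"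
      using uv(1,2) j by simp
    finally show ?thesis .
  qed
qed

text \<open>The inverse comes from the inverse letter with the same set \<open>A\<close>, since the
  generator images depend only on the letters of other indices in \<open>A\<close>.\<close>

lemma whitehead_aut_in_aut:
  assumes a: "a \<in> letters n"
  shows "whitehead_aut n A a \<in> carrier (aut_free n)"
proof -
  define a' where "a' = bar (rose n) a"
  have a': "a' \<in> letters n" "bar (rose n) a' = a" "{a', a} = {a, a'}"
    using a rose.bar_in_iff by (auto simp: a'_def)
  let ?W = "free_ext n (whitehead_gen n A a)" and ?W' = "free_ext n (whitehead_gen n A a')"
  have hom: "?W \<in> hom (free_grp n) (free_grp n)" "?W' \<in> hom (free_grp n) (free_grp n)"
    using free_ext_hom whitehead_gen_in a a'(1) by blast+
  have id: "(\<lambda>w. w) \<in> hom (free_grp n) (free_grp n)"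
    by (auto simp: hom_def)
  have "?W (?W' w) = w" if "w \<in> carrier (free_grp n)" for w
    using free_hom_eqI [OF hom_compose [OF hom(2,1)] id _ that]
      whitehead_gen_inverse [OF a, of A A] a a' by (simp add: free_ext_generator whitehead_gen_in a'_def)
  moreover have "?W' (?W w) = w" if "w \<in> carrier (free_grp n)" for w
    using free_hom_eqI [OF hom_compose [OF hom] id _ that]
      whitehead_gen_inverse [OF a'(1), of A A] a a' by (simp add: free_ext_generator whitehead_gen_in)
  ultimately have "bij_betw ?W (carrier (free_grp n)) (carrier (free_grp n))"
    using hom by (intro bij_betw_byWitness [of _ ?W']) (auto simp: hom_def)
  then show ?thesis
    using hom(1) a by (simp add: whitehead_aut_eq carrier_aut_free Bij_def free_ext_extensional)
qed

text \<open>How the automorphism changes when the potential of one component of the tree minus an edge is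
  multiplied by the value \<open>\<gamma>\<close> of the letter \<open>(i, s)\<close>: \<open>P j\<close> and \<open>Q j\<close> say whether the initial
  and the terminal vertex of the edge with index \<open>j\<close> lie in that component.\<close>

lemma whitehead_step:
  fixes P Q :: "nat \<Rightarrow> bool"
  assumes aut: "free_ext n g \<in> carrier (aut_free n)"
    and g: "\<And>j. j < n \<Longrightarrow> g j \<in> carrier (free_grp n)"
    and g': "\<And>j. j < n \<Longrightarrow> g' j \<in> carrier (free_grp n)"
    and i: "i < n" and g'i: "g' i = g i" and \<gamma>: "\<gamma> = letter_value n g (i, s)"
    and gj: "\<And>j. j < n \<Longrightarrow> j \<noteq> i \<Longrightarrow>
      g j = (if P j then \<gamma> else \<one>\<^bsub>free_grp n\<^esub>) \<otimes>\<^bsub>free_grp n\<^esub> g' j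
            \<otimes>\<^bsub>free_grp n\<^esub> inv\<^bsub>free_grp n\<^esub> (if Q j then \<gamma> else \<one>\<^bsub>free_grp n\<^esub>)"
  shows "free_ext n g' \<in> carrier (aut_free n) \<and>
    inv\<^bsub>aut_free n\<^esub> (free_ext n g') \<otimes>\<^bsub>aut_free n\<^esub> free_ext n g \<in> whitehead_pair_auts n"
proof -
  \<comment> \<open>The letter itself is added by hand and the index \<open>i\<close> is excluded
    elsewhere, so that the inverse letter stays outside of \<open>A\<close>.\<close>
  define A where "A = insert (i, s) ({(j, True) | j. j < n \<and> j \<noteq> i \<and> P j} \<union>
                                     {(j, False) | j. j < n \<and> j \<noteq> i \<and> Q j})"
  let ?W = "whitehead_aut n A (i, s)" and ?\<phi> = "free_ext n g" and ?\<phi>' = "free_ext n g'"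
  let ?F = "carrier (free_grp n)"
  have pair: "whitehead_pair n A (i, s)"
    using i by (auto simp: whitehead_pair_def A_def bar_rose)
  have W: "?W \<in> carrier (aut_free n)"
    using i by (intro whitehead_aut_in_aut) simp
  interpret \<phi>': group_hom "free_grp n" "free_grp n" ?\<phi>'
    using free_ext_hom g' by unfold_locales blast
  have letter: "?\<phi>' [(i, s)] = \<gamma>"
    using g' i g'i \<gamma> by (subst free_ext_letter) (auto simp: letter_value_def)
  have gen: "?\<phi>' (whitehead_gen n A (i, s) j) = g j" if j: "j < n" for j
  proof (cases "i = j")
    case True
    then show ?thesis using g' g'i i by (simp add: whitehead_gen_def free_ext_generator)
  next
    case False
    then have "(j, True) \<in> A \<longleftrightarrow> P j" "(j, False) \<in> A \<longleftrightarrow> Q j"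
      using j by (auto simp: A_def)
    then have "?\<phi>' (whitehead_gen n A (i, s) j) =
      (if P j then \<gamma> else \<one>\<^bsub>free_grp n\<^esub>) \<otimes>\<^bsub>free_grp n\<^esub> g' j
            \<otimes>\<^bsub>free_grp n\<^esub> inv\<^bsub>free_grp n\<^esub> (if Q j then \<gamma> else \<one>\<^bsub>free_grp n\<^esub>)"
      using i j False g' letter by (auto simp: whitehead_gen_def free_ext_generator)
    then show ?thesis using gj [OF j] False by auto
  qed
  have W_hom: "?W \<in> hom (free_grp n) (free_grp n)"
    using W by (simp add: carrier_aut_free)
  have \<phi>: "?\<phi> w = ?\<phi>' (?W w)" if "w \<in> ?F" for w
    using free_hom_eqI [OF free_ext_hom [of n g] hom_compose [OF W_hom \<phi>'.homh] _ that] g gen i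
    by (simp add: free_ext_generator whitehead_aut_eq whitehead_gen_in)
  have bijW: "bij_betw ?W ?F ?F" and bij\<phi>: "bij_betw ?\<phi> ?F ?F"
    using W aut by (auto simp: carrier_aut_free Bij_def)
  \<comment> \<open>Old map = new map after \<open>?W\<close>. As the old map and \<open>?W\<close>
    are bijective, so is the new one; this is how the invariant survives a move.\<close>
  have "bij_betw (?\<phi>' \<circ> ?W) ?F ?F"
    using bij\<phi> by (subst bij_betw_cong [where g = ?\<phi>]) (auto simp: \<phi>)
  then have "bij_betw ?\<phi>' ?F ?F"
    using bij_betw_comp_iff [OF bijW, of ?\<phi>' ?F] by blast
  then have aut': "?\<phi>' \<in> carrier (aut_free n)"
    using \<phi>'.homh by (simp add: carrier_aut_free Bij_def free_ext_extensional)
  have "?\<phi> = ?\<phi>' \<otimes>\<^bsub>aut_free n\<^esub> ?W"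
    unfolding mult_aut_free [OF aut' W] using free_ext_extensional [of n g]
    by (intro extensionalityI [of _ ?F]) (auto simp: compose_def \<phi>)
  then have "inv\<^bsub>aut_free n\<^esub> ?\<phi>' \<otimes>\<^bsub>aut_free n\<^esub> ?\<phi> = ?W"
    using aut' W aut by (metis aut_free.inv_solve_left)
  with aut' pair show ?thesis
    by (auto simp: whitehead_pair_auts_def)
qed


lemma free_grp_Nil [simp]:
  "[] \<in> carrier (free_grp n)"
  "p \<in> carrier (free_grp n) \<Longrightarrow> p \<otimes>\<^bsub>free_grp n\<^esub> [] = p"
  "p \<in> carrier (free_grp n) \<Longrightarrow> [] \<otimes>\<^bsub>free_grp n\<^esub> p = p"
  "inv\<^bsub>free_grp n\<^esub> [] = []"
  using free_grp.one_closed free_grp.r_one free_grp.l_one free_grp.inv_one unfolding one_free_grp by auto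

section \<open>Labelled graphs\<close>

text \<open>A graph map to the rose, kept as its edge part: the rose has one vertex, so the edge
  part determines the map.\<close>

locale labelled_graph = wf_bar_graph G for G :: "('v, 'e) bar_graph" +
  fixes n :: nat and f :: "'e \<Rightarrow> letter"
  assumes f_in [simp]: "e \<in> arcs G \<Longrightarrow> f e \<in> letters n"
    and f_bar: "e \<in> arcs G \<Longrightarrow> f (bar G e) = bar (rose n) (f e)"
begin

definition lab :: "'e list \<Rightarrow> letter list" where
  "lab p = reduce (rose n) (map f p)"

lemma lab_Nil [simp]: "lab [] = []" and lab_single [simp]: "lab [e] = [f e]"
  by (simp_all add: lab_def)

lemma lab_in [simp]: "set p \<subseteq> arcs G \<Longrightarrow> lab p \<in> carrier (free_grp n)"
  unfolding lab_def by (intro reduce_in_free_grp) auto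

lemma lab_append: "lab (p @ q) = lab p \<otimes>\<^bsub>free_grp n\<^esub> lab q"
  by (simp add: lab_def mult_free_grp)

lemma lab_Cons: "lab (e # p) = [f e] \<otimes>\<^bsub>free_grp n\<^esub> lab p"
  using lab_append [of "[e]" p] by simp

lemma lab_rev_path: "set p \<subseteq> arcs G \<Longrightarrow> lab (rev_path G p) = inv\<^bsub>free_grp n\<^esub> (lab p)"
proof -
  assume p: "set p \<subseteq> arcs G"
  then have "map f (rev_path G p) = rev_path (rose n) (map f p)"
    by (induction p) (auto simp: f_bar)
  moreover have "set (map f p) \<subseteq> letters n"
    using p by auto
  ultimately show ?thesis
    unfolding lab_def by (simp only: reduce_rev_path_inv)
qed

lemma lab_reduce: "set p \<subseteq> arcs G \<Longrightarrow> lab (reduce G p) = lab p"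
  unfolding lab_def by (rule reduce_map) (auto intro: rose.bar_involution_axioms f_bar)

lemma lab_cong:
  "reduce G p = reduce G q \<Longrightarrow> set p \<subseteq> arcs G \<Longrightarrow> set q \<subseteq> arcs G \<Longrightarrow> lab p = lab q"
  by (metis lab_reduce)

section \<open>Injectivity and surjectivity on fundamental groups\<close>

definition pi1_inj :: bool where
  "pi1_inj \<longleftrightarrow> (\<forall>v \<in> verts G. \<forall>p. walk G (arcs G) v p v \<longrightarrow> lab p = [] \<longrightarrow> reduce G p = [])"

definition pi1_surj :: bool where
  "pi1_surj \<longleftrightarrow> (\<forall>v \<in> verts G. \<forall>w \<in> carrier (free_grp n). \<exists>p. walk G (arcs G) v p v \<and> lab p = w)"

text \<open>Labels are invariant under reduction, so unreduced walks can be used throughout.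
  Injectivity becomes triviality of the kernel, applied to \<open>rev_path G p @ q\<close> for two
  paths of equal label.\<close>

lemma induced_map_iso_iff:
  assumes "emap m = f"
  shows "(\<forall>v \<in> verts G. induced_map (rose n) m \<in> iso (pi1 G v) (pi1 (rose n) (vmap m v)))
     \<longleftrightarrow> pi1_inj \<and> pi1_surj"
proof -
  have im: "induced_map (rose n) m p = lab p" for p
    by (simp add: induced_map_def lab_def assms)
  have carrier: "p \<in> carrier (pi1 G v) \<longleftrightarrow> walk G (arcs G) v p v \<and> reduced G p"
    if "v \<in> verts G" for p v
    using that by (simp add: pi1_def path_from_to_iff)
  have rose: "pi1 (rose n) u = free_grp n" for u
    by (simp add: free_grp_def)
  have in_carrier: "lab p \<in> carrier (free_grp n)" if "walk G (arcs G) v p v" for p v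
    using walk_subset [OF that] by simp
  have hom: "lab \<in> hom (pi1 G v) (free_grp n)" if v: "v \<in> verts G" for v
  proof (rule homI)
    fix p q assume "p \<in> carrier (pi1 G v)" "q \<in> carrier (pi1 G v)"
    then have "set (p @ q) \<subseteq> arcs G"
      using carrier [OF v] walk_subset by fastforce
    then show "lab (p \<otimes>\<^bsub>pi1 G v\<^esub> q) = lab p \<otimes>\<^bsub>free_grp n\<^esub> lab q"
      by (simp add: pi1_def lab_reduce lab_append)
  qed (use carrier [OF v] in_carrier in blast)
  have inj: "inj_on lab (carrier (pi1 G v)) \<longleftrightarrow>
      (\<forall>p. walk G (arcs G) v p v \<longrightarrow> lab p = [] \<longrightarrow> reduce G p = [])" if v: "v \<in> verts G" for v
  proof
    assume inj: "inj_on lab (carrier (pi1 G v))"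
    show "\<forall>p. walk G (arcs G) v p v \<longrightarrow> lab p = [] \<longrightarrow> reduce G p = []"
    proof (intro allI impI)
      fix p assume p: "walk G (arcs G) v p v" "lab p = []"
      then have "reduce G p \<in> carrier (pi1 G v)" "[] \<in> carrier (pi1 G v)"
        using v full.walk_reduce by (auto simp: carrier)
      moreover have "lab (reduce G p) = lab []"
        using p lab_reduce [OF walk_subset [OF p(1)]] by simp
      ultimately show "reduce G p = []"
        using inj by (auto simp: inj_on_def)
    qed
  next
    assume *: "\<forall>p. walk G (arcs G) v p v \<longrightarrow> lab p = [] \<longrightarrow> reduce G p = []"
    show "inj_on lab (carrier (pi1 G v))"
    proof (rule inj_onI)
      fix p q assume "p \<in> carrier (pi1 G v)" "q \<in> carrier (pi1 G v)" and eq: "lab p = lab q"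
      then have p: "walk G (arcs G) v p v" "reduced G p" and q: "walk G (arcs G) v q v" "reduced G q"
        using carrier [OF v] by auto
      have "lab (rev_path G p @ q) = inv\<^bsub>free_grp n\<^esub> (lab p) \<otimes>\<^bsub>free_grp n\<^esub> lab p"
        using eq walk_subset [OF p(1)] by (simp add: lab_append lab_rev_path)
      also have "\<dots> = []"
        using in_carrier [OF p(1)] by (simp add: one_free_grp)
      finally have "reduce G (rev_path G p @ q) = []"
        using * full.walk_rev_path [OF p(1)] q(1) walk_append by metis
      then show "p = q"
        using p q reduce_eq_iff [of p q] by (simp add: reduce_reduced)
    qed
  qed
  have surj: "lab ` carrier (pi1 G v) = carrier (free_grp n) \<longleftrightarrow>
      (\<forall>w \<in> carrier (free_grp n). \<exists>p. walk G (arcs G) v p v \<and> lab p = w)" if v: "v \<in> verts G" for v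
  proof
    assume "lab ` carrier (pi1 G v) = carrier (free_grp n)"
    then show "\<forall>w \<in> carrier (free_grp n). \<exists>p. walk G (arcs G) v p v \<and> lab p = w"
      using carrier [OF v] by (metis imageE)
  next
    assume *: "\<forall>w \<in> carrier (free_grp n). \<exists>p. walk G (arcs G) v p v \<and> lab p = w"
    show "lab ` carrier (pi1 G v) = carrier (free_grp n)"
    proof
      show "lab ` carrier (pi1 G v) \<subseteq> carrier (free_grp n)"
        using carrier [OF v] in_carrier by blast
      show "carrier (free_grp n) \<subseteq> lab ` carrier (pi1 G v)"
      proof
        fix w assume "w \<in> carrier (free_grp n)"
        then obtain p where p: "walk G (arcs G) v p v" "lab p = w" using * by blast
        then have "lab (reduce G p) = w" "reduce G p \<in> carrier (pi1 G v)"
          using lab_reduce [OF walk_subset [OF p(1)]] full.walk_reduce carrier [OF v] by auto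
        then show "w \<in> lab ` carrier (pi1 G v)" by blast
      qed
    qed
  qed
  have fun_eq: "induced_map (rose n) m = lab"
    using im by (simp add: fun_eq_iff)
  have "lab \<in> iso (pi1 G v) (free_grp n) \<longleftrightarrow>
     inj_on lab (carrier (pi1 G v)) \<and> lab ` carrier (pi1 G v) = carrier (free_grp n)" if "v \<in> verts G" for v
    using hom [OF that] by (auto simp: iso_def bij_betw_def)
  then show ?thesis
    unfolding fun_eq rose pi1_inj_def pi1_surj_def using inj surj by blast
qed

end

locale labelled_tree = rooted_tree G A b + labelled_graph G n f
  for G :: "('v, 'e) bar_graph" and A :: "'e set" and b :: 'v and n f
begin

lemma set_tp_arcs [simp]: "v \<in> verts G \<Longrightarrow> set (tp v) \<subseteq> arcs G"
  using set_tp A_arcs by blast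

definition potential :: "('v \<Rightarrow> letter list) \<Rightarrow> bool" where
  "potential h \<longleftrightarrow> (\<forall>v \<in> verts G. h v \<in> carrier (free_grp n)) \<and> h b = [] \<and>
     (\<forall>e \<in> A. h (head G e) = h (tail G e) \<otimes>\<^bsub>free_grp n\<^esub> [f e])"

text \<open>Uniqueness: the edge equations telescope along the tree path, starting from the trivial
  value at the base. Any function that satisfies the equations can hence be used to compute the
  branded loops.\<close>

lemma potential_tp:
  assumes h: "potential h" and v: "v \<in> verts G"
  shows "h v = lab (tp v)"
proof -
  have "h v = h u \<otimes>\<^bsub>free_grp n\<^esub> lab p" if "walk G A u p v" "u \<in> verts G" for u p
    using that
  proof (induction p arbitrary: u)
    case Nil
    then show ?case using h by (auto simp: potential_def)
  next
    case (Cons e p)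
    then have "walk G A (head G e) p v" "e \<in> A" by auto
    moreover from this have p: "set p \<subseteq> arcs G"
      by (metis walk_arcs walk_subset)
    ultimately have "h v = h (head G e) \<otimes>\<^bsub>free_grp n\<^esub> lab p"
      using Cons by simp
    also have "h (head G e) = h u \<otimes>\<^bsub>free_grp n\<^esub> [f e]"
      using h Cons.prems by (auto simp: potential_def)
    finally show ?case
      using \<open>e \<in> A\<close> p h Cons.prems by (simp add: potential_def lab_Cons free_grp.m_assoc)
  qed
  from this [OF tp_walk [OF v] root_in] have "h v = h b \<otimes>\<^bsub>free_grp n\<^esub> lab (tp v)" .
  moreover have "h b = []" using h unfolding potential_def by blast
  ultimately show ?thesis using v by simp
qed

lemma potential_lab_tp: "potential (\<lambda>v. lab (tp v))"
proof -
  have "lab (tp (head G e)) = lab (tp (tail G e)) \<otimes>\<^bsub>free_grp n\<^esub> [f e]" if "e \<in> A" for e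
  proof -
    have "lab (tp (head G e)) = lab (tp (tail G e) @ [e])"
      using that tp_extend [of "tail G e" "[e]" "head G e"]
      by (intro lab_cong) (auto simp: reduce_reduced)
    then show ?thesis by (simp add: lab_append)
  qed
  then show ?thesis by (auto simp: potential_def)
qed

end


section \<open>Branded graphs\<close>

definition tree_arcs :: "('v, 'e) branded \<Rightarrow> 'e set" where
  "tree_arcs \<G> = arcs (ugraph \<G>) - (set (brands \<G>) \<union> bar (ugraph \<G>) ` set (brands \<G>))"

lemma brand_tree_eq: "brand_tree \<G> = restrict_arcs (ugraph \<G>) (tree_arcs \<G>)"
  by (simp add: brand_tree_def restrict_arcs_def tree_arcs_def Let_def)

text \<open>The homotopy equivalence is left out: it follows as soon as the associated endomorphism is
  bijective, which the moves preserve.\<close>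

locale pre_branded =
  labelled_tree "ugraph \<G>" "tree_arcs \<G>" "base \<G>" n "emap (marking \<G>)"
  for n and \<G> :: "('v, 'e) branded" +
  assumes length_brands [simp]: "length (brands \<G>) = n"
    and brands_arcs: "set (brands \<G>) \<subseteq> arcs (ugraph \<G>)"
    and brands_distinct: "\<And>i j. i < n \<Longrightarrow> j < n \<Longrightarrow> i \<noteq> j \<Longrightarrow>
        brands \<G> ! i \<noteq> brands \<G> ! j \<and> brands \<G> ! i \<noteq> bar (ugraph \<G>) (brands \<G> ! j)"

lemma branded_graph_iff:
  "branded_graph n \<G> \<longleftrightarrow> pre_branded n \<G> \<and>
     labelled_graph.pi1_inj (ugraph \<G>) n (emap (marking \<G>)) \<and>
     labelled_graph.pi1_surj (ugraph \<G>) n (emap (marking \<G>))"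
proof
  assume B: "branded_graph n \<G>"
  let ?G = "ugraph \<G>"
  have map: "is_graph_map ?G (rose n) (marking \<G>)"
    using B by (auto simp: branded_graph_def homotopy_equivalence_def)
  interpret wf_bar_graph ?G
    using B by (auto simp: branded_graph_def is_graph_iff)
  interpret labelled_graph ?G n "emap (marking \<G>)"
    using map by unfold_locales (auto simp: is_graph_map_def)
  interpret bar_subgraph ?G "tree_arcs \<G>"
  proof unfold_locales
    fix e assume e: "e \<in> tree_arcs \<G>"
    then have "bar ?G e \<notin> set (brands \<G>)"
      unfolding tree_arcs_def by (metis DiffE UnI2 bar_bar imageI)
    with e show "bar ?G e \<in> tree_arcs \<G>"
      by (auto simp: tree_arcs_def)
  qed (auto simp: tree_arcs_def)
  interpret rooted_tree ?G "tree_arcs \<G>" "base \<G>"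
    using B maximal_tree_iff by (auto simp: branded_graph_def brand_tree_eq)
  have "pre_branded n \<G>"
    using B by unfold_locales (simp_all add: branded_graph_def)
  moreover have "pi1_inj \<and> pi1_surj"
    using B induced_map_iso_iff [OF refl] by (auto simp: branded_graph_def homotopy_equivalence_def)
  ultimately show "pre_branded n \<G> \<and> pi1_inj \<and> pi1_surj" by blast
next
  assume R: "pre_branded n \<G> \<and>
     labelled_graph.pi1_inj (ugraph \<G>) n (emap (marking \<G>)) \<and>
     labelled_graph.pi1_surj (ugraph \<G>) n (emap (marking \<G>))"
  then interpret pre_branded n \<G> by blast
  have "is_graph_map (ugraph \<G>) (rose n) (marking \<G>)"
    using f_bar by (auto simp: is_graph_map_def)
  moreover have "maximal_tree (brand_tree \<G>) (ugraph \<G>)"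
    using maximal_tree_iff [OF root_in] rooted_tree_axioms by (simp add: brand_tree_eq)
  ultimately show "branded_graph n \<G>"
    using R is_graph induced_map_iso_iff [OF refl] brands_arcs brands_distinct
    by (auto simp: branded_graph_def homotopy_equivalence_def)
qed

context pre_branded
begin

abbreviation "G \<equiv> ugraph \<G>"
abbreviation "f \<equiv> emap (marking \<G>)"
abbreviation "A \<equiv> tree_arcs \<G>"

lemma brand_arc [simp]: "i < n \<Longrightarrow> brands \<G> ! i \<in> arcs G"
  using brands_arcs by (simp add: subset_iff)

lemma arc_cases:
  assumes "e \<in> arcs G"
  obtains "e \<in> A" | i where "i < n" "e = brands \<G> ! i" | i where "i < n" "e = bar G (brands \<G> ! i)"
proof -
  consider "e \<in> A" | "e \<in> set (brands \<G>)" | d where "d \<in> set (brands \<G>)" "e = bar G d"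
    using assms unfolding tree_arcs_def by blast
  then show ?thesis
    using that by cases (auto simp: in_set_conv_nth)
qed

lemma brand_notin_tree: "i < n \<Longrightarrow> brands \<G> ! i \<notin> A"
  by (auto simp: tree_arcs_def)

lemma base_path_eq: "base_path \<G> v = tp v"
  by (simp add: tp_def brand_tree_eq)

lemma brand_loop_eq:
  "brand_loop \<G> i = tp (tail G (brands \<G> ! i)) @ [brands \<G> ! i] @ rev_path G (tp (head G (brands \<G> ! i)))"
  by (simp add: brand_loop_def base_path_eq Let_def)

lemma brand_loop_arcs: "i < n \<Longrightarrow> set (brand_loop \<G> i) \<subseteq> arcs G"
  by (auto simp: brand_loop_eq dest!: set_tp_arcs [THEN subsetD, rotated])

lemma brand_loop_walk: "i < n \<Longrightarrow> walk G (arcs G) (base \<G>) (brand_loop \<G> i) (base \<G>)"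
  using walk_arcs [OF tp_walk] walk_arcs [OF walk_rev_path [OF tp_walk]]
  by (auto simp: brand_loop_eq walk_append)

lemma assoc_aut_eq: "assoc_aut n \<G> = free_ext n (\<lambda>i. lab (brand_loop \<G> i))"
  by (simp add: assoc_aut_def induced_map_def lab_def)

lemma lab_brand_loop_in: "i < n \<Longrightarrow> lab (brand_loop \<G> i) \<in> carrier (free_grp n)"
  by (simp add: brand_loop_arcs)

lemma lab_brand_loop:
  assumes "potential h" "i < n"
  shows "lab (brand_loop \<G> i) =
    h (tail G (brands \<G> ! i)) \<otimes>\<^bsub>free_grp n\<^esub> [f (brands \<G> ! i)] \<otimes>\<^bsub>free_grp n\<^esub>
      inv\<^bsub>free_grp n\<^esub> (h (head G (brands \<G> ! i)))"
  using assms potential_tp [OF assms(1)]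
  by (simp add: brand_loop_eq lab_append lab_Cons lab_rev_path free_grp.m_assoc)

section \<open>Words in the branded loops\<close>

definition loop_of_letter :: "letter \<Rightarrow> 'e list" where
  "loop_of_letter x =
     (if snd x then brand_loop \<G> (fst x) else rev_path G (brand_loop \<G> (fst x)))"

definition loop_word :: "letter list \<Rightarrow> 'e list" where
  "loop_word k = concat (map loop_of_letter k)"

lemma loop_word_walk: "set k \<subseteq> letters n \<Longrightarrow> walk G (arcs G) (base \<G>) (loop_word k) (base \<G>)"
proof (induction k)
  case (Cons x k)
  have "walk G (arcs G) (base \<G>) (loop_of_letter x) (base \<G>)"
    using Cons brand_loop_walk full.walk_rev_path by (cases x) (auto simp: loop_of_letter_def)
  with Cons show ?case by (auto simp: loop_word_def walk_append)
qed (simp add: loop_word_def)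

text \<open>The branded loops generate: conjugated by tree paths, an edge is a branded loop, its inverse
  or trivial.\<close>

lemma walk_loop_word:
  assumes "walk G (arcs G) u p v" "u \<in> verts G"
  shows "\<exists>k. set k \<subseteq> letters n \<and> reduce G (tp u @ p @ rev_path G (tp v)) = reduce G (loop_word k)"
  using assms
proof (induction p arbitrary: u)
  case Nil
  then show ?case by (intro exI [of _ "[]"]) (auto simp: loop_word_def)
next
  case (Cons e p)
  let ?l = "tp u @ [e] @ rev_path G (tp (head G e))"
  from Cons obtain k where k: "set k \<subseteq> letters n"
    "reduce G (tp (head G e) @ p @ rev_path G (tp v)) = reduce G (loop_word k)"
    using head_in by (metis walk.simps(2))
  have e: "e \<in> arcs G" "tail G e = u" using Cons.prems by auto
  have "\<exists>k'. set k' \<subseteq> letters n \<and> reduce G ?l = reduce G (loop_word k')"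
    using e(1)
  proof (cases rule: arc_cases)
    case 1
    then have "reduce G ((tp u @ [e]) @ rev_path G (tp (head G e)))
        = reduce G (tp (head G e) @ rev_path G (tp (head G e)))"
      using e tp_extend [of u "[e]" "head G e"] by (intro reduce_append_cong) (auto simp: reduce_reduced)
    then show ?thesis by (intro exI [of _ "[]"]) (simp add: loop_word_def)
  next
    case (2 i)
    then show ?thesis
      using e by (intro exI [of _ "[(i, True)]"]) (simp add: loop_word_def loop_of_letter_def brand_loop_eq)
  next
    case (3 i)
    then show ?thesis
      using e by (intro exI [of _ "[(i, False)]"]) (simp add: loop_word_def loop_of_letter_def brand_loop_eq)
  qed
  then obtain k' where k': "set k' \<subseteq> letters n" "reduce G ?l = reduce G (loop_word k')" by blast
  have "reduce G (tp u @ (e # p) @ rev_path G (tp v)) = reduce G ((tp u @ [e]) @ (p @ rev_path G (tp v)))"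
    by simp
  \<comment> \<open>Insert the detour from the head of \<open>e\<close> to the base and back, which
    is trivial; this splits off the loop of the first edge.\<close>
  also have "\<dots> = reduce G ((tp u @ [e]) @ (rev_path G (tp (head G e)) @ tp (head G e) @ p @ rev_path G (tp v)))"
    by (rule reduce_append_cong) simp_all
  also have "\<dots> = reduce G (?l @ (tp (head G e) @ p @ rev_path G (tp v)))"
    by simp
  also have "\<dots> = reduce G (loop_word k' @ loop_word k)"
    using k k' by (intro reduce_append_cong)
  finally show ?case
    using k k' by (intro exI [of _ "k' @ k"]) (simp add: loop_word_def)
qed

lemma lab_loop_word:
  assumes "set k \<subseteq> letters n"
  shows "lab (loop_word k) = assoc_aut n \<G> (reduce (rose n) k)"
proof -
  have "lab (loop_word k) = reduce (rose n) (concat (map (letter_value n (\<lambda>i. lab (brand_loop \<G> i))) k))"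
    using assms
  proof (induction k)
    case (Cons x k)
    have "lab (loop_of_letter x) = letter_value n (\<lambda>i. lab (brand_loop \<G> i)) x"
      using Cons.prems brand_loop_arcs by (cases x) (auto simp: loop_of_letter_def letter_value_def lab_rev_path)
    with Cons show ?case
      by (simp add: loop_word_def lab_append mult_free_grp)
  qed (simp add: loop_word_def)
  then show ?thesis
    using assms lab_brand_loop_in
    by (simp add: assoc_aut_eq free_ext_eq reduce_concat_letter_value)
qed

text \<open>Inverse letters go to inverse loops, so the substitution of loops for letters respects
  reduction.\<close>

lemma reduce_loop_word:
  assumes "set k \<subseteq> letters n" "reduce (rose n) k = []"
  shows "reduce G (loop_word k) = []"
proof -
  have "reduce G (loop_of_letter x @ loop_of_letter (bar (rose n) x)) = []" if "x \<in> letters n" for x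
    using that by (cases x) (auto simp: loop_of_letter_def bar_rose)
  then have "reduce G (loop_word (reduce (rose n) k)) = reduce G (loop_word k)"
    using assms(1) unfolding loop_word_def
    by (intro rose.reduce_substitute bar_involution_axioms) blast
  with assms(2) show ?thesis by (simp add: loop_word_def)
qed

text \<open>Conjugated to the base, a closed walk is a word \<open>k\<close> in the branded loops,
  and its label is the automorphism applied to \<open>k\<close>. A trivial label therefore makes
  \<open>k\<close> trivial, and with it the walk. For surjectivity at \<open>v\<close>, the target
  word is conjugated by the label of the tree path to \<open>v\<close> and pulled back by the
  automorphism.\<close>

theorem branded_graph_if_aut:
  assumes aut: "assoc_aut n \<G> \<in> carrier (aut_free n)"
  shows "branded_graph n \<G>"
proof -
  let ?F = "carrier (free_grp n)"
  have hom: "assoc_aut n \<G> \<in> hom (free_grp n) (free_grp n)" and bij: "bij_betw (assoc_aut n \<G>) ?F ?F"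
    using aut by (auto simp: carrier_aut_free Bij_def)
  interpret \<phi>: group_hom "free_grp n" "free_grp n" "assoc_aut n \<G>"
    using hom by unfold_locales
  have conj: "lab (p @ q @ rev_path G p) = lab p \<otimes>\<^bsub>free_grp n\<^esub> lab q \<otimes>\<^bsub>free_grp n\<^esub> inv\<^bsub>free_grp n\<^esub> (lab p)"
    if "set p \<subseteq> arcs G" "set q \<subseteq> arcs G" for p q
    using that by (simp add: lab_append lab_rev_path free_grp.m_assoc)
  have "pi1_inj"
    unfolding pi1_inj_def
  proof (intro ballI allI impI)
    fix v p assume v: "v \<in> verts G" and p: "walk G (arcs G) v p v" and "lab p = []"
    let ?q = "tp v @ p @ rev_path G (tp v)"
    obtain k where k: "set k \<subseteq> letters n" "reduce G ?q = reduce G (loop_word k)"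
      using walk_loop_word [OF p v] by blast
    have arcs: "set p \<subseteq> arcs G" "set (tp v) \<subseteq> arcs G"
      using v walk_subset [OF p] by auto
    have "assoc_aut n \<G> (reduce (rose n) k) = lab ?q"
      using k arcs walk_subset [OF loop_word_walk [OF k(1)]] unfolding lab_loop_word [OF k(1), symmetric]
      by (intro lab_cong) auto
    also have "\<dots> = \<one>\<^bsub>free_grp n\<^esub>"
      using arcs \<open>lab p = []\<close> by (simp add: conj one_free_grp)
    finally have "assoc_aut n \<G> (reduce (rose n) k) = assoc_aut n \<G> \<one>\<^bsub>free_grp n\<^esub>" by simp
    then have "reduce (rose n) k = []"
      using bij k(1) by (auto simp: bij_betw_def inj_on_def one_free_grp carrier_free_grp rose.set_reduce [THEN order_trans])
    then have "reduce G ?q = reduce G (tp v @ rev_path G (tp v))"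
      using k reduce_loop_word by simp
    then have "reduce G (p @ rev_path G (tp v)) = reduce G (rev_path G (tp v))"
      unfolding reduce_append_cancel .
    then have "reduce G ((p @ rev_path G (tp v)) @ tp v) = reduce G (rev_path G (tp v) @ tp v)"
      by (rule reduce_append_cong) simp
    then show "reduce G p = []"
      using reduce_append_cong [of p p "rev_path G (tp v) @ tp v" "[]"] by simp
  qed
  moreover have "pi1_surj"
    unfolding pi1_surj_def
  proof (intro ballI)
    fix v w assume v: "v \<in> verts G" and w: "w \<in> ?F"
    define h where "h = lab (tp v)"
    have h: "h \<in> ?F" using v by (simp add: h_def)
    have "h \<otimes>\<^bsub>free_grp n\<^esub> w \<otimes>\<^bsub>free_grp n\<^esub> inv\<^bsub>free_grp n\<^esub> h \<in> assoc_aut n \<G> ` ?F"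
      using bij h w by (simp add: bij_betw_def)
    then obtain k where k: "k \<in> ?F"
      "assoc_aut n \<G> k = h \<otimes>\<^bsub>free_grp n\<^esub> w \<otimes>\<^bsub>free_grp n\<^esub> inv\<^bsub>free_grp n\<^esub> h"
      by auto
    then have k': "set k \<subseteq> letters n" "reduce (rose n) k = k"
      by (auto simp: carrier_free_grp rose.reduce_reduced)
    let ?p = "rev_path G (tp v) @ loop_word k @ tp v"
    have "walk G (arcs G) v ?p v"
      using loop_word_walk [OF k'(1)] walk_arcs [OF tp_walk [OF v]] walk_arcs [OF walk_rev_path [OF tp_walk [OF v]]]
      by (auto simp: walk_append)
    moreover have "lab ?p = inv\<^bsub>free_grp n\<^esub> h \<otimes>\<^bsub>free_grp n\<^esub> ((h \<otimes>\<^bsub>free_grp n\<^esub> w \<otimes>\<^bsub>free_grp n\<^esub> inv\<^bsub>free_grp n\<^esub> h) \<otimes>\<^bsub>free_grp n\<^esub> h)"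
      using k k' v by (simp add: lab_append lab_rev_path lab_loop_word h_def)
    moreover have "\<dots> = w"
      using h w by (simp add: free_grp.m_assoc free_grp.inv_solve_left')
    ultimately show "\<exists>p. walk G (arcs G) v p v \<and> lab p = w" by auto
  qed
  ultimately show ?thesis
    using branded_graph_iff pre_branded_axioms by blast
qed

end


section \<open>Edge swaps\<close>

lemma (in group) inv_cancel_left [simp]:
  assumes "x \<in> carrier G" "y \<in> carrier G"
  shows "x \<otimes> (inv x \<otimes> y) = y" "inv x \<otimes> (x \<otimes> y) = y"
  using assms by (simp_all add: m_assoc [symmetric])

context rooted_tree
begin

text \<open>Without \<open>d\<close> the tree falls into two parts, and \<open>s\<close> crosses
  from the part of the base to the other one. The vertices beyond \<open>d\<close> are now reached
  through \<open>s\<close>, while within each part the paths are as before.\<close>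

lemma exchange_rooted_tree:
  assumes d: "outward d" and s: "s \<in> arcs G" "tail G s \<notin> beyond d" "head G s \<in> beyond d"
  shows "rooted_tree G (insert s (insert (bar G s) (A - {d, bar G d}))) b"
proof -
  let ?A0 = "A - {d, bar G d}"
  let ?A' = "insert s (insert (bar G s) ?A0)"
  interpret A0: bar_subgraph G ?A0
    by unfold_locales auto
  interpret A': bar_subgraph G ?A'
    using s(1) by unfold_locales auto
  define r where "r v = drop (length (tp (head G d))) (tp v)" for v
  have r: "tp v = tp (head G d) @ r v" "walk G ?A0 (head G d) (r v) v" if "v \<in> beyond d" for v
  proof -
    note v = that
    obtain r' where "tp v = tp (head G d) @ r'" "walk G ?A0 (head G d) r' v"
      by (rule beyond_split [OF v d])
    then show "tp v = tp (head G d) @ r v" "walk G ?A0 (head G d) (r v) v"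
      by (simp_all add: r_def)
  qed
  \<comment> \<open>The new way from the base to the head of \<open>d\<close>: to the tail of
    \<open>s\<close>, across \<open>s\<close>, then backwards inside the part beyond
    \<open>d\<close>. From there \<open>r v\<close> continues to \<open>v\<close> as in the old
    tree.\<close>
  define K where "K = tp (tail G s) @ [s] @ rev_path G (r (head G s))"
  define P where "P v = (if v \<in> beyond d then K @ r v else tp v)" for v
  show ?thesis
  proof (rule A'.rooted_treeI [where P = P])
    fix v assume v: "v \<in> verts G"
    have tp: "walk G ?A' b (tp u) u" if "u \<in> verts G" "u \<notin> beyond d" for u
      by (rule walk_mono [OF notin_beyond_walk [OF that d]]) auto
    have rw: "walk G ?A' (head G d) (r u) u" "walk G ?A' u (rev_path G (r u)) (head G d)"
      if "u \<in> beyond d" for u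
      using walk_mono [OF r(2) [OF that], of ?A'] walk_mono [OF A0.walk_rev_path [OF r(2) [OF that]], of ?A']
      by auto
    show "walk G ?A' b (P v) v"
    proof (cases "v \<in> beyond d")
      case True
      have "walk G ?A' b K (head G d)"
        using tp [OF tail_in [OF s(1)] s(2)] rw(2) [OF s(3)] unfolding K_def walk_append by auto
      with True rw(1) [OF True] show ?thesis
        by (auto simp: P_def walk_append)
    qed (use v tp in \<open>simp add: P_def\<close>)
  next
    fix e assume e: "e \<in> ?A'"
    have s_edge: "reduce G (P (tail G s) @ [s]) = reduce G (P (head G s))"
      using s reduce_append_cong [of "tp (tail G s) @ [s]" "tp (tail G s) @ [s]" "rev_path G (r (head G s)) @ r (head G s)" "[]"]
      by (simp add: P_def K_def)
    show "reduce G (P (tail G e) @ [e]) = reduce G (P (head G e)) \<or>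
          reduce G (P (head G e) @ [bar G e]) = reduce G (P (tail G e))"
    proof (cases "e \<in> ?A0")
      case True
      then have eA: "e \<in> A" "e \<in> arcs G" "tail G e \<in> beyond d \<longleftrightarrow> head G e \<in> beyond d"
        using edge_beyond_iff [of e d] by auto
      have ext: "reduce G (tp (tail G e) @ [e]) = reduce G (tp (head G e))"
        using eA tp_extend [of "tail G e" "[e]" "head G e"] by (simp add: reduce_reduced)
      show ?thesis
      proof (cases "tail G e \<in> beyond d")
        case True
        then have "reduce G (r (tail G e) @ [e]) = reduce G (r (head G e))"
          using ext eA(3) r(1) [of "tail G e"] r(1) [of "head G e"] by simp
        then show ?thesis
          using True eA(3) by (simp add: P_def)
      qed (use ext eA in \<open>simp add: P_def\<close>)
    next
      case False
      then show ?thesis using e s s_edge by auto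
    qed
  qed (rule root_in)
qed

end

context labelled_graph
begin

lemma potential_bar:
  assumes "e \<in> arcs G" "x \<in> carrier (free_grp n)" "y = x \<otimes>\<^bsub>free_grp n\<^esub> [f e]"
  shows "x = y \<otimes>\<^bsub>free_grp n\<^esub> [f (bar G e)]"
  using assms by (simp add: f_bar inv_letter [symmetric] free_grp.m_assoc)

end

text \<open>The change of a potential under a move; \<open>c\<close> will say that the vertex lies
  beyond the separating edge.\<close>

definition twist :: "nat \<Rightarrow> letter list \<Rightarrow> bool \<Rightarrow> letter list \<Rightarrow> letter list" where
  "twist n \<gamma> c x = (if c then inv\<^bsub>free_grp n\<^esub> \<gamma> \<otimes>\<^bsub>free_grp n\<^esub> x else x)"

lemma twist_in [simp]:
  "\<gamma> \<in> carrier (free_grp n) \<Longrightarrow> x \<in> carrier (free_grp n) \<Longrightarrow> twist n \<gamma> c x \<in> carrier (free_grp n)"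
  by (simp add: twist_def)

text \<open>Puts the effect of twisting the two ends of an edge into the shape that
  \<open>whitehead_step\<close> asks for.\<close>

lemma twist_loop:
  assumes "\<gamma> \<in> carrier (free_grp n)" "x \<in> carrier (free_grp n)" "l \<in> carrier (free_grp n)"
    "y \<in> carrier (free_grp n)"
  shows "x \<otimes>\<^bsub>free_grp n\<^esub> l \<otimes>\<^bsub>free_grp n\<^esub> inv\<^bsub>free_grp n\<^esub> y =
    (if P then \<gamma> else \<one>\<^bsub>free_grp n\<^esub>) \<otimes>\<^bsub>free_grp n\<^esub>
    (twist n \<gamma> P x \<otimes>\<^bsub>free_grp n\<^esub> l \<otimes>\<^bsub>free_grp n\<^esub> inv\<^bsub>free_grp n\<^esub> (twist n \<gamma> Q y))
    \<otimes>\<^bsub>free_grp n\<^esub> inv\<^bsub>free_grp n\<^esub> (if Q then \<gamma> else \<one>\<^bsub>free_grp n\<^esub>)"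
  using assms by (simp add: twist_def free_grp.m_assoc free_grp.inv_mult_group)

section \<open>Effect of a swap on the tree and on the automorphism\<close>

context pre_branded
begin

lemma tree_arcs_iff:
  "e \<in> A \<longleftrightarrow> e \<in> arcs G \<and> (\<forall>i<n. e \<noteq> brands \<G> ! i \<and> e \<noteq> bar G (brands \<G> ! i))"
proof
  assume "e \<in> arcs G \<and> (\<forall>i<n. e \<noteq> brands \<G> ! i \<and> e \<noteq> bar G (brands \<G> ! i))"
  then show "e \<in> A" using arc_cases [of e] by metis
next
  assume "e \<in> A"
  then show "e \<in> arcs G \<and> (\<forall>i<n. e \<noteq> brands \<G> ! i \<and> e \<noteq> bar G (brands \<G> ! i))"
    by (metis A_arc bar_A_iff brand_notin_tree)
qed

text \<open>A branded edge with exactly one end beyond \<open>d\<close> reconnects the two parts, so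
  it can take the place of \<open>d\<close>. The last conjunct records the new tree, from which
  \<open>swap_into_tree\<close> reads off which edges stay.\<close>

lemma swap_step:
  assumes i: "i < n" and d: "outward d"
    and cross: "tail G (brands \<G> ! i) \<in> beyond d \<longleftrightarrow> head G (brands \<G> ! i) \<notin> beyond d"
    and aut: "assoc_aut n \<G> \<in> carrier (aut_free n)"
  shows "\<exists>e'. let \<G>' = \<G>\<lparr>brands := (brands \<G>)[i := e']\<rparr> in
    edge_swap \<G> \<G>' \<and> pre_branded n \<G>' \<and> assoc_aut n \<G>' \<in> carrier (aut_free n) \<and>
    inv\<^bsub>aut_free n\<^esub> (assoc_aut n \<G>') \<otimes>\<^bsub>aut_free n\<^esub> assoc_aut n \<G> \<in> whitehead_pair_auts n \<and>
    tree_arcs \<G>' = insert (brands \<G> ! i) (insert (bar G (brands \<G> ! i)) (A - {d, bar G d}))"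
proof -
  define e where "e = brands \<G> ! i"
  define c where "c \<longleftrightarrow> tail G e \<in> beyond d"
  \<comment> \<open>Both orientations are forced: \<open>e'\<close> is directed so that the loop
    with index \<open>i\<close> keeps its label, and \<open>s\<close> is the branded edge directed
    into the part beyond \<open>d\<close>.\<close>
  define e' where "e' = (if c then d else bar G d)"
  define s where "s = (if c then bar G e else e)"
  define \<G>' where "\<G>' = \<G>\<lparr>brands := (brands \<G>)[i := e']\<rparr>"
  have e: "e \<in> arcs G" using i by (simp add: e_def)
  have s: "s \<in> arcs G" "tail G s \<notin> beyond d" "head G s \<in> beyond d" "{s, bar G s} = {e, bar G e}"
    using e cross by (auto simp: s_def c_def e_def)
  have dA: "d \<in> A" "e' \<in> A" using outward_A d by (auto simp: e'_def)
  have \<G>'_simps [simp]: "ugraph \<G>' = G" "marking \<G>' = marking \<G>" "base \<G>' = base \<G>"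
      "brands \<G>' = (brands \<G>)[i := e']"
    by (simp_all add: \<G>'_def)
  have brand': "brands \<G>' ! j = (if j = i then e' else brands \<G> ! j)" if "j < n" for j
    using that by simp
  have e'_neq: "e' \<noteq> brands \<G> ! j" "e' \<noteq> bar G (brands \<G> ! j)" "bar G e' \<noteq> brands \<G> ! j" if "j < n" for j
    using dA(2) brand_notin_tree [OF that] by (metis bar_A_iff)+
  have distinct': "brands \<G>' ! j \<noteq> brands \<G>' ! k \<and> brands \<G>' ! j \<noteq> bar G (brands \<G>' ! k)"
    if "j < n" "k < n" "j \<noteq> k" for j k
    unfolding brand' [OF that(1)] brand' [OF that(2)]
    using that brands_distinct [of j k] e'_neq by (auto dest: sym)
  have A': "tree_arcs \<G>' = insert e (insert (bar G e) (A - {d, bar G d}))"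
  proof (rule Set.set_eqI)
    fix x
    let ?Q = "\<lambda>x. \<forall>j<n. j \<noteq> i \<longrightarrow> x \<noteq> brands \<G> ! j \<and> x \<noteq> bar G (brands \<G> ! j)"
    have "y \<in> set (brands \<G>') \<longleftrightarrow> y = e' \<or> (\<exists>j<n. j \<noteq> i \<and> y = brands \<G> ! j)" for y
      using i by (auto simp: in_set_conv_nth nth_list_update)
    then have "x \<in> tree_arcs \<G>' \<longleftrightarrow> x \<in> arcs G \<and> x \<notin> {e', bar G e'} \<and> ?Q x"
      unfolding tree_arcs_def by (auto simp: image_iff)
    also have "{e', bar G e'} = {d, bar G d}"
      by (auto simp: e'_def)
    finally have A'_iff: "x \<in> tree_arcs \<G>' \<longleftrightarrow> x \<in> arcs G \<and> x \<notin> {d, bar G d} \<and> ?Q x" .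
    have A_iff: "x \<in> A \<longleftrightarrow> x \<in> arcs G \<and> x \<noteq> e \<and> x \<noteq> bar G e \<and> ?Q x"
      unfolding tree_arcs_iff e_def using i by blast
    have Q: "?Q e"
      unfolding e_def using brands_distinct [OF i] by simp
    have "?Q (bar G e)"
    proof (intro allI impI)
      fix j assume j: "j < n" "j \<noteq> i"
      show "bar G e \<noteq> brands \<G> ! j \<and> bar G e \<noteq> bar G (brands \<G> ! j)"
        using brands_distinct [OF i j(1)] j(2) bar_bar unfolding e_def by metis
    qed
    note Q = Q this
    have "e \<notin> A"
      using brand_notin_tree [OF i] by (simp add: e_def)
    then have nd: "e \<notin> {d, bar G d}" "bar G e \<notin> {d, bar G d}"
      using dA(1) bar_A_iff bar_bar by (metis empty_iff insert_iff)+
    show "x \<in> tree_arcs \<G>' \<longleftrightarrow> x \<in> insert e (insert (bar G e) (A - {d, bar G d}))"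
    proof (cases "x = e \<or> x = bar G e")
      case True
      then have "x \<in> arcs G \<and> x \<notin> {d, bar G d} \<and> ?Q x"
      proof
        assume "x = e"
        show ?thesis unfolding \<open>x = e\<close> using e nd(1) Q(1) by (intro conjI)
      next
        assume "x = bar G e"
        show ?thesis unfolding \<open>x = bar G e\<close> bar_in_iff using e nd(2) Q(2) by (intro conjI)
      qed
      with True A'_iff show ?thesis by blast
    next
      case False
      then show ?thesis
        unfolding A'_iff insert_iff Diff_iff A_iff by blast
    qed
  qed
  interpret T': rooted_tree G "tree_arcs \<G>'" "base \<G>"
    using exchange_rooted_tree [OF d s(1,2,3)] by (cases c) (simp_all add: A' s_def insert_commute)
  interpret B': pre_branded n \<G>'
  proof (intro pre_branded.intro labelled_tree.intro pre_branded_axioms.intro)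
    show "rooted_tree (ugraph \<G>') (tree_arcs \<G>') (base \<G>')"
      using T'.rooted_tree_axioms by simp
    show "labelled_graph (ugraph \<G>') n (emap (marking \<G>'))"
      using labelled_graph_axioms by simp
    show "set (brands \<G>') \<subseteq> arcs (ugraph \<G>')"
      using brands_arcs dA set_update_subset_insert [of "brands \<G>" i e'] by auto
  qed (use distinct' in auto)
  define g where "g j = lab (brand_loop \<G> j)" for j
  define g' where "g' j = lab (brand_loop \<G>' j)" for j
  define h where "h v = lab (tp v)" for v
  define \<gamma> where "\<gamma> = letter_value n g (i, c)"
  define h' where "h' v = twist n \<gamma> (v \<in> beyond d) (h v)" for v
  have g: "g j \<in> carrier (free_grp n)" if "j < n" for j
    using lab_brand_loop_in that by (simp add: g_def)
  have g': "g' j \<in> carrier (free_grp n)" if "j < n" for j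
    using B'.lab_brand_loop_in that by (simp add: g'_def)
  have \<gamma>: "\<gamma> \<in> carrier (free_grp n)"
    using g i by (simp add: \<gamma>_def letter_value_in)
  have h: "potential h"
    unfolding h_def by (rule potential_lab_tp)
  have h_in [simp]: "h v \<in> carrier (free_grp n)" if "v \<in> verts G" for v
    using h that by (simp add: potential_def)
  have h_edge: "h (head G x) = h (tail G x) \<otimes>\<^bsub>free_grp n\<^esub> [f x]" if "x \<in> A" for x
    using h that by (simp add: potential_def)
  have g_eq: "g j = h (tail G (brands \<G> ! j)) \<otimes>\<^bsub>free_grp n\<^esub> [f (brands \<G> ! j)] \<otimes>\<^bsub>free_grp n\<^esub>
      inv\<^bsub>free_grp n\<^esub> (h (head G (brands \<G> ! j)))" if "j < n" for j
    unfolding g_def using lab_brand_loop [OF h that] .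
  \<comment> \<open>The letter \<open>(i, c)\<close> is chosen for this equation: after twisting by
    its value \<gamma>, the potential equation holds along the new tree edge
    \<open>s\<close>.\<close>
  have s_edge: "inv\<^bsub>free_grp n\<^esub> \<gamma> \<otimes>\<^bsub>free_grp n\<^esub> h (head G s) = h (tail G s) \<otimes>\<^bsub>free_grp n\<^esub> [f s]"
  proof (cases c)
    case True
    then show ?thesis
      using e g_eq [OF i, folded e_def]
      by (simp add: \<gamma>_def s_def letter_value_def f_bar inv_letter [symmetric] free_grp.m_assoc free_grp.inv_mult_group)
  next
    case False
    then show ?thesis
      using e g i g_eq [OF i, folded e_def]
      by (simp add: \<gamma>_def s_def letter_value_def free_grp.m_assoc)
  qed
  have h': "B'.potential h'"
    unfolding B'.potential_def
  proof (intro conjI ballI)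
    show "h' v \<in> carrier (free_grp n)" if "v \<in> verts (ugraph \<G>')" for v
      using that \<gamma> by (simp add: h'_def)
    show "h' (base \<G>') = []"
      using h root_notin_beyond by (simp add: h'_def twist_def potential_def)
    fix x assume "x \<in> tree_arcs \<G>'"
    then have x: "x = s \<or> x = bar G s \<or> x \<in> A \<and> x \<noteq> d \<and> x \<noteq> bar G d"
      unfolding A' using s(4) by auto
    have hs: "h' (head G s) = h' (tail G s) \<otimes>\<^bsub>free_grp n\<^esub> [f s]"
      using s s_edge by (simp add: h'_def twist_def)
    have "h' (tail G s) = h' (head G s) \<otimes>\<^bsub>free_grp n\<^esub> [f (bar G s)]"
      using potential_bar [OF s(1) _ hs] \<gamma> s(1) by (simp add: h'_def)
    moreover have "h' (head G x) = h' (tail G x) \<otimes>\<^bsub>free_grp n\<^esub> [f x]" if "x \<in> A" "x \<noteq> d" "x \<noteq> bar G d"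
      using that edge_beyond_iff [of x d] h_edge [of x] \<gamma> by (simp add: h'_def twist_def free_grp.m_assoc)
    ultimately show "h' (head (ugraph \<G>') x) = h' (tail (ugraph \<G>') x) \<otimes>\<^bsub>free_grp n\<^esub> [emap (marking \<G>') x]"
      using x hs s(1) by auto
  qed
  have g'_eq: "g' j = h' (tail G (brands \<G>' ! j)) \<otimes>\<^bsub>free_grp n\<^esub> [f (brands \<G>' ! j)] \<otimes>\<^bsub>free_grp n\<^esub>
      inv\<^bsub>free_grp n\<^esub> (h' (head G (brands \<G>' ! j)))" if "j < n" for j
    unfolding g'_def using B'.lab_brand_loop [OF h' that] by simp
  have d_in: "d \<in> arcs G" "tail G d \<notin> beyond d" "head G d \<in> beyond d"
    using dA tail_notin_beyond head_beyond d by auto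
  \<comment> \<open>Along \<open>d\<close> the old potential satisfies its equation and only the
    head of \<open>d\<close> is twisted, so the new loop contributes precisely \<gamma> or its
    inverse.\<close>
  have "g' i = g i"
  proof (cases c)
    case True
    then show ?thesis
      using g'_eq [OF i] d_in i \<gamma> h_edge [OF dA(1), symmetric]
      by (simp add: e'_def h'_def twist_def \<gamma>_def letter_value_def free_grp.inv_mult_group)
  next
    case False
    have "h (tail G d) = h (head G d) \<otimes>\<^bsub>free_grp n\<^esub> [f (bar G d)]"
      using potential_bar [OF d_in(1) _ h_edge [OF dA(1)]] d_in by simp
    with False show ?thesis
      using g'_eq [OF i] d_in i \<gamma> g
      by (simp add: e'_def h'_def twist_def \<gamma>_def letter_value_def free_grp.m_assoc)
  qed
  moreover have "g j = (if tail G (brands \<G> ! j) \<in> beyond d then \<gamma> else \<one>\<^bsub>free_grp n\<^esub>) \<otimes>\<^bsub>free_grp n\<^esub> g' j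
      \<otimes>\<^bsub>free_grp n\<^esub> inv\<^bsub>free_grp n\<^esub> (if head G (brands \<G> ! j) \<in> beyond d then \<gamma> else \<one>\<^bsub>free_grp n\<^esub>)"
    if "j < n" "j \<noteq> i" for j
    unfolding g_eq [OF that(1)] g'_eq [OF that(1)] brand' [OF that(1)] h'_def
    using that \<gamma> by (simp add: twist_loop [symmetric])
  ultimately have white: "free_ext n g' \<in> carrier (aut_free n) \<and>
      inv\<^bsub>aut_free n\<^esub> (free_ext n g') \<otimes>\<^bsub>aut_free n\<^esub> free_ext n g \<in> whitehead_pair_auts n"
    using aut g g' i unfolding assoc_aut_eq g_def [symmetric]
    by (intro whitehead_step [where \<gamma> = \<gamma> and s = c and P = "\<lambda>j. tail G (brands \<G> ! j) \<in> beyond d"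
            and Q = "\<lambda>j. head G (brands \<G> ! j) \<in> beyond d"]) (auto simp: \<gamma>_def)
  have "edge_swap \<G> \<G>'"
  proof -
    let ?p = "tp (tail G e)" and ?p' = "tp (head G e)"
    have mem: "x \<in> set (drop (length (longest_common_prefix q q')) q)" if "x \<in> set q" "x \<notin> set q'" for x q q'
    proof -
      let ?a = "longest_common_prefix q q'"
      have "x \<notin> set ?a"
        using longest_common_prefix_prefix2 [of q q'] that(2) set_mono_prefix by blast
      moreover obtain z where "q = ?a @ z"
        using longest_common_prefix_prefix1 [of q q'] by (auto simp: prefix_def)
      ultimately show ?thesis
        using that(1) by (metis Un_iff append_eq_conv_conj set_append)
    qed
    have com: "longest_common_prefix q q' = longest_common_prefix q' q" for q q' :: "'b list"
      by (induction q q' rule: longest_common_prefix.induct) auto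
    \<comment> \<open>Exactly one end of \<open>e\<close> lies beyond \<open>d\<close>, so
      \<open>d\<close> occurs on just one of the two tree paths, hence after their common initial
      segment. This makes it an admissible choice.\<close>
    have sep: "c \<longleftrightarrow> d \<in> set ?p" "\<not> c \<longleftrightarrow> d \<in> set ?p'"
      using cross e by (auto simp: c_def beyond_def e_def)
    then have "e' \<in> set (drop (length (longest_common_prefix ?p ?p')) ?p) \<or>
          bar G e' \<in> set (drop (length (longest_common_prefix ?p ?p')) ?p')"
      using mem [of d ?p ?p'] mem [of d ?p' ?p] com [of ?p ?p'] by (cases c) (auto simp: e'_def)
    moreover have "tail G e \<noteq> head G e" using sep by auto
    ultimately show ?thesis
      unfolding edge_swap_def base_path_eq Let_def
      using i by (intro exI [of _ i] exI [of _ e'] conjI) (simp_all add: e_def \<G>'_def)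
  qed
  moreover have "assoc_aut n \<G> = free_ext n g" "assoc_aut n \<G>' = free_ext n g'"
    by (simp_all add: assoc_aut_eq B'.assoc_aut_eq g_def [abs_def] g'_def [abs_def])
  ultimately show ?thesis
    using white A' B'.pre_branded_axioms
    unfolding Let_def by (intro exI [of _ e']) (simp flip: \<G>'_def e_def)
qed

text \<open>The edge removed from the tree can be chosen incident to the head of \<open>s\<close>, so \<open>t\<close> stays.\<close>

lemma swap_into_tree:
  assumes s: "s \<in> arcs G" "s \<notin> A" "tail G s \<noteq> head G s"
    and t: "head G s \<noteq> tail G t" "head G s \<noteq> head G t" "t \<in> arcs G"
    and aut: "assoc_aut n \<G> \<in> carrier (aut_free n)"
  obtains \<G>' where "edge_swap \<G> \<G>'" "pre_branded n \<G>'" "assoc_aut n \<G>' \<in> carrier (aut_free n)"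
    "inv\<^bsub>aut_free n\<^esub> (assoc_aut n \<G>') \<otimes>\<^bsub>aut_free n\<^esub> assoc_aut n \<G> \<in> whitehead_pair_auts n"
    "ugraph \<G>' = G" "marking \<G>' = marking \<G>" "s \<in> tree_arcs \<G>'" "t \<in> A \<Longrightarrow> t \<in> tree_arcs \<G>'"
proof -
  obtain d where d: "outward d" "head G s = tail G d \<or> head G s = head G d"
      "head G s \<in> beyond d \<longleftrightarrow> tail G s \<notin> beyond d"
    using separating_edge [of "head G s" "tail G s"] s by auto
  obtain i where i: "i < n" "s = brands \<G> ! i \<or> s = bar G (brands \<G> ! i)"
    using s arc_cases [of s] by metis
  have "t \<noteq> d" "t \<noteq> bar G d"
    using t d(2) outward_A [OF d(1)] by auto
  moreover have "tail G (brands \<G> ! i) \<in> beyond d \<longleftrightarrow> head G (brands \<G> ! i) \<notin> beyond d"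
    using i d(3) by auto
  note swap_step [OF i(1) d(1) this aut]
  ultimately show ?thesis
    using i(2) that unfolding Let_def by fastforce
qed

end


section \<open>Branded folds\<close>

text \<open>Such a \<open>q\<close> is constant on classes and moves each point inside its class, so
  it chooses representatives and its fibres are the classes.\<close>

lemma equivclp_iff_eq:
  assumes "\<And>x y. r x y \<Longrightarrow> q x = q y" and "\<And>x. equivclp r x (q x)"
  shows "q u = q v \<longleftrightarrow> equivclp r u v"
proof
  show "q u = q v" if "equivclp r u v"
    using that by (induction rule: equivclp_induct) (auto dest: assms(1))
  show "equivclp r u v" if "q u = q v"
    using assms(2) [of u] assms(2) [of v] that by (metis equivclp_sym equivclp_trans)
qed

text \<open>In a fold of type 1 both edges lie in the tree, in a fold of type 2 \<open>s1\<close> is a loop.\<close>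

locale fold_pair = pre_branded n \<G> for n and \<G> :: "('v, 'e) branded" +
  fixes s1 s2 :: 'e
  assumes s1: "s1 \<in> arcs (ugraph \<G>)" and s2: "s2 \<in> tree_arcs \<G>" and s1_neq_s2: "s1 \<noteq> s2"
    and tails: "tail (ugraph \<G>) s1 = tail (ugraph \<G>) s2"
    and labels: "emap (marking \<G>) s1 = emap (marking \<G>) s2"
    and heads: "head (ugraph \<G>) s1 \<noteq> head (ugraph \<G>) s2"
    and not_loop: "tail (ugraph \<G>) s2 \<noteq> head (ugraph \<G>) s2"
    and type: "s1 \<in> tree_arcs \<G> \<longleftrightarrow> tail (ugraph \<G>) s1 \<noteq> head (ugraph \<G>) s1"
begin

text \<open>The head of \<open>s1\<close> represents the class of the two heads, and every other
  vertex represents itself; \<open>qe\<close> does the same for edges. The quotient thus keeps the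
  types of the original graph.\<close>

definition qv :: "'v \<Rightarrow> 'v" where
  "qv v = (if v = head G s2 then head G s1 else v)"

definition qe :: "'e \<Rightarrow> 'e" where
  "qe e = (if e = s2 then s1 else if e = bar G s2 then bar G s1 else e)"

definition arcs' :: "'e set" where
  "arcs' = arcs G - {s2, bar G s2}"

definition G' :: "('v, 'e) bar_graph" where
  "G' = \<lparr>verts = verts G - {head G s2}, arcs = arcs', tail = qv \<circ> tail G, head = qv \<circ> head G,
         bar = perm_restrict (bar G) arcs'\<rparr>"

definition \<G>' :: "('v, 'e) branded" where
  "\<G>' = \<lparr>ugraph = G', marking = marking \<G>, base = qv (base \<G>), brands = brands \<G>\<rparr>"

lemma G'_simps [simp]:
  "verts G' = verts G - {head G s2}" "arcs G' = arcs'" "tail G' e = qv (tail G e)"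
  "head G' e = qv (head G e)" "e \<in> arcs' \<Longrightarrow> bar G' e = bar G e"
  by (simp_all add: G'_def perm_restrict_def)

lemma \<G>'_simps [simp]:
  "ugraph \<G>' = G'" "marking \<G>' = marking \<G>" "base \<G>' = qv (base \<G>)" "brands \<G>' = brands \<G>"
  by (simp_all add: \<G>'_def)

lemma s2_arc [simp]: "s2 \<in> arcs G" and s1_arc [simp]: "s1 \<in> arcs G"
  using s1 s2 by auto

lemma bar_s2_neq: "bar G s2 \<noteq> s2"
  by (rule bar_neq) simp

text \<open>Otherwise \<open>s2\<close> and its inverse would carry the same letter, but no letter
  is its own inverse.\<close>

lemma s1_neq_bar_s2: "s1 \<noteq> bar G s2"
proof
  assume "s1 = bar G s2"
  then have "f s2 = bar (rose n) (f s2)"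
    using labels f_bar [of s2] by simp
  then show False
    using rose.bar_neq [of "f s2" n] f_in [of s2] by simp
qed

lemma bar_s1_neq: "bar G s1 \<noteq> s2" "bar G s1 \<noteq> bar G s2"
  using s1_neq_bar_s2 s1_neq_s2 by auto

lemma arcs'_bar [simp]: "bar G e \<in> arcs' \<longleftrightarrow> e \<in> arcs'"
  by (auto simp: arcs'_def)

lemma arcs'_arcs: "e \<in> arcs' \<Longrightarrow> e \<in> arcs G"
  by (simp add: arcs'_def)

lemma s1_arcs' [simp]: "s1 \<in> arcs'"
  using s1_neq_s2 s1_neq_bar_s2 by (simp add: arcs'_def)

lemma qv_in: "v \<in> verts G \<Longrightarrow> qv v \<in> verts G'"
  using heads by (auto simp: qv_def)

lemma qv_id: "v \<in> verts G' \<Longrightarrow> qv v = v"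
  by (simp add: qv_def)

lemma qe_in: "e \<in> arcs G \<Longrightarrow> qe e \<in> arcs'"
  using s1_arcs' by (auto simp: qe_def) (auto simp: arcs'_def)

lemma qe_id: "e \<in> arcs' \<Longrightarrow> qe e = e"
  by (simp add: qe_def arcs'_def)

lemma qe_bar: "e \<in> arcs G \<Longrightarrow> qe (bar G e) = bar G (qe e)"
  using bar_s2_neq by (auto simp: qe_def)

lemma tail_qe: "e \<in> arcs G \<Longrightarrow> qv (tail G (qe e)) = qv (tail G e)"
  using tails by (auto simp: qe_def qv_def)

lemma f_qe: "e \<in> arcs G \<Longrightarrow> f (qe e) = f e"
  using labels by (auto simp: qe_def f_bar)

lemma labelled_G': "labelled_graph G' n f"
proof unfold_locales
  show "bar G' (bar G' e) = e" for e
    by (simp add: G'_def perm_restrict_def)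
  show "e \<in> arcs G' \<Longrightarrow> bar G' e \<noteq> e" for e
    using bar_neq arcs'_arcs by simp
  show "e \<notin> arcs G' \<Longrightarrow> bar G' e = e" for e
    by (simp add: G'_def perm_restrict_def)
  show "e \<in> arcs G' \<Longrightarrow> tail G' e \<in> verts G'" "e \<in> arcs G' \<Longrightarrow> head G' e \<in> verts G'" for e
    using arcs'_arcs qv_in [of "tail G e"] qv_in [of "head G e"] by auto
qed (auto simp: arcs'_arcs f_bar)

sublocale G': labelled_graph G' n f
  by (rule labelled_G')

lemma fold_quotient: "fold_quotient G s1 s2 G' \<lparr>vmap = qv, emap = qe\<rparr>"
proof -
  have "is_graph_map G G' \<lparr>vmap = qv, emap = qe\<rparr>"
    using qv_in qe_in tail_qe qe_bar by (auto simp: is_graph_map_def)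
  moreover have "qv ` verts G = verts G'"
    using qv_in qv_id by (auto simp del: G'_simps(1)) (metis Diff_iff G'_simps(1) image_eqI)
  moreover have "qe ` arcs G = arcs G'"
    using qe_in qe_id arcs'_arcs by auto (metis image_eqI)
  moreover have "qv u = qv v \<longleftrightarrow> equivclp (\<lambda>x y. x = head G s1 \<and> y = head G s2) u v" for u v
    by (rule equivclp_iff_eq) (auto simp: qv_def intro: equivclp_sym r_into_equivclp)
  moreover have "qe d = qe e \<longleftrightarrow>
      equivclp (\<lambda>x y. x = s1 \<and> y = s2 \<or> x = bar G s1 \<and> y = bar G s2) d e" for d e
    using s1_neq_s2 s1_neq_bar_s2 bar_s1_neq bar_s2_neq
    by (intro equivclp_iff_eq) (auto simp: qe_def intro: equivclp_sym r_into_equivclp)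
  ultimately show ?thesis
    by (simp add: fold_quotient_def)
qed

text \<open>The edge that disappears lies in the tree, so the branded edges represent themselves in
  the quotient and the list \<open>brands\<close> stays literally the same.\<close>

lemma brand_arcs': "i < n \<Longrightarrow> brands \<G> ! i \<in> arcs'"
  using brand_notin_tree [of i] s2 by (auto simp: arcs'_def)

lemma tree_arcs': "tree_arcs \<G>' = A - {s2, bar G s2}"
proof -
  have "bar G' e = bar G e" if "e \<in> set (brands \<G>)" for e
    using that brand_arcs' by (metis G'_simps(5) in_set_conv_nth length_brands)
  then have "bar G' ` set (brands \<G>) = bar G ` set (brands \<G>)" by auto
  then show ?thesis
    by (simp only: tree_arcs_def \<G>'_simps G'_simps arcs'_def) blast
qed

lemma branded_fold: "branded_fold \<G> \<G>'"
proof -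
  have "fold_type1 \<G> s1 s2 \<or> fold_type2 \<G> s2 s1"
    using type heads not_loop tails s2 by (auto simp: fold_type1_def fold_type2_def brand_tree_eq)
  moreover have "map qe (brands \<G>) = brands \<G>"
    using brand_arcs' qe_id by (intro nth_equalityI) auto
  ultimately show ?thesis
    unfolding branded_fold_def Let_def
    using fold_quotient f_qe s1_neq_s2 tails labels
    by (intro bexI [of _ s1] bexI [of _ s2] exI [of _ "\<lparr>vmap = qv, emap = qe\<rparr>"] conjI) auto
qed

text \<open>The image of the tree: \<open>s2\<close> is identified with \<open>s1\<close> or, if \<open>s1\<close> is a loop, contracted.\<close>

definition \<sigma> :: "'e \<Rightarrow> 'e list" where
  "\<sigma> e = (if e = s2 then (if s1 \<in> A then [s1] else [])
          else if e = bar G s2 then (if s1 \<in> A then [bar G s1] else [])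
          else [e])"

lemma \<sigma>_cancel: "e \<in> A \<Longrightarrow> reduce G' (\<sigma> e @ \<sigma> (bar G e)) = []"
proof -
  assume "e \<in> A"
  have c: "reduce G' [x, bar G x] = []" if "x \<in> arcs'" for x
    using G'.reduce_inverse [of "[x]"] that by simp
  have "e \<in> arcs'" if "e \<noteq> s2" "e \<noteq> bar G s2"
    using that \<open>e \<in> A\<close> by (simp add: arcs'_def)
  then show ?thesis
    using c [of s1] c [of "bar G s1"] c [of e] bar_s2_neq by (auto simp: \<sigma>_def)
qed

lemma \<sigma>_walk: "e \<in> A \<Longrightarrow> walk G' (tree_arcs \<G>') (qv (tail G e)) (\<sigma> e) (qv (head G e))"
  using type tails s1_neq_s2 s1_neq_bar_s2 bar_s1_neq heads not_loop
  by (auto simp: \<sigma>_def tree_arcs' qv_def)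

lemma \<sigma>_walks: "walk G A u p v \<Longrightarrow> walk G' (tree_arcs \<G>') (qv u) (concat (map \<sigma> p)) (qv v)"
  by (induction p arbitrary: u) (auto simp: walk_append intro: \<sigma>_walk)

lemma \<sigma>_edge:
  assumes "e \<in> A"
  shows "reduce G' (concat (map \<sigma> (tp (tail G e))) @ \<sigma> e) = reduce G' (concat (map \<sigma> (tp (head G e))))"
proof -
  let ?p = "tp (tail G e) @ [e]"
  have "set ?p \<subseteq> A" using assms set_tp [of "tail G e"] by simp
  then have "reduce G' (concat (map \<sigma> (reduce G ?p))) = reduce G' (concat (map \<sigma> ?p))"
    by (intro reduce_substitute G'.bar_involution_axioms \<sigma>_cancel) blast
  moreover have "reduce G ?p = tp (head G e)"
    using assms by (intro tp_extend) auto
  ultimately show ?thesis by simp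
qed

text \<open>For tree edges with a common tail, the paths to both heads become the path to the tail
  followed by \<open>s1\<close>. If \<open>s1\<close> is a loop, its head is the tail of
  \<open>s2\<close>, and \<open>s2\<close> is contracted. So the images of tree paths depend only on
  the vertex of the quotient.\<close>

lemma \<sigma>_qv:
  "reduce G' (concat (map \<sigma> (tp (qv v)))) = reduce G' (concat (map \<sigma> (tp v)))"
proof (cases "v = head G s2")
  case True
  show ?thesis
  proof (cases "s1 \<in> A")
    case s1A: True
    show ?thesis
      using \<sigma>_edge [OF s1A] \<sigma>_edge [OF s2] s1A True s1_neq_s2 s1_neq_bar_s2 tails
      by (simp add: qv_def \<sigma>_def)
  next
    case False
    then show ?thesis
      using \<sigma>_edge [OF s2] True type tails by (simp add: qv_def \<sigma>_def)
  qed
qed (simp add: qv_def)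

lemma rooted_tree': "rooted_tree G' (tree_arcs \<G>') (base \<G>')"
proof -
  interpret T': bar_subgraph G' "tree_arcs \<G>'"
    by unfold_locales (auto simp: tree_arcs' arcs'_def perm_restrict_def G'_def)
  show ?thesis
  proof (rule T'.rooted_treeI [where P = "\<lambda>v. concat (map \<sigma> (tp v))"])
    show "base \<G>' \<in> verts G'" using qv_in [OF root_in] by simp
    show "walk G' (tree_arcs \<G>') (base \<G>') (concat (map \<sigma> (tp v))) v" if "v \<in> verts G'" for v
      using \<sigma>_walks [OF tp_walk [of v]] that qv_id [OF that] by simp
    fix e assume "e \<in> tree_arcs \<G>'"
    then have e: "e \<in> A" "\<sigma> e = [e]" by (auto simp: tree_arcs' \<sigma>_def)
    have "reduce G' (concat (map \<sigma> (tp (qv (tail G e)))) @ [e])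
        = reduce G' (concat (map \<sigma> (tp (tail G e))) @ [e])"
      by (intro G'.reduce_append_cong \<sigma>_qv refl)
    then show "reduce G' (concat (map \<sigma> (tp (tail G' e))) @ [e]) = reduce G' (concat (map \<sigma> (tp (head G' e)))) \<or>
       reduce G' (concat (map \<sigma> (tp (head G' e))) @ [bar G' e]) = reduce G' (concat (map \<sigma> (tp (tail G' e))))"
      using \<sigma>_edge [OF e(1)] e(2) \<sigma>_qv by simp
  qed
qed

sublocale B': pre_branded n \<G>'
proof (intro pre_branded.intro labelled_tree.intro pre_branded_axioms.intro)
  show "rooted_tree (ugraph \<G>') (tree_arcs \<G>') (base \<G>')"
    using rooted_tree' by simp
  show "labelled_graph (ugraph \<G>') n (emap (marking \<G>'))"
    using labelled_G' by simp
  show "set (brands \<G>') \<subseteq> arcs (ugraph \<G>')"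
    using brand_arcs' by (metis G'_simps(2) \<G>'_simps(1,4) in_set_conv_nth length_brands subsetI)
  show "brands \<G>' ! i \<noteq> brands \<G>' ! j \<and> brands \<G>' ! i \<noteq> bar (ugraph \<G>') (brands \<G>' ! j)"
    if "i < n" "j < n" "i \<noteq> j" for i j
    using brands_distinct [OF that] brand_arcs' [OF that(2)] by simp
qed simp

text \<open>A function on the old vertices that agrees on the two heads descends to the quotient. If
  it satisfies the edge equations away from \<open>s2\<close>, it is the potential there and
  computes the new loops.\<close>

lemma assoc_aut_fold_eqI:
  assumes h': "\<And>v. v \<in> verts G \<Longrightarrow> h' v \<in> carrier (free_grp n)" "h' (base \<G>) = []"
    and edge: "\<And>e. e \<in> A - {s2, bar G s2} \<Longrightarrow> h' (head G e) = h' (tail G e) \<otimes>\<^bsub>free_grp n\<^esub> [f e]"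
    and eq: "h' (head G s1) = h' (head G s2)" and j: "j < n"
  shows "B'.lab (brand_loop \<G>' j) = h' (tail G (brands \<G> ! j)) \<otimes>\<^bsub>free_grp n\<^esub> [f (brands \<G> ! j)] \<otimes>\<^bsub>free_grp n\<^esub>
      inv\<^bsub>free_grp n\<^esub> (h' (head G (brands \<G> ! j)))"
proof -
  have qv: "h' (qv v) = h' v" for v
    using eq by (simp add: qv_def)
  have "B'.potential h'"
    unfolding B'.potential_def using h' edge by (auto simp: qv tree_arcs')
  from B'.lab_brand_loop [OF this j] show ?thesis
    by (simp add: qv)
qed

text \<open>Two tree edges with the same tail and label force equal potentials at their heads, so
  the old potential descends unchanged.\<close>

lemma assoc_aut_type1:
  assumes "s1 \<in> A"
  shows "assoc_aut n \<G>' = assoc_aut n \<G>"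
proof -
  define h where "h v = lab (tp v)" for v
  have h: "potential h"
    unfolding h_def by (rule potential_lab_tp)
  have "h (head G s1) = h (head G s2)"
    using h assms s2 tails labels unfolding potential_def by metis
  then have "B'.lab (brand_loop \<G>' j) = lab (brand_loop \<G> j)" if "j < n" for j
    using h that unfolding lab_brand_loop [OF h that]
    by (intro assoc_aut_fold_eqI) (auto simp: potential_def)
  then show ?thesis
    unfolding assoc_aut_eq B'.assoc_aut_eq by (rule free_ext_cong)
qed

text \<open>Here the potentials at the two heads differ by a factor coming from the loop
  \<open>s1\<close>. Twisting one side of \<open>s2\<close> removes the difference, after which the
  potential descends.\<close>

lemma assoc_aut_type2:
  assumes s1A: "s1 \<notin> A" and aut: "assoc_aut n \<G> \<in> carrier (aut_free n)"
  shows "assoc_aut n \<G>' \<in> carrier (aut_free n) \<and>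
    inv\<^bsub>aut_free n\<^esub> (assoc_aut n \<G>') \<otimes>\<^bsub>aut_free n\<^esub> assoc_aut n \<G> \<in> whitehead_pair_auts n"
proof -
  define u where "u = tail G s2"
  have u: "tail G s1 = u" "head G s1 = u" "u \<in> verts G"
    using s1A type tails by (auto simp: u_def)
  obtain i where i: "i < n" "s1 = brands \<G> ! i \<or> s1 = bar G (brands \<G> ! i)"
    using s1A arc_cases [of s1] by (metis s1_arc)
  define e where "e = brands \<G> ! i"
  have e: "e \<in> arcs G" "tail G e = u" "head G e = u" "s1 = e \<or> s1 = bar G e" "brands \<G> ! i = e"
    using i u by (auto simp: e_def)
  \<comment> \<open>The edge \<open>s2\<close> itself may point towards the base;
    \<open>beyond\<close> is meant for the outward orientation.\<close>
  define d where "d = (if outward s2 then s2 else bar G s2)"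
  have d: "outward d" "d = s2 \<or> d = bar G s2" "{d, bar G d} = {s2, bar G s2}"
    using outward_or [OF s2] by (auto simp: d_def)
  \<comment> \<open>The sign for which \<gamma> becomes \<kappa> when \<open>d = s2\<close> and its
    inverse when \<open>d\<close> is the inverse of \<open>s2\<close>.\<close>
  define c where "c \<longleftrightarrow> (s1 = e \<longleftrightarrow> d = s2)"
  define g where "g j = lab (brand_loop \<G> j)" for j
  define g' where "g' j = B'.lab (brand_loop \<G>' j)" for j
  define h where "h v = lab (tp v)" for v
  define \<gamma> where "\<gamma> = letter_value n g (i, c)"
  define h' where "h' v = twist n \<gamma> (v \<in> beyond d) (h v)" for v
  have g: "g j \<in> carrier (free_grp n)" if "j < n" for j
    using lab_brand_loop_in that by (simp add: g_def)
  have g': "g' j \<in> carrier (free_grp n)" if "j < n" for j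
    using B'.lab_brand_loop_in that by (simp add: g'_def)
  have \<gamma>: "\<gamma> \<in> carrier (free_grp n)"
    using g i by (simp add: \<gamma>_def letter_value_in)
  have h: "potential h"
    unfolding h_def by (rule potential_lab_tp)
  have h_in [simp]: "h v \<in> carrier (free_grp n)" if "v \<in> verts G" for v
    using h that by (simp add: potential_def)
  have h_edge: "h (head G x) = h (tail G x) \<otimes>\<^bsub>free_grp n\<^esub> [f x]" if "x \<in> A" for x
    using h that by (simp add: potential_def)
  have g_eq: "g j = h (tail G (brands \<G> ! j)) \<otimes>\<^bsub>free_grp n\<^esub> [f (brands \<G> ! j)] \<otimes>\<^bsub>free_grp n\<^esub>
      inv\<^bsub>free_grp n\<^esub> (h (head G (brands \<G> ! j)))" if "j < n" for j
    unfolding g_def using lab_brand_loop [OF h that] .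
  \<comment> \<open>The loop \<open>s1\<close> read from the base. It is \<open>g i\<close> or its
    inverse, and also the factor between the potentials at the two heads.\<close>
  define \<kappa> where "\<kappa> = h u \<otimes>\<^bsub>free_grp n\<^esub> [f s1] \<otimes>\<^bsub>free_grp n\<^esub> inv\<^bsub>free_grp n\<^esub> (h u)"
  have \<kappa>_in: "\<kappa> \<in> carrier (free_grp n)"
    using u by (simp add: \<kappa>_def)
  have head_s2: "h (head G s2) = \<kappa> \<otimes>\<^bsub>free_grp n\<^esub> h u"
    using h_edge [OF s2] u labels by (simp add: \<kappa>_def free_grp.m_assoc flip: u_def)
  have gi: "g i = (if s1 = e then \<kappa> else inv\<^bsub>free_grp n\<^esub> \<kappa>)"
    using g_eq [OF i(1)] e u
    by (auto simp: \<kappa>_def f_bar inv_letter [symmetric] free_grp.m_assoc free_grp.inv_mult_group)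
  have \<gamma>_eq: "\<gamma> = (if d = s2 then \<kappa> else inv\<^bsub>free_grp n\<^esub> \<kappa>)"
    using gi \<kappa>_in by (auto simp: \<gamma>_def letter_value_def c_def)
  have cross: "head G s2 \<in> beyond d \<longleftrightarrow> d = s2" "u \<in> beyond d \<longleftrightarrow> d \<noteq> s2"
    using head_beyond [OF d(1)] tail_notin_beyond [OF d(1)] d(2) bar_s2_neq by (auto simp: u_def)
  have "h' (head G s1) = h' (head G s2)"
    using cross head_s2 \<kappa>_in u by (auto simp: h'_def twist_def \<gamma>_eq)
  moreover have "h' (head G x) = h' (tail G x) \<otimes>\<^bsub>free_grp n\<^esub> [f x]" if "x \<in> A - {s2, bar G s2}" for x
    using that d(3) edge_beyond_iff [of x d] h_edge [of x] \<gamma> by (auto simp: h'_def twist_def free_grp.m_assoc)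
  moreover have "h' (base \<G>) = []"
    using h root_notin_beyond by (simp add: h'_def twist_def potential_def)
  ultimately have g'_eq: "g' j = h' (tail G (brands \<G> ! j)) \<otimes>\<^bsub>free_grp n\<^esub> [f (brands \<G> ! j)] \<otimes>\<^bsub>free_grp n\<^esub>
      inv\<^bsub>free_grp n\<^esub> (h' (head G (brands \<G> ! j)))" if "j < n" for j
    unfolding g'_def using that \<gamma> by (intro assoc_aut_fold_eqI) (auto simp: h'_def)
  \<comment> \<open>If \<open>u\<close> lies beyond \<open>d\<close>, twisting conjugates the value
    of the loop by \<gamma>, which is \<open>g i\<close> or its inverse and so commutes with
    it.\<close>
  have "g' i = g i"
  proof (cases "d = s2")
    case True
    then show ?thesis
      using g'_eq [OF i(1)] g_eq [OF i(1)] e cross by (simp add: h'_def twist_def)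
  next
    case False
    then have "g' i = inv\<^bsub>free_grp n\<^esub> \<gamma> \<otimes>\<^bsub>free_grp n\<^esub> g i \<otimes>\<^bsub>free_grp n\<^esub> \<gamma>"
      using g'_eq [OF i(1)] g_eq [OF i(1)] e u cross \<gamma>
      by (simp add: h'_def twist_def free_grp.m_assoc free_grp.inv_mult_group)
    also have "\<dots> = g i"
      using gi \<gamma>_eq \<kappa>_in by (auto simp: free_grp.m_assoc)
    finally show ?thesis .
  qed
  moreover have "g j = (if tail G (brands \<G> ! j) \<in> beyond d then \<gamma> else \<one>\<^bsub>free_grp n\<^esub>) \<otimes>\<^bsub>free_grp n\<^esub> g' j
      \<otimes>\<^bsub>free_grp n\<^esub> inv\<^bsub>free_grp n\<^esub> (if head G (brands \<G> ! j) \<in> beyond d then \<gamma> else \<one>\<^bsub>free_grp n\<^esub>)"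
    if "j < n" for j
    unfolding g_eq [OF that] g'_eq [OF that] h'_def
    using that \<gamma> by (simp add: twist_loop [symmetric])
  ultimately have "free_ext n g' \<in> carrier (aut_free n) \<and>
      inv\<^bsub>aut_free n\<^esub> (free_ext n g') \<otimes>\<^bsub>aut_free n\<^esub> free_ext n g \<in> whitehead_pair_auts n"
    using aut g g' i unfolding assoc_aut_eq g_def [symmetric]
    by (intro whitehead_step [where \<gamma> = \<gamma> and s = c and P = "\<lambda>j. tail G (brands \<G> ! j) \<in> beyond d"
            and Q = "\<lambda>j. head G (brands \<G> ! j) \<in> beyond d"]) (auto simp: \<gamma>_def)
  moreover have "assoc_aut n \<G> = free_ext n g" "assoc_aut n \<G>' = free_ext n g'"
    by (simp_all add: assoc_aut_eq B'.assoc_aut_eq g_def [abs_def] g'_def [abs_def])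
  ultimately show ?thesis by simp
qed

end

lemma (in pre_branded) fold_step:
  assumes s1: "s1 \<in> arcs G" and s2: "s2 \<in> A" and neq: "s1 \<noteq> s2"
    and same: "tail G s1 = tail G s2" "f s1 = f s2" and heads: "head G s1 \<noteq> head G s2"
    and not_loop: "tail G s2 \<noteq> head G s2"
    and type: "s1 \<in> A \<or> tail G s1 = head G s1"
    and aut: "assoc_aut n \<G> \<in> carrier (aut_free n)"
  obtains \<G>' :: "('v, 'e) branded" where "branded_fold \<G> \<G>'" "pre_branded n \<G>'" "assoc_aut n \<G>' \<in> carrier (aut_free n)"
    "inv\<^bsub>aut_free n\<^esub> (assoc_aut n \<G>') \<otimes>\<^bsub>aut_free n\<^esub> assoc_aut n \<G> = \<one>\<^bsub>aut_free n\<^esub> \<or>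
     inv\<^bsub>aut_free n\<^esub> (assoc_aut n \<G>') \<otimes>\<^bsub>aut_free n\<^esub> assoc_aut n \<G> \<in> whitehead_pair_auts n"
    "verts (ugraph \<G>') = verts G - {head G s2}"
proof -
  \<comment> \<open>A single edge is a reduced path, so a tree contains no loop. This turns the
    disjunction \<open>type\<close> into the equivalence of the locale.\<close>
  have "tail G s1 \<noteq> head G s1" if "s1 \<in> A"
  proof
    assume "tail G s1 = head G s1"
    then have "reduce G [s1] = []"
      using that by (intro tree_closed [of "tail G s1"]) auto
    then show False by simp
  qed
  with assms interpret fold_pair n \<G> s1 s2
    by unfold_locales auto
  show ?thesis
  proof (cases "s1 \<in> A")
    case True
    then show ?thesis
      using that [of \<G>'] branded_fold B'.pre_branded_axioms aut
      by (simp add: assoc_aut_type1 aut_free.l_inv)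
  next
    case False
    then show ?thesis
      using that [of \<G>'] branded_fold B'.pre_branded_axioms assoc_aut_type2 aut by simp
  qed
qed


section \<open>Graphs without folds\<close>

context pre_branded
begin

text \<open>With a common head, \<open>[s1, bar G s2]\<close> would be a nontrivial reduced loop
  with trivial label.\<close>

lemma heads_distinct:
  assumes inj: "pi1_inj" and s: "s1 \<in> arcs G" "s2 \<in> arcs G" "s1 \<noteq> s2" "tail G s1 = tail G s2" "f s1 = f s2"
  shows "head G s1 \<noteq> head G s2"
proof
  assume "head G s1 = head G s2"
  then have w: "walk G (arcs G) (tail G s1) [s1, bar G s2] (tail G s1)"
    using s by simp
  have "lab [s1, bar G s2] = []"
    using s lab_append [of "[s1]" "[bar G s2]"] by (simp add: f_bar inv_letter [symmetric] one_free_grp)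
  then have "reduce G [s1, bar G s2] = []"
    using inj w tail_in [OF s(1)] unfolding pi1_inj_def by blast
  moreover have "reduced G [s1, bar G s2]"
    using s by simp
  ultimately show False
    by (simp add: reduce_reduced)
qed

lemma no_fold_isomorphism:
  assumes surj: "pi1_surj"
    and no_fold: "\<And>s1 s2. s1 \<in> arcs G \<Longrightarrow> s2 \<in> arcs G \<Longrightarrow> tail G s1 = tail G s2 \<Longrightarrow> f s1 = f s2 \<Longrightarrow> s1 = s2"
  shows "graph_isomorphism G (rose n) (marking \<G>)" "verts G = {base \<G>}"
proof -
  have reduced_map: "reduced (rose n) (map f p)" if "walk G (arcs G) u p v" "reduced G p" for u p v
    using that
  proof (induction p arbitrary: u rule: induct_list012)
    case (3 e e' p)
    \<comment> \<open>Were the labels inverse, \<open>e'\<close> and \<open>bar G e\<close> would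
      start at the same vertex with the same label and hence be equal, although the path is
      reduced.\<close>
    have "f e' \<noteq> bar (rose n) (f e)"
      using 3 no_fold [of e' "bar G e"] by (auto simp: f_bar)
    with 3 show ?case by auto
  qed auto
  have loop: "\<exists>e \<in> arcs G. tail G e = v \<and> head G e = v \<and> f e = x" if v: "v \<in> verts G" and x: "x \<in> letters n" for v x
  proof -
    obtain p where p: "walk G (arcs G) v p v" "lab p = [x]"
      using surj v x letter_in_free_grp unfolding pi1_surj_def by metis
    let ?p = "reduce G p"
    have w: "walk G (arcs G) v ?p v"
      using p(1) by (rule full.walk_reduce)
    have "map f ?p = lab ?p"
      using reduced_map [OF w] by (simp add: lab_def rose.reduce_reduced)
    also have "\<dots> = [x]"
      using p walk_subset [OF p(1)] by (simp add: lab_reduce)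
    finally obtain e where "?p = [e]" "f e = x" by auto
    then show ?thesis using w by auto
  qed
  \<comment> \<open>At its tail, \<open>e\<close> competes with a loop of the same label and
    therefore equals it.\<close>
  have all_loops: "head G e = tail G e" if "e \<in> arcs G" for e
  proof -
    obtain e' where "e' \<in> arcs G" "tail G e' = tail G e" "head G e' = tail G e" "f e' = f e"
      using loop [of "tail G e" "f e"] \<open>e \<in> arcs G\<close> by auto
    then show ?thesis using no_fold that by metis
  qed
  have "u = v" if "walk G (arcs G) u p v" for u p v
    using that by (induction p arbitrary: u) (auto simp: all_loops)
  then show verts: "verts G = {base \<G>}"
    using walk_arcs [OF tp_walk] root_in by auto
  have "inj_on f (arcs G)"
  proof (rule inj_onI)
    fix s1 s2 assume s: "s1 \<in> arcs G" "s2 \<in> arcs G" "f s1 = f s2"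
    then have "tail G s1 = tail G s2"
      using tail_in [of s1] tail_in [of s2] unfolding verts by simp
    then show "s1 = s2" using s no_fold by blast
  qed
  moreover have "f ` arcs G = letters n"
    using loop [OF root_in] f_in by (metis image_eqI image_subsetI subsetI subset_antisym)
  ultimately show "graph_isomorphism G (rose n) (marking \<G>)"
    by (auto simp: graph_isomorphism_def is_graph_map_def f_bar bij_betw_def verts)
qed

text \<open>All tree paths are trivial, so the loops are the branded edges. These come from
  different pairs of inverse edges, so injectivity of the marking gives their labels different
  indices.\<close>

lemma isomorphism_signed_perm:
  assumes verts: "verts G = {base \<G>}" and iso: "graph_isomorphism G (rose n) (marking \<G>)"
    and aut: "assoc_aut n \<G> \<in> carrier (aut_free n)"
  shows "assoc_aut n \<G> \<in> signed_perm_auts n"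
proof -
  let ?x = "\<lambda>i. f (brands \<G> ! i)"
  have ends: "tail G e = base \<G>" "head G e = base \<G>" if "e \<in> arcs G" for e
    using tail_in [OF that] head_in [OF that] by (auto simp: verts)
  have gen: "assoc_aut n \<G> [(i, True)] = [?x i]" if "i < n" for i
  proof -
    have "lab (brand_loop \<G> i) = [?x i]"
      using that ends by (simp add: brand_loop_eq)
    then show ?thesis
      unfolding assoc_aut_eq by (subst free_ext_generator) (use that lab_brand_loop_in in auto)
  qed
  define \<sigma> where "\<sigma> i = (if i < n then fst (?x i) else i)" for i
  have x_in: "?x i \<in> letters n" if "i < n" for i
    using that by simp
  have \<sigma>_in: "\<sigma> i < n" if "i < n" for i
    using x_in [OF that] that by (cases "?x i") (simp add: \<sigma>_def)
  have inj: "inj_on f (arcs G)"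
    using iso by (auto simp: graph_isomorphism_def bij_betw_def)
  have "inj_on \<sigma> {..<n}"
  proof (rule inj_onI)
    fix i j assume ij: "i \<in> {..<n}" "j \<in> {..<n}" "\<sigma> i = \<sigma> j"
    then have "?x i = ?x j \<or> ?x i = bar (rose n) (?x j)"
      using x_in [of i] x_in [of j]
      by (cases "?x i"; cases "?x j") (auto simp: \<sigma>_def bar_rose)
    then have "?x i = ?x j \<or> ?x i = f (bar G (brands \<G> ! j))"
      using ij by (simp add: f_bar)
    then have "brands \<G> ! i = brands \<G> ! j \<or> brands \<G> ! i = bar G (brands \<G> ! j)"
      using inj ij brand_arc by (metis bar_in_iff inj_on_def lessThan_iff)
    then show "i = j"
      using brands_distinct ij by blast
  qed
  moreover from this have "\<sigma> ` {..<n} = {..<n}"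
    using \<sigma>_in by (intro endo_inj_surj) auto
  ultimately have "bij_betw \<sigma> {..<n} {..<n}"
    by (simp add: bij_betw_def)
  then have "\<sigma> permutes {..<n}"
    by (rule bij_imp_permutes) (simp add: \<sigma>_def)
  moreover have "\<forall>i<n. assoc_aut n \<G> [(i, True)] = [(\<sigma> i, snd (?x i))]"
    using gen by (simp add: \<sigma>_def)
  ultimately show ?thesis
    using aut by (auto simp: signed_perm_auts_def)
qed

end


section \<open>Sequences of moves\<close>

definition good :: "nat \<Rightarrow> ('v, 'e) branded \<Rightarrow> bool" where
  "good n \<G> \<longleftrightarrow> pre_branded n \<G> \<and> assoc_aut n \<G> \<in> carrier (aut_free n)"

lemma good_branded: "good n \<G> \<Longrightarrow> branded_graph n \<G>"
  unfolding good_def by (blast intro: pre_branded.branded_graph_if_aut)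

definition whitehead_move :: "nat \<Rightarrow> move \<Rightarrow> ('v, 'e) branded \<Rightarrow> ('v, 'e) branded \<Rightarrow> bool" where
  "whitehead_move n m \<G> \<G>' \<longleftrightarrow> move_step m \<G> \<G>' \<and>
     (inv\<^bsub>aut_free n\<^esub> (assoc_aut n \<G>') \<otimes>\<^bsub>aut_free n\<^esub> assoc_aut n \<G>
        \<in> insert \<one>\<^bsub>aut_free n\<^esub> (whitehead_pair_auts n))"

inductive run :: "nat \<Rightarrow> move list \<Rightarrow> ('v, 'e) branded list \<Rightarrow> bool" for n where
  run_Nil: "good n \<G> \<Longrightarrow> run n [] [\<G>]"
| run_Cons: "good n \<G> \<Longrightarrow> whitehead_move n m \<G> \<G>' \<Longrightarrow> run n ms (\<G>' # \<H>) \<Longrightarrow> run n (m # ms) (\<G> # \<G>' # \<H>)"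

lemma run_nth:
  assumes "run n ms \<H>"
  shows "length \<H> = Suc (length ms) \<and> (\<forall>j < length \<H>. good n (\<H> ! j)) \<and>
    (\<forall>j < length ms. whitehead_move n (ms ! j) (\<H> ! j) (\<H> ! Suc j))"
  using assms
proof induction
  case (run_Cons \<G> m \<G>' ms \<H>)
  then show ?case by (simp add: All_less_Suc2)
qed simp

text \<open>Blocks of at most two swaps closed by a fold. The form encodes the number of folds, the
  bound on preceding swaps and the absence of swaps at the end all at once.\<close>

inductive fold_blocks :: "nat \<Rightarrow> move list \<Rightarrow> bool" where
  "fold_blocks 0 []"
| "k \<le> 2 \<Longrightarrow> fold_blocks m ms \<Longrightarrow> fold_blocks (Suc m) (replicate k Swap @ Fold # ms)"

lemma count_list_fold_blocks: "fold_blocks m ms \<Longrightarrow> count_list ms Fold = m"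
proof (induction rule: fold_blocks.induct)
  case (2 k m ms)
  have "count_list (replicate k Swap) Fold = 0"
    by (induction k) auto
  with 2 show ?case by simp
qed simp

lemma preceding_swaps_fold_blocks:
  "fold_blocks m ms \<Longrightarrow> j \<le> length ms \<Longrightarrow> preceding_swaps ms j \<le> 2"
proof (induction arbitrary: j rule: fold_blocks.induct)
  case (2 k m ms)
  show ?case
  proof (cases "j \<le> k")
    case True
    then show ?thesis
      using 2(1) by (simp add: preceding_swaps_def le_trans [OF length_takeWhile_le])
  next
    case False
    \<comment> \<open>Position \<open>j\<close> lies behind the first fold, which stops the backward
      count; what remains is position \<open>i\<close> of the later blocks.\<close>
    then obtain i where i: "j = Suc (k + i)"
      by (metis add_Suc_right less_imp_Suc_add not_le)
    then have "takeWhile (\<lambda>m. m = Swap) (rev (take i ms) @ Fold # replicate k Swap)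
        = takeWhile (\<lambda>m. m = Swap) (rev (take i ms))"
      by (auto simp: takeWhile_append intro!: takeWhile_eq_all_conv [THEN iffD2, symmetric])
    then have "preceding_swaps (replicate k Swap @ Fold # ms) j = preceding_swaps ms i"
      using i by (simp add: preceding_swaps_def)
    with 2 i show ?thesis by simp
  qed
qed (simp add: preceding_swaps_def)

lemma last_fold_blocks: "fold_blocks m ms \<Longrightarrow> ms = [] \<or> last ms = Fold"
  by (induction rule: fold_blocks.induct) auto

text \<open>No swap is made if \<open>s\<close> is in the tree already. The last conclusion prepends
  the swap, if any, to an arbitrary run from the new graph, so both cases look alike to the
  caller.\<close>

lemma ensure_in_tree:
  fixes \<G> :: "('v, 'e) branded"
  assumes good: "good n \<G>" and s: "s \<in> arcs (ugraph \<G>)" "tail (ugraph \<G>) s \<noteq> head (ugraph \<G>) s"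
    and t: "head (ugraph \<G>) s \<noteq> tail (ugraph \<G>) t" "head (ugraph \<G>) s \<noteq> head (ugraph \<G>) t" "t \<in> arcs (ugraph \<G>)"
  obtains k and \<G>' :: "('v, 'e) branded" where "k \<le> 1" "good n \<G>'" "ugraph \<G>' = ugraph \<G>" "marking \<G>' = marking \<G>"
    "s \<in> tree_arcs \<G>'" "t \<in> tree_arcs \<G> \<Longrightarrow> t \<in> tree_arcs \<G>'"
    "\<And>ms \<H>. run n ms (\<G>' # \<H>) \<Longrightarrow>
       \<exists>\<H>'. run n (replicate k Swap @ ms) (\<G> # \<H>') \<and> last (\<G> # \<H>') = last (\<G>' # \<H>)"
proof (cases "s \<in> tree_arcs \<G>")
  case True
  show ?thesis
    by (rule that [of 0 \<G>]) (use good True in auto)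
next
  case False
  interpret pre_branded n \<G>
    using good by (simp add: good_def)
  have aut: "assoc_aut n \<G> \<in> carrier (aut_free n)"
    using good by (simp add: good_def)
  obtain \<G>' where \<G>': "edge_swap \<G> \<G>'" "pre_branded n \<G>'" "assoc_aut n \<G>' \<in> carrier (aut_free n)"
    "inv\<^bsub>aut_free n\<^esub> (assoc_aut n \<G>') \<otimes>\<^bsub>aut_free n\<^esub> assoc_aut n \<G> \<in> whitehead_pair_auts n"
    "ugraph \<G>' = G" "marking \<G>' = marking \<G>" "s \<in> tree_arcs \<G>'" "t \<in> A \<Longrightarrow> t \<in> tree_arcs \<G>'"
    using swap_into_tree [OF s(1) False s(2) t aut] by blast
  show ?thesis
  proof (rule that [of 1 \<G>'])
    fix ms \<H> assume "run n ms (\<G>' # \<H>)"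
    then have "run n (Swap # ms) (\<G> # \<G>' # \<H>)"
      using \<G>' good by (intro run_Cons) (simp_all add: whitehead_move_def)
    then show "\<exists>\<H>'. run n (replicate 1 Swap @ ms) (\<G> # \<H>') \<and> last (\<G> # \<H>') = last (\<G>' # \<H>)"
      by (intro exI [of _ "\<G>' # \<H>"]) simp
  qed (use \<G>' in \<open>simp_all add: good_def\<close>)
qed

text \<open>At most one swap for \<open>s2\<close>, then at most one for \<open>s1\<close>. The
  second does not expel \<open>s2\<close>: unless \<open>s1\<close> is a loop, its head differs from
  the common tail, and it differs from the head of \<open>s2\<close> by hypothesis.\<close>

lemma good_fold:
  fixes \<G> :: "('v, 'e) branded"
  assumes good: "good n \<G>"
    and s: "s1 \<in> arcs (ugraph \<G>)" "s2 \<in> arcs (ugraph \<G>)" "s1 \<noteq> s2" "tail (ugraph \<G>) s1 = tail (ugraph \<G>) s2"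
      "emap (marking \<G>) s1 = emap (marking \<G>) s2" "head (ugraph \<G>) s1 \<noteq> head (ugraph \<G>) s2"
    and not_loop: "tail (ugraph \<G>) s2 \<noteq> head (ugraph \<G>) s2"
  obtains k and \<G>' :: "('v, 'e) branded" and v where "k \<le> 2" "good n \<G>'" "v \<in> verts (ugraph \<G>)"
    "verts (ugraph \<G>') = verts (ugraph \<G>) - {v}"
    "\<And>ms \<H>. run n ms (\<G>' # \<H>) \<Longrightarrow>
       \<exists>\<H>'. run n (replicate k Swap @ Fold # ms) (\<G> # \<H>') \<and> last (\<G> # \<H>') = last (\<G>' # \<H>)"
proof -
  let ?G = "ugraph \<G>"
  obtain k1 and \<G>1 :: "('v, 'e) branded" where \<G>1: "k1 \<le> 1" "good n \<G>1" "ugraph \<G>1 = ?G" "marking \<G>1 = marking \<G>"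
    "s2 \<in> tree_arcs \<G>1"
    "\<And>ms \<H>. run n ms (\<G>1 # \<H>) \<Longrightarrow>
       \<exists>\<H>'. run n (replicate k1 Swap @ ms) (\<G> # \<H>') \<and> last (\<G> # \<H>') = last (\<G>1 # \<H>)"
    using ensure_in_tree [OF good s(2) not_loop, of s1] s not_loop by metis
  have "\<exists>k2 (\<G>2 :: ('v, 'e) branded). k2 \<le> 1 \<and> good n \<G>2 \<and> ugraph \<G>2 = ?G \<and> marking \<G>2 = marking \<G> \<and>
    s2 \<in> tree_arcs \<G>2 \<and> (s1 \<in> tree_arcs \<G>2 \<or> tail ?G s1 = head ?G s1) \<and>
    (\<forall>ms \<H>. run n ms (\<G>2 # \<H>) \<longrightarrow>
       (\<exists>\<H>'. run n (replicate k2 Swap @ ms) (\<G>1 # \<H>') \<and> last (\<G>1 # \<H>') = last (\<G>2 # \<H>)))"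
  proof (cases "tail ?G s1 = head ?G s1")
    case True
    then show ?thesis
      using \<G>1 by (intro exI [of _ 0] exI [of _ \<G>1]) auto
  next
    case False
    obtain k2 and \<G>2 :: "('v, 'e) branded" where "k2 \<le> 1" "good n \<G>2" "ugraph \<G>2 = ?G" "marking \<G>2 = marking \<G>"
      "s1 \<in> tree_arcs \<G>2" "s2 \<in> tree_arcs \<G>2"
      "\<And>ms \<H>. run n ms (\<G>2 # \<H>) \<Longrightarrow>
         \<exists>\<H>'. run n (replicate k2 Swap @ ms) (\<G>1 # \<H>') \<and> last (\<G>1 # \<H>') = last (\<G>2 # \<H>)"
      using ensure_in_tree [OF \<G>1(2), of s1 s2] False s \<G>1 by metis
    then show ?thesis by blast
  qed
  then obtain k2 and \<G>2 :: "('v, 'e) branded" where \<G>2: "k2 \<le> 1" "good n \<G>2" "ugraph \<G>2 = ?G" "marking \<G>2 = marking \<G>"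
    "s2 \<in> tree_arcs \<G>2" "s1 \<in> tree_arcs \<G>2 \<or> tail ?G s1 = head ?G s1"
    "\<And>ms \<H>. run n ms (\<G>2 # \<H>) \<Longrightarrow>
         \<exists>\<H>'. run n (replicate k2 Swap @ ms) (\<G>1 # \<H>') \<and> last (\<G>1 # \<H>') = last (\<G>2 # \<H>)"
    by blast
  interpret G2: pre_branded n \<G>2
    using \<G>2(2) by (simp add: good_def)
  have aut: "assoc_aut n \<G>2 \<in> carrier (aut_free n)"
    using \<G>2(2) by (simp add: good_def)
  obtain \<G>' :: "('v, 'e) branded" where \<G>': "branded_fold \<G>2 \<G>'" "pre_branded n \<G>'" "assoc_aut n \<G>' \<in> carrier (aut_free n)"
    "inv\<^bsub>aut_free n\<^esub> (assoc_aut n \<G>') \<otimes>\<^bsub>aut_free n\<^esub> assoc_aut n \<G>2 = \<one>\<^bsub>aut_free n\<^esub> \<or>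
     inv\<^bsub>aut_free n\<^esub> (assoc_aut n \<G>') \<otimes>\<^bsub>aut_free n\<^esub> assoc_aut n \<G>2 \<in> whitehead_pair_auts n"
    "verts (ugraph \<G>') = verts ?G - {head ?G s2}"
    using G2.fold_step [of s1 s2] s not_loop \<G>2(3-6) aut by metis
  show ?thesis
  proof (rule that [of "k1 + k2" \<G>' "head ?G s2"])
    fix ms \<H> assume "run n ms (\<G>' # \<H>)"
    then have "run n (Fold # ms) (\<G>2 # \<G>' # \<H>)"
      using \<G>2(2) \<G>' by (intro run_Cons) (auto simp: whitehead_move_def)
    from \<G>2(7) [OF this] obtain \<H>2 where
      "run n (replicate k2 Swap @ Fold # ms) (\<G>1 # \<H>2)" "last (\<G>1 # \<H>2) = last (\<G>' # \<H>)"
      by auto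
    with \<G>1(6) [OF this(1)] show
      "\<exists>\<H>'. run n (replicate (k1 + k2) Swap @ Fold # ms) (\<G> # \<H>') \<and> last (\<G> # \<H>') = last (\<G>' # \<H>)"
      by (auto simp: replicate_add)
  next
    show "head ?G s2 \<in> verts ?G"
      using G2.head_in [of s2] s \<G>2 by simp
  qed (use \<G>1(1) \<G>2(1) \<G>' in \<open>auto simp: good_def\<close>)
qed

theorem run_to_rose:
  fixes \<G> :: "('v, 'e) branded"
  assumes "good n \<G>" "card (verts (ugraph \<G>)) = Suc m"
  shows "\<exists>ms \<H>. run n ms (\<G> # \<H>) \<and> fold_blocks m ms \<and>
    graph_isomorphism (ugraph (last (\<G> # \<H>))) (rose n) (marking (last (\<G> # \<H>))) \<and>
    assoc_aut n (last (\<G> # \<H>)) \<in> signed_perm_auts n"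
  using assms
proof (induction m arbitrary: \<G>)
  case (0 \<G>)
  then interpret pre_branded n \<G> by (simp add: good_def)
  have inj: "pi1_inj" "pi1_surj"
    using good_branded [OF 0(1)] by (auto simp: branded_graph_iff)
  obtain v where v: "verts G = {v}"
    using 0(2) by (metis One_nat_def card_1_singletonE)
  \<comment> \<open>With a single vertex all heads coincide, so \<open>heads_distinct\<close> rules
    out any pair to fold.\<close>
  have "s1 = s2" if "s1 \<in> arcs G" "s2 \<in> arcs G" "tail G s1 = tail G s2" "f s1 = f s2" for s1 s2
    using heads_distinct [OF inj(1) that(1,2) _ that(3,4)] head_in [OF that(1)] head_in [OF that(2)]
    unfolding v by (cases "s1 = s2") simp_all
  note iso = no_fold_isomorphism [OF inj(2) this]
  have aut: "assoc_aut n \<G> \<in> carrier (aut_free n)"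
    using 0(1) unfolding good_def by blast
  have "assoc_aut n \<G> \<in> signed_perm_auts n"
    by (rule isomorphism_signed_perm [OF iso(2,1) aut])
  with iso(1) have "run n [] [\<G>] \<and> fold_blocks 0 [] \<and>
    graph_isomorphism (ugraph (last [\<G>])) (rose n) (marking (last [\<G>])) \<and>
    assoc_aut n (last [\<G>]) \<in> signed_perm_auts n"
    unfolding last_ConsL [OF refl] by (intro conjI run_Nil [OF 0(1)] fold_blocks.intros(1))
  then show ?case by blast
next
  case (Suc m \<G>)
  then interpret pre_branded n \<G> by (simp add: good_def)
  have inj: "pi1_inj" "pi1_surj"
    using good_branded [OF Suc(2)] by (auto simp: branded_graph_iff)
  have "\<not> verts G = {base \<G>}"
    using Suc(3) by auto
  then obtain s1 s2 where s: "s1 \<in> arcs G" "s2 \<in> arcs G" "s1 \<noteq> s2" "tail G s1 = tail G s2" "f s1 = f s2"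
    using no_fold_isomorphism(2) [OF inj(2)] by metis
  note heads = heads_distinct [OF inj(1) s]
  \<comment> \<open>The tails agree and the heads do not, so at most one of the two edges is a loop;
    the names are chosen such that \<open>t2\<close> is not.\<close>
  obtain t1 t2 where t: "t1 \<in> arcs G" "t2 \<in> arcs G" "t1 \<noteq> t2" "tail G t1 = tail G t2" "f t1 = f t2"
    "head G t1 \<noteq> head G t2" "tail G t2 \<noteq> head G t2"
    using s heads by (cases "tail G s2 = head G s2") metis+
  obtain k and \<G>' :: "('v, 'e) branded" and v where \<G>': "k \<le> 2" "good n \<G>'" "v \<in> verts G"
    "verts (ugraph \<G>') = verts G - {v}"
    "\<And>ms \<H>. run n ms (\<G>' # \<H>) \<Longrightarrow>
       \<exists>\<H>'. run n (replicate k Swap @ Fold # ms) (\<G> # \<H>') \<and> last (\<G> # \<H>') = last (\<G>' # \<H>)"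
  proof (rule good_fold [OF Suc(2) t], goal_cases)
    case (1 k \<G>' v)
    from 1(2-6) show ?thesis by (rule 1(1))
  qed
  have "card (verts (ugraph \<G>')) = Suc m"
    using \<G>'(3,4) Suc(3) by (simp add: card_Diff_singleton)
  from Suc.IH [OF \<G>'(2) this] obtain ms \<H> where IH: "run n ms (\<G>' # \<H>)" "fold_blocks m ms"
    "graph_isomorphism (ugraph (last (\<G>' # \<H>))) (rose n) (marking (last (\<G>' # \<H>)))"
    "assoc_aut n (last (\<G>' # \<H>)) \<in> signed_perm_auts n"
    by blast
  from \<G>'(5) [OF IH(1)] obtain \<H>' where
    "run n (replicate k Swap @ Fold # ms) (\<G> # \<H>')" "last (\<G> # \<H>') = last (\<G>' # \<H>)" by blast
  with IH \<G>'(1) show ?case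
    by (metis fold_blocks.intros(2))
qed


section \<open>The subdivided rose\<close>

text \<open>The subdivided rose for arbitrary words, so that its tree and its loops can be treated
  before the words are images under an automorphism.\<close>

definition sr_branded ::
  "nat \<Rightarrow> (nat \<Rightarrow> letter list) \<Rightarrow> (nat \<Rightarrow> nat) \<Rightarrow> (sr_vertex, sr_edge) branded" where
  "sr_branded n w c = \<lparr>ugraph = sr_graph n w, marking = sr_marking n w, base = Centre,
     brands = map (\<lambda>i. ((i, c i), True)) [0..<n]\<rparr>"

context
  fixes n :: nat and w :: "nat \<Rightarrow> letter list" and c :: "nat \<Rightarrow> nat"
  assumes w: "\<And>i. i < n \<Longrightarrow> w i \<in> carrier (free_grp n)"
    and c: "\<And>i. i < n \<Longrightarrow> c i < length (w i)"
begin

lemma sr_graph_simps: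
  "verts (sr_graph n w) = insert Centre {Inner i j | i j. i < n \<and> 0 < j \<and> j < length (w i)}"
  "((i, j), s) \<in> arcs (sr_graph n w) \<longleftrightarrow> i < n \<and> j < length (w i)"
  "tail (sr_graph n w) ((i, j), s) = sr_point w i (if s then j else Suc j)"
  "head (sr_graph n w) ((i, j), s) = sr_point w i (if s then Suc j else j)"
  "bar (sr_graph n w) ((i, j), s) = ((i, j), if i < n \<and> j < length (w i) then \<not> s else s)"
  by (auto simp: sr_graph_def Let_def perm_restrict_def)

lemma sr_point_in: "i < n \<Longrightarrow> j \<le> length (w i) \<Longrightarrow> sr_point w i j \<in> verts (sr_graph n w)"
  by (auto simp: sr_graph_simps sr_point_def)

lemma emap_sr_marking:
  "emap (sr_marking n w) ((i, j), s) = (if s then w i ! j else bar (rose n) (w i ! j))"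
  by (simp add: sr_marking_def)

lemma w_letter: "i < n \<Longrightarrow> j < length (w i) \<Longrightarrow> w i ! j \<in> letters n"
  using w [of i] nth_mem [of j "w i"] unfolding carrier_free_grp by blast

lemma sr_labelled: "labelled_graph (sr_graph n w) n (emap (sr_marking n w))"
proof unfold_locales
  fix e :: sr_edge
  obtain i j s where e: "e = ((i, j), s)" by (metis prod.exhaust)
  show "bar (sr_graph n w) (bar (sr_graph n w) e) = e"
    by (simp add: e sr_graph_simps)
  show "e \<notin> arcs (sr_graph n w) \<Longrightarrow> bar (sr_graph n w) e = e"
    by (auto simp: e sr_graph_simps)
  assume "e \<in> arcs (sr_graph n w)"
  then have ij: "i < n" "j < length (w i)" by (auto simp: e sr_graph_simps)
  then show "tail (sr_graph n w) e \<in> verts (sr_graph n w)" "head (sr_graph n w) e \<in> verts (sr_graph n w)"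
    using sr_point_in [of i j] sr_point_in [of i "Suc j"] by (auto simp: e sr_graph_simps(3,4))
  show "bar (sr_graph n w) e \<noteq> e" "tail (sr_graph n w) (bar (sr_graph n w) e) = head (sr_graph n w) e"
    using ij by (simp_all add: e sr_graph_simps(3-5))
  show "emap (sr_marking n w) e \<in> letters n"
    "emap (sr_marking n w) (bar (sr_graph n w) e) = bar (rose n) (emap (sr_marking n w) e)"
    using ij w_letter [OF ij] rose.bar_in_iff [of n "w i ! j"]
    by (simp_all add: e sr_graph_simps(5) emap_sr_marking)
qed

interpretation sr: labelled_graph "sr_graph n w" n "emap (sr_marking n w)"
  by (rule sr_labelled)

lemma sr_branded_simps [simp]:
  "ugraph (sr_branded n w c) = sr_graph n w" "marking (sr_branded n w c) = sr_marking n w" "base (sr_branded n w c) = Centre"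
  "length (brands (sr_branded n w c)) = n" "i < n \<Longrightarrow> brands (sr_branded n w c) ! i = ((i, c i), True)"
  by (simp_all add: sr_branded_def)

lemma tree_arcs_sr: "((i, j), s) \<in> tree_arcs (sr_branded n w c) \<longleftrightarrow> i < n \<and> j < length (w i) \<and> j \<noteq> c i"
  using c by (auto simp: tree_arcs_def sr_branded_def sr_graph_simps image_iff)

lemma sr_subgraph: "bar_subgraph (sr_graph n w) (tree_arcs (sr_branded n w c))"
proof unfold_locales
  show "tree_arcs (sr_branded n w c) \<subseteq> arcs (sr_graph n w)"
    by (auto simp: tree_arcs_def)
  show "bar (sr_graph n w) e \<in> tree_arcs (sr_branded n w c)" if "e \<in> tree_arcs (sr_branded n w c)" for e
    using that by (cases e; cases "fst e") (auto simp: tree_arcs_sr sr_graph_simps)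
qed

interpretation srT: bar_subgraph "sr_graph n w" "tree_arcs (sr_branded n w c)"
  by (rule sr_subgraph)

text \<open>From the centre to position \<open>j\<close> of the loop with index \<open>i\<close>, avoiding the branded edge in
  position \<open>c i\<close>.\<close>

definition sr_path :: "nat \<Rightarrow> nat \<Rightarrow> sr_edge list" where
  "sr_path i j = (if j \<le> c i then map (\<lambda>k. ((i, k), True)) [0..<j]
                  else map (\<lambda>k. ((i, k), False)) (rev [j..<length (w i)]))"

text \<open>The label of \<open>sr_path i j\<close>: a prefix of the word in front of the branded
  edge, an inverted suffix behind it.\<close>

definition sr_pot :: "nat \<Rightarrow> nat \<Rightarrow> letter list" where
  "sr_pot i j = (if j \<le> c i then take j (w i) else inv\<^bsub>free_grp n\<^esub> (drop j (w i)))"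

definition at_vertex :: "(nat \<Rightarrow> nat \<Rightarrow> 'x list) \<Rightarrow> sr_vertex \<Rightarrow> 'x list" where
  "at_vertex F v = (case v of Centre \<Rightarrow> [] | Inner i j \<Rightarrow> F i j)"

text \<open>Positions 0 and \<open>length (w i)\<close> are both the centre. As \<open>c i\<close>
  is smaller than the length, the first falls into the prefix case and the second into the suffix
  case, and both values are empty.\<close>

lemma at_vertex_point:
  assumes "i < n" "j \<le> length (w i)"
  shows "at_vertex sr_path (sr_point w i j) = sr_path i j" "at_vertex sr_pot (sr_point w i j) = sr_pot i j"
  using c [OF assms(1)] by (auto simp: at_vertex_def sr_point_def sr_path_def sr_pot_def)

lemma sr_walk:
  assumes i: "i < n" and j: "j \<le> length (w i)"
  shows "walk (sr_graph n w) (tree_arcs (sr_branded n w c)) Centre (sr_path i j) (sr_point w i j)"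
proof (cases "j \<le> c i")
  case True
  then have "walk (sr_graph n w) (tree_arcs (sr_branded n w c)) Centre (map (\<lambda>k. ((i, k), True)) [0..<j]) (sr_point w i j)"
    using c [OF i] i
    by (induction j) (auto simp: walk_append tree_arcs_sr sr_graph_simps(3,4), simp add: sr_point_def)
  with True show ?thesis by (simp add: sr_path_def)
next
  case False
  have "walk (sr_graph n w) (tree_arcs (sr_branded n w c)) Centre (map (\<lambda>k. ((i, k), False)) (rev [j..<length (w i)])) (sr_point w i j)"
    using j False
  proof (induction rule: inc_induct)
    case base
    then show ?case by (simp add: sr_point_def)
  next
    case (step k)
    then have "rev [k..<length (w i)] = rev [Suc k..<length (w i)] @ [k]"
      by (simp add: upt_rec [of k])
    with step i show ?case
      by (simp add: walk_append tree_arcs_sr sr_graph_simps(3,4))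
  qed
  with False show ?thesis by (simp add: sr_path_def)
qed

lemma sr_pot_in: "i < n \<Longrightarrow> sr_pot i j \<in> carrier (free_grp n)"
proof -
  assume i: "i < n"
  have "take j (w i) @ drop j (w i) \<in> carrier (free_grp n)"
    using w [OF i] by simp
  then have "take j (w i) \<in> carrier (free_grp n)" "drop j (w i) \<in> carrier (free_grp n)"
    unfolding carrier_free_grp by (auto simp: rose.reduced_append_iff simp del: append_take_drop_id
        dest: in_set_takeD in_set_dropD)
  then show ?thesis by (simp add: sr_pot_def)
qed

lemma mult_eq_append:
  "p @ q \<in> carrier (free_grp n) \<Longrightarrow> p \<otimes>\<^bsub>free_grp n\<^esub> q = p @ q"
  by (simp add: mult_free_grp carrier_free_grp rose.reduce_reduced)

lemma w_parts:
  assumes i: "i < n" and j: "j < length (w i)"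
  shows "take j (w i) \<otimes>\<^bsub>free_grp n\<^esub> [w i ! j] = take (Suc j) (w i)"
    "[w i ! j] \<otimes>\<^bsub>free_grp n\<^esub> drop (Suc j) (w i) = drop j (w i)"
    "take j (w i) \<in> carrier (free_grp n)" "drop j (w i) \<in> carrier (free_grp n)"
proof -
  have part: "p \<in> carrier (free_grp n)" if "u @ p @ v = w i" for p u v
    using w [OF i] unfolding that [symmetric] carrier_free_grp by (auto simp: rose.reduced_append_iff)
  show t: "take k (w i) \<in> carrier (free_grp n)" and d: "drop k (w i) \<in> carrier (free_grp n)" for k
    using part [of "[]" "take k (w i)" "drop k (w i)"] part [of "take k (w i)" "drop k (w i)" "[]"] by auto
  show "take j (w i) \<otimes>\<^bsub>free_grp n\<^esub> [w i ! j] = take (Suc j) (w i)"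
    using t [of "Suc j"] j by (simp add: take_Suc_conv_app_nth mult_eq_append)
  show "[w i ! j] \<otimes>\<^bsub>free_grp n\<^esub> drop (Suc j) (w i) = drop j (w i)"
    using d [of j] j by (simp add: Cons_nth_drop_Suc [symmetric] mult_eq_append)
qed

lemma sr_rooted_tree: "rooted_tree (sr_graph n w) (tree_arcs (sr_branded n w c)) Centre"
proof (rule srT.rooted_treeI [where P = "at_vertex sr_path"])
  show "Centre \<in> verts (sr_graph n w)" by (simp add: sr_graph_simps)
  fix v assume "v \<in> verts (sr_graph n w)"
  then consider "v = Centre" | i j where "v = Inner i j" "i < n" "0 < j" "j < length (w i)"
    by (auto simp: sr_graph_simps)
  then show "walk (sr_graph n w) (tree_arcs (sr_branded n w c)) Centre (at_vertex sr_path v) v"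
  proof cases
    case (2 i j)
    then show ?thesis using sr_walk [of i j] by (simp add: at_vertex_def sr_point_def)
  qed (simp add: at_vertex_def)
next
  fix e assume e: "e \<in> tree_arcs (sr_branded n w c)"
  obtain i j s where ijs: "e = ((i, j), s)" by (metis prod.exhaust)
  with e have ij: "i < n" "j < length (w i)" "j \<noteq> c i" by (auto simp: tree_arcs_sr)
  let ?e = "((i, j), True)"
  have step: "reduce (sr_graph n w) (sr_path i j @ [?e]) = reduce (sr_graph n w) (sr_path i (Suc j))"
  proof (cases "j < c i")
    case True
    then show ?thesis by (simp add: sr_path_def)
  next
    \<comment> \<open>Behind the branded edge the paths run backwards from the end of the loop, so
      the edge cancels the last step of the path to its tail.\<close>
    case False
    with ij have "sr_path i j = sr_path i (Suc j) @ [bar (sr_graph n w) ?e]"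
      by (simp add: sr_path_def sr_graph_simps(5) upt_rec [of j])
    then show ?thesis
      using sr.reduce_append_cong [of "sr_path i (Suc j)" "sr_path i (Suc j)" "[bar (sr_graph n w) ?e, ?e]" "[]"]
      by simp
  qed
  have bar: "bar (sr_graph n w) ((i, j), False) = ?e"
    using ij by (simp add: sr_graph_simps(5))
  show "reduce (sr_graph n w) (at_vertex sr_path (tail (sr_graph n w) e) @ [e]) =
          reduce (sr_graph n w) (at_vertex sr_path (head (sr_graph n w) e)) \<or>
        reduce (sr_graph n w) (at_vertex sr_path (head (sr_graph n w) e) @ [bar (sr_graph n w) e]) =
          reduce (sr_graph n w) (at_vertex sr_path (tail (sr_graph n w) e))"
    using step ij at_vertex_point [of i j] at_vertex_point [of i "Suc j"]
    by (cases s) (simp_all add: ijs sr_graph_simps(3,4) bar)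
qed

lemma sr_pre_branded: "pre_branded n (sr_branded n w c)"
proof (intro pre_branded.intro labelled_tree.intro pre_branded_axioms.intro)
  show "rooted_tree (ugraph (sr_branded n w c)) (tree_arcs (sr_branded n w c)) (base (sr_branded n w c))"
    using sr_rooted_tree by simp
  show "labelled_graph (ugraph (sr_branded n w c)) n (emap (marking (sr_branded n w c)))"
    using sr_labelled by simp
  show "set (brands (sr_branded n w c)) \<subseteq> arcs (ugraph (sr_branded n w c))"
    using c by (auto simp: sr_branded_def sr_graph_simps)
qed (auto simp: sr_graph_simps)

interpretation srB: pre_branded n "sr_branded n w c"
  by (rule sr_pre_branded)

lemma sr_potential: "srB.potential (at_vertex sr_pot)"
  unfolding srB.potential_def
proof (intro conjI ballI)
  show "at_vertex sr_pot v \<in> carrier (free_grp n)" if "v \<in> verts (ugraph (sr_branded n w c))" for v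
    using that sr_pot_in by (auto simp: sr_graph_simps at_vertex_def)
  show "at_vertex sr_pot (base (sr_branded n w c)) = []"
    by (simp add: at_vertex_def)
  fix e assume e: "e \<in> tree_arcs (sr_branded n w c)"
  obtain i j s where ijs: "e = ((i, j), s)" by (metis prod.exhaust)
  with e have ij: "i < n" "j < length (w i)" "j \<noteq> c i" by (auto simp: tree_arcs_sr)
  have step: "sr_pot i (Suc j) = sr_pot i j \<otimes>\<^bsub>free_grp n\<^esub> [w i ! j]"
  proof (cases "j < c i")
    case True
    then show ?thesis using ij w_parts by (simp add: sr_pot_def)
  next
    case False
    have "[w i ! j] \<in> carrier (free_grp n)" "drop (Suc j) (w i) \<in> carrier (free_grp n)"
      using w_letter ij w_parts(4) [OF ij(1)] by (cases "Suc j < length (w i)"; simp)+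
    with False show ?thesis
      using ij w_parts(2) [OF ij(1,2), symmetric] by (simp add: sr_pot_def free_grp.inv_mult_group free_grp.m_assoc)
  qed
  have "sr_pot i j = sr_pot i (Suc j) \<otimes>\<^bsub>free_grp n\<^esub> [bar (rose n) (w i ! j)]"
    using step sr_pot_in ij w_letter by (simp add: inv_letter [symmetric] free_grp.m_assoc)
  with step show "at_vertex sr_pot (head (ugraph (sr_branded n w c)) e) =
      at_vertex sr_pot (tail (ugraph (sr_branded n w c)) e) \<otimes>\<^bsub>free_grp n\<^esub> [emap (marking (sr_branded n w c)) e]"
    using ij at_vertex_point [of i j] at_vertex_point [of i "Suc j"]
    by (cases s) (simp_all add: ijs sr_graph_simps(3,4) emap_sr_marking)
qed

text \<open>The ends of the branded edge contribute the prefix before it and, after inversion, the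
  suffix after it; together with its own letter they spell \<open>w i\<close>.\<close>

lemma sr_brand_loop: "i < n \<Longrightarrow> srB.lab (brand_loop (sr_branded n w c) i) = w i"
proof -
  assume i: "i < n"
  note ci = c [OF i]
  have "srB.lab (brand_loop (sr_branded n w c) i) = sr_pot i (c i) \<otimes>\<^bsub>free_grp n\<^esub> [w i ! c i] \<otimes>\<^bsub>free_grp n\<^esub>
      inv\<^bsub>free_grp n\<^esub> (sr_pot i (Suc (c i)))"
    unfolding srB.lab_brand_loop [OF sr_potential i]
    using i ci at_vertex_point [of i "c i"] at_vertex_point [of i "Suc (c i)"]
    by (simp add: sr_graph_simps(3,4) emap_sr_marking)
  also have "inv\<^bsub>free_grp n\<^esub> (sr_pot i (Suc (c i))) = drop (Suc (c i)) (w i)"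
    using w_parts(4) [OF i, of "Suc (c i)"] by (cases "Suc (c i) < length (w i)") (simp_all add: sr_pot_def)
  also have "sr_pot i (c i) \<otimes>\<^bsub>free_grp n\<^esub> [w i ! c i] = take (Suc (c i)) (w i)"
    using w_parts(1) [OF i ci] by (simp add: sr_pot_def)
  also have "take (Suc (c i)) (w i) \<otimes>\<^bsub>free_grp n\<^esub> drop (Suc (c i)) (w i) = w i"
    using w [OF i] by (simp add: mult_eq_append)
  finally show ?thesis .
qed

lemma sr_assoc_aut: "assoc_aut n (sr_branded n w c) = free_ext n w"
  unfolding srB.assoc_aut_eq by (rule free_ext_cong) (rule sr_brand_loop)

lemma card_sr_verts: "card (verts (sr_graph n w)) = Suc (\<Sum>i<n. length (w i) - 1)"
proof -
  let ?S = "SIGMA i:{..<n}. {0<..<length (w i)}"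
  have eq: "{Inner i j | i j. i < n \<and> 0 < j \<and> j < length (w i)} = (\<lambda>(i, j). Inner i j) ` ?S"
    by auto
  have "card ((\<lambda>(i, j). Inner i j) ` ?S) = card ?S"
    by (rule card_image) (auto simp: inj_on_def)
  also have "\<dots> = (\<Sum>i<n. length (w i) - 1)"
    by simp
  finally show ?thesis
    unfolding sr_graph_simps(1) eq by (subst card_insert_disjoint) auto
qed

end


section \<open>The decomposition\<close>

lemma telescoping_product:
  assumes "\<And>j. 1 \<le> j \<Longrightarrow> j \<le> k \<Longrightarrow> \<Phi> j \<in> carrier (aut_free n)" "1 \<le> k"
  shows "foldr (\<lambda>\<alpha> \<beta>. \<alpha> \<otimes>\<^bsub>aut_free n\<^esub> \<beta>)
      (\<Phi> k # map (\<lambda>j. inv\<^bsub>aut_free n\<^esub> (\<Phi> (Suc j)) \<otimes>\<^bsub>aut_free n\<^esub> \<Phi> j) (rev [1..<k])) \<one>\<^bsub>aut_free n\<^esub> = \<Phi> 1"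
  using assms(2,1)
proof (induction k rule: dec_induct)
  case base
  then show ?case by simp
next
  case (step k)
  let ?\<Psi> = "\<lambda>j. inv\<^bsub>aut_free n\<^esub> (\<Phi> (Suc j)) \<otimes>\<^bsub>aut_free n\<^esub> \<Phi> j"
  define X where "X = foldr (\<lambda>\<alpha> \<beta>. \<alpha> \<otimes>\<^bsub>aut_free n\<^esub> \<beta>) (map ?\<Psi> (rev [1..<k])) \<one>\<^bsub>aut_free n\<^esub>"
  have "foldr (\<lambda>\<alpha> \<beta>. \<alpha> \<otimes>\<^bsub>aut_free n\<^esub> \<beta>) \<alpha>s \<one>\<^bsub>aut_free n\<^esub> \<in> carrier (aut_free n)"
    if "set \<alpha>s \<subseteq> carrier (aut_free n)" for \<alpha>s
    using that by (induction \<alpha>s) auto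
  then have X: "X \<in> carrier (aut_free n)"
    unfolding X_def using step.prems by (auto simp: image_subset_iff)
  have \<Phi>: "\<Phi> k \<in> carrier (aut_free n)" "\<Phi> (Suc k) \<in> carrier (aut_free n)"
    using step by auto
  have "\<Phi> (Suc k) \<otimes>\<^bsub>aut_free n\<^esub> (?\<Psi> k \<otimes>\<^bsub>aut_free n\<^esub> X) = \<Phi> k \<otimes>\<^bsub>aut_free n\<^esub> X"
    using X \<Phi> by (simp add: aut_free.m_assoc)
  with step show ?case
    by (simp add: X_def)
qed

text \<open>A fold that leaves the automorphism unchanged gives the identity as a factor; this
  counts as a Whitehead automorphism because it lies in W_n.\<close>

lemma one_signed_perm: "\<one>\<^bsub>aut_free n\<^esub> \<in> signed_perm_auts n"
proof -
  have "\<exists>\<sigma> \<epsilon>. \<sigma> permutes {..<n} \<and> (\<forall>i<n. \<one>\<^bsub>aut_free n\<^esub> [(i, True)] = [(\<sigma> i, \<epsilon> i)])"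
    by (intro exI [of _ id] exI [of _ "\<lambda>_. True"]) (simp add: permutes_id one_aut_free)
  then show ?thesis
    using aut_free.one_closed by (simp add: signed_perm_auts_def)
qed

theorem mainTheorem1:
  fixes n :: nat
    and \<phi> :: "letter list \<Rightarrow> letter list"
    and w :: "nat \<Rightarrow> letter list"
    and N :: int
    and c :: "nat \<Rightarrow> nat"
  assumes "n \<ge> 1"
    and "\<phi> \<in> carrier (aut_free n)"
    and "\<And>i. i < n \<Longrightarrow> w i = \<phi> [(i, True)]"
    and "N = (\<Sum>i<n. int (length (w i))) - int n"
    and "\<And>i. i < n \<Longrightarrow> c i < length (w i)"
  shows "\<exists>(\<G> :: nat \<Rightarrow> (sr_vertex, sr_edge) branded) (k :: nat) (ms :: move list).
    let \<Phi> = (\<lambda>j. assoc_aut n (\<G> j));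
        \<Psi> = (\<lambda>j. inv\<^bsub>aut_free n\<^esub> (\<Phi> (Suc j)) \<otimes>\<^bsub>aut_free n\<^esub> \<Phi> j);
        factors = \<Phi> k # map \<Psi> (rev [1..<k])
    in k \<ge> 1 \<and> (\<forall>j \<in> {1..k}. branded_graph n (\<G> j)) \<and>
       \<G> 1 = subdivided_rose n \<phi> c \<and> \<Phi> 1 = \<phi> \<and>
       length ms = k - 1 \<and>
       (\<forall>j \<in> {1..<k}. move_step (ms ! (j - 1)) (\<G> j) (\<G> (Suc j))) \<and>
       int (count_list ms Fold) = N \<and>
       (\<forall>j < length ms. ms ! j = Fold \<longrightarrow> preceding_swaps ms j \<le> 2) \<and>
       (\<forall>j < length ms. ms ! j = Swap \<longrightarrow> (\<exists>j'. j < j' \<and> j' < length ms \<and> ms ! j' = Fold)) \<and>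
       (\<forall>j \<in> {1..<k}. \<Psi> j = \<one>\<^bsub>aut_free n\<^esub> \<or> \<Psi> j \<in> whitehead_pair_auts n) \<and>
       graph_isomorphism (ugraph (\<G> k)) (rose n) (marking (\<G> k)) \<and>
       \<Phi> k \<in> signed_perm_auts n \<and>
       \<phi> = foldr (\<lambda>\<alpha> \<beta>. \<alpha> \<otimes>\<^bsub>aut_free n\<^esub> \<beta>) factors \<one>\<^bsub>aut_free n\<^esub> \<and>
       set factors \<subseteq> whitehead_automorphisms n"
proof -
  define u where "u i = \<phi> [(i, True)]" for i
  have hom: "\<phi> \<in> hom (free_grp n) (free_grp n)"
    using assms(2) by (simp add: carrier_aut_free)
  have u: "u i \<in> carrier (free_grp n)" if "i < n" for i
    using hom_in_carrier [OF hom, of "[(i, True)]"] that by (simp add: u_def)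
  have c: "c i < length (u i)" if "i < n" for i
    using assms(3,5) that by (simp add: u_def)
  have rose_eq: "subdivided_rose n \<phi> c = sr_branded n u c"
    by (simp add: sr_branded_def subdivided_rose_def Let_def u_def [abs_def])
  have "assoc_aut n (sr_branded n u c) = free_ext n u"
    using u c by (rule sr_assoc_aut)
  also have "\<dots> = \<phi>"
    by (rule free_ext_of_aut [OF assms(2)]) (rule u_def)
  finally have \<phi>: "assoc_aut n (sr_branded n u c) = \<phi>" .
  define m where "m = (\<Sum>i<n. length (u i) - 1)"
  have "pre_branded n (sr_branded n u c)"
    using u c by (rule sr_pre_branded)
  then have "good n (sr_branded n u c)"
    using assms(2) \<phi> by (simp add: good_def)
  moreover have "card (verts (sr_graph n u)) = Suc m"
    unfolding m_def using u c by (rule card_sr_verts)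
  then have "card (verts (ugraph (sr_branded n u c))) = Suc m"
    by (simp add: sr_branded_def)
  ultimately obtain ms \<H> where run: "run n ms (sr_branded n u c # \<H>)" and blocks: "fold_blocks m ms"
    and iso: "graph_isomorphism (ugraph (last (sr_branded n u c # \<H>))) (rose n) (marking (last (sr_branded n u c # \<H>)))"
    and perm: "assoc_aut n (last (sr_branded n u c # \<H>)) \<in> signed_perm_auts n"
    using run_to_rose by blast
  define k where "k = length (sr_branded n u c # \<H>)"
  \<comment> \<open>The sequence is counted from 1, the list from 0.\<close>
  define \<G> where "\<G> j = (sr_branded n u c # \<H>) ! (j - 1)" for j
  define \<Phi> where "\<Phi> = (\<lambda>j. assoc_aut n (\<G> j))"
  define \<Psi> where "\<Psi> = (\<lambda>j. inv\<^bsub>aut_free n\<^esub> (\<Phi> (Suc j)) \<otimes>\<^bsub>aut_free n\<^esub> \<Phi> j)"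
  define factors where "factors = \<Phi> k # map \<Psi> (rev [1..<k])"
  have k: "k \<ge> 1" "length ms = k - 1"
    using run_nth [OF run] by (simp_all add: k_def)
  have good: "good n (\<G> j)" if "j \<in> {1..k}" for j
    using run_nth [OF run] that by (auto simp: \<G>_def k_def)
  have move: "whitehead_move n (ms ! (j - 1)) (\<G> j) (\<G> (Suc j))" if "j \<in> {1..<k}" for j
  proof -
    have "j - 1 < length ms" "Suc (j - 1) = j" using that k by auto
    then show ?thesis using run_nth [OF run] by (metis \<G>_def diff_Suc_1)
  qed
  have \<Psi>: "\<Psi> j = \<one>\<^bsub>aut_free n\<^esub> \<or> \<Psi> j \<in> whitehead_pair_auts n" if "j \<in> {1..<k}" for j
    using move [OF that] by (simp add: whitehead_move_def \<Psi>_def \<Phi>_def)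
  have \<G>k: "\<G> k = last (sr_branded n u c # \<H>)"
    by (simp add: \<G>_def k_def last_conv_nth)
  have \<G>1: "\<G> 1 = subdivided_rose n \<phi> c"
    by (simp add: \<G>_def rose_eq)
  have \<Phi>1: "\<Phi> 1 = \<phi>"
    using \<phi> by (simp add: \<Phi>_def \<G>_def)
  have "N = int m"
  proof -
    \<comment> \<open>The bound on \<open>c i\<close> makes every word nonempty, so the truncated
      subtraction in \<open>m\<close> is exact.\<close>
    have "int (length (w i)) = int (length (u i) - 1) + 1" if "i < n" for i
      using assms(3) [OF that] c [OF that] by (simp add: u_def)
    then show ?thesis
      by (simp add: assms(4) m_def sum.distrib)
  qed
  then have count: "int (count_list ms Fold) = N"
    by (simp add: count_list_fold_blocks [OF blocks])
  have last_fold: "\<exists>j'. j < j' \<and> j' < length ms \<and> ms ! j' = Fold" if "j < length ms" "ms ! j = Swap" for j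
  proof -
    have "ms \<noteq> []" using that by auto
    \<comment> \<open>The final move is a fold and serves as the later fold for every swap.\<close>
    then have "ms ! (length ms - 1) = Fold"
      using last_fold_blocks [OF blocks] by (simp add: last_conv_nth)
    moreover from this have "j \<noteq> length ms - 1" using that by auto
    ultimately show ?thesis
      using that by (intro exI [of _ "length ms - 1"]) auto
  qed
  have product: "\<phi> = foldr (\<lambda>\<alpha> \<beta>. \<alpha> \<otimes>\<^bsub>aut_free n\<^esub> \<beta>) factors \<one>\<^bsub>aut_free n\<^esub>"
    using telescoping_product [of k \<Phi> n] good k \<Phi>1
    by (simp add: factors_def \<Psi>_def good_def \<Phi>_def)
  have "set factors \<subseteq> whitehead_automorphisms n"
  proof -
    have "\<Psi> j \<in> whitehead_automorphisms n" if "j \<in> {1..<k}" for j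
      using \<Psi> [OF that] one_signed_perm [of n] by (auto simp: whitehead_automorphisms_def)
    moreover have "\<Phi> k \<in> whitehead_automorphisms n"
      using perm by (simp add: whitehead_automorphisms_def \<Phi>_def \<G>k)
    ultimately show ?thesis
      by (auto simp: factors_def)
  qed
  then have "k \<ge> 1 \<and> (\<forall>j \<in> {1..k}. branded_graph n (\<G> j)) \<and>
       \<G> 1 = subdivided_rose n \<phi> c \<and> \<Phi> 1 = \<phi> \<and>
       length ms = k - 1 \<and>
       (\<forall>j \<in> {1..<k}. move_step (ms ! (j - 1)) (\<G> j) (\<G> (Suc j))) \<and>
       int (count_list ms Fold) = N \<and>
       (\<forall>j < length ms. ms ! j = Fold \<longrightarrow> preceding_swaps ms j \<le> 2) \<and>
       (\<forall>j < length ms. ms ! j = Swap \<longrightarrow> (\<exists>j'. j < j' \<and> j' < length ms \<and> ms ! j' = Fold)) \<and>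
       (\<forall>j \<in> {1..<k}. \<Psi> j = \<one>\<^bsub>aut_free n\<^esub> \<or> \<Psi> j \<in> whitehead_pair_auts n) \<and>
       graph_isomorphism (ugraph (\<G> k)) (rose n) (marking (\<G> k)) \<and>
       \<Phi> k \<in> signed_perm_auts n \<and>
       \<phi> = foldr (\<lambda>\<alpha> \<beta>. \<alpha> \<otimes>\<^bsub>aut_free n\<^esub> \<beta>) factors \<one>\<^bsub>aut_free n\<^esub> \<and>
       set factors \<subseteq> whitehead_automorphisms n"
    using k good_branded [OF good] \<G>1 \<Phi>1 move count preceding_swaps_fold_blocks [OF blocks] last_fold \<Psi>
      iso perm \<G>k product
    by (simp add: \<Phi>_def whitehead_move_def)
  then show ?thesis
    unfolding Let_def factors_def \<Psi>_def \<Phi>_def by blast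
qed


end
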